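(* Let $\mathcal H=\{(x_1,x_2)\in\mathbb R^2\mid x_1^2x_2=1,\ x_1>0\}$ be the homogeneous PSR curve, with cubic polynomial $h=x_1^2x_2$ and arc-length parameter $s=\sqrt6\log(x_1)$, and let $\overline N\to\mathcal H$ be the associated tree-level q-map space. After taking a quotient of $\overline N\to\mathcal H$ by a lattice in the fiber-preserving group $\mathrm{SL}(2,\mathbb R)\ltimes\exp(\mathfrak n)\subset\mathrm{Iso}(\overline N)$, the fiber-wise volume increases exponentially along $\mathcal H$ for $s\to\infty$, and decreases exponentially for $s\to-\infty$. In particular, the total volume is infinite.
   Context: Conventions: here $n=2$, the coordinates $(t^1,t^2)$ of $\mathbb R^2$ are written $(x_1,x_2)$; indices $a,b,c,\dots$ run from $1$ to $n$, indices $i,j,k,\dots$ from $0$ to $n$; repeated indices are summed. Write $h(t)=\frac16k_{abc}t^at^bt^c$ with $k_{abc}$ symmetric; $g_{\mathcal H}=-\partial^2h|_{T\mathcal H\times T\mathcal H}$. Tree-level q-map space: put $U=\mathbb R_{>0}\cdot\mathcal H\subset\mathbb R^n$, $\overline M=\mathbb R^n+iU\subset\mathbb C^n$ with coordinates $z^a=b^a+it^a$, $z^0:=1$, $K(t)=8h(t)$, $\mathcal K=-\log K$, and $g_{\overline M}=\frac{\partial^2\mathcal K}{\partial z^a\partial\overline z^b}dz^ad\overline z^b=-\frac14\frac{\partial^2\log h}{\partial t^a\partial t^b}(db^adb^b+dt^adt^b)$. Let $\mathfrak F(X)=-h(X^1,\dots,X^n)/X^0$, $\tau_{ij}=\frac{\partial^2\mathfrak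 F}{\partial X^i\partial X^j}$ evaluated at $X=(1,z)$, $N_{ij}=-2\,\mathrm{Im}(\tau_{ij})$, $(N^{ij})=(N_{ij})^{-1}$, $W_i=d\widetilde\zeta_i-\tau_{ij}d\zeta^j$; then $K=N_{ij}z^i\overline z^j$. The tree-level q-map space is $\overline N=\overline M\times\mathbb R_{>0}\times\mathbb R^{2n+2}\times\mathbb R$ with global ("type IIA") coordinates $(z^a,\rho,\widetilde\zeta_i,\zeta^i,\sigma)$ and metric $$g_{\overline N}=g_{\overline M}+\frac{d\rho^2}{4\rho^2}-\frac1{4\rho}\Big(N^{ij}-\frac2Kz^i\overline z^j\Big)W_i\overline W_j+\frac1{64\rho^2}\big(d\sigma+\widetilde\zeta_id\zeta^i-\zeta^id\widetilde\zeta_i\big)^2 .$$ The projection $\overline N\to\mathcal H$ is $(z^a=b^a+it^a,\rho,\widetilde\zeta_i,\zeta^i,\sigma)\mapsto(t^a/h(t)^{1/3})$. For a lattice $\Gamma$, the fiber-wise volume is the volume of the fibers of $\overline N/\Gamma\to\mathcal H$ with respect to the metric induced by $g_{\overline N}$, as a function on $\mathcal H$. Group: $\mathfrak n=\mathrm{span}\{V_a,Z,P_a,X^i\}$ with $P_a=\partial_{\zeta^a}+\widetilde\zeta_a\partial_\sigma$, $X^i=\partial_{\widetilde\zeta_i}-\zeta^i\partial_\sigma$, $Z=\partial_\sigma$, $V_a=\partial_{b^a}+\zeta^0\partial_{\zeta^a}-\widetilde\zeta_a\partial_{\widetilde\zeta_0}-k_{abc}\zeta^c\partial_{\widetilde\zeta_b}$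 (Killing fields), and $\mathrm{SL}(2,\mathbb R)$ acts isometrically by S-duality: "type IIB" global coordinates $(b^a+it^a,\tau_1+i\tau_2,c^a,c_a,c_0,\psi)$ on $\overline N$ (with $\tau_2>0$) are defined by $\rho=\frac{\tau_2^2}{2}h(t)$, $z^a=b^a+it^a$, $\zeta^0=\tau_1$, $\zeta^a=-(c^a-\tau_1b^a)$, $\widetilde\zeta_a=c_a+\frac{k_{abc}}2b^b(c^c-\tau_1b^c)$, $\widetilde\zeta_0=c_0-\frac{k_{abc}}6b^ab^b(c^c-\tau_1b^c)$, $\sigma=-2(\psi+\frac12\tau_1c_0)+c_a(c^a-\tau_1b^a)-\frac{k_{abc}}6b^ac^b(c^c-\tau_1b^c)$, and $\begin{pmatrix}a&b\\ c&d\end{pmatrix}\in\mathrm{SL}(2,\mathbb R)$ acts, with $\tau=\tau_1+i\tau_2$, by $$\tau\mapsto\frac{a\tau+b}{c\tau+d},\quad t^a\mapsto|c\tau+d|t^a,\quad c_a\mapsto c_a,\quad\begin{pmatrix}c^a\\ b^a\end{pmatrix}\mapsto\begin{pmatrix}a&b\\ c&d\end{pmatrix}\begin{pmatrix}c^a\\ b^a\end{pmatrix},\quad\begin{pmatrix}c_0\\ \psi\end{pmatrix}\mapsto\begin{pmatrix}d&-c\\ -b&a\end{pmatrix}\begin{pmatrix}c_0\\ \psi\end{pmatrix}.$$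
   Formalization: Whole fibers of the quotient have infinite volume for every lattice, so their growth law C·exp(κs), κ>0, is stated allowing C=∞; the same law is added for every Borel region of the fibers, with C>0 for open nonempty and C finite for relatively compact regions. *)

theory Defs
  imports "HOL-Analysis.Analysis" "HOL-Algebra.Bij"
begin

section \<open>Generalities\<close>

definition partial :: "'n::finite \<Rightarrow> ('a::real_normed_field ^ 'n \<Rightarrow> 'a) \<Rightarrow> 'a ^ 'n \<Rightarrow> 'a" where
  "partial i f x = deriv (\<lambda>u. f (x + axis i u)) 0"

text \<open>Riemannian volume measure of the submanifold \<open>\<phi> ` D\<close> with the metric induced by \<open>g\<close>, where
  \<open>\<phi>\<close> is an injective immersion of the open set \<open>D\<close>, i.e. a global parametrisation.\<close>

definition gram :: "('p::real_normed_vector \<Rightarrow> 'p \<Rightarrow> 'p \<Rightarrow> real) \<Rightarrow> (real^'m \<Rightarrow> 'p) \<Rightarrow> real^'m \<Rightarrow> real^'m^'m"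
  where "gram g \<phi> q = (\<chi> i j. g (\<phi> q) (frechet_derivative \<phi> (at q) (axis i 1))
                                   (frechet_derivative \<phi> (at q) (axis j 1)))"

definition riem_measure ::
  "('p::real_normed_vector \<Rightarrow> 'p \<Rightarrow> 'p \<Rightarrow> real) \<Rightarrow> (real^'m \<Rightarrow> 'p) \<Rightarrow> (real^'m) set \<Rightarrow> 'p measure"
  where "riem_measure g \<phi> D =
    distr (density lborel (\<lambda>q. indicator D q * ennreal (sqrt (det (gram g \<phi> q))))) borel \<phi>"

text \<open>Volume of the image of \<open>E\<close> in the quotient by the group of transformations \<open>\<Gamma>\<close> (which is to
  preserve the measure \<open>\<mu>\<close> and to act properly discontinuously).  The quotient measure is
  characterised by being \<open>\<mu> B\<close> on the image of every measurable set \<open>B\<close> on which the quotient map is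
  injective; the supremum is attained at a measurable fundamental domain.  Using it avoids the
  choice of such a domain.\<close>

definition quot_vol :: "'p measure \<Rightarrow> ('p \<Rightarrow> 'p) set \<Rightarrow> 'p set \<Rightarrow> ennreal" where
  "quot_vol \<mu> \<Gamma> E =
    (SUP B \<in> {B \<in> sets \<mu>. B \<subseteq> E \<and> (\<forall>p\<in>B. \<forall>\<gamma>\<in>\<Gamma>. \<gamma> p \<in> B \<longrightarrow> \<gamma> p = p)}. emeasure \<mu> B)"


section \<open>The projective special real curve\<close>

text \<open>Indices \<open>a, b, c\<close> have type \<open>2\<close>, whose elements are \<open>1\<close> and \<open>2 = 0\<close>; indices \<open>i, j\<close> running
  from \<open>0\<close> to \<open>n = 2\<close> have type \<open>2 option\<close>, with \<open>None\<close> in the role of \<open>0\<close>.\<close>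

definition hpoly :: "'a::real_normed_field ^ 2 \<Rightarrow> 'a" where
  "hpoly x = (x $ 1)\<^sup>2 * x $ 2"

definition kcoef :: "2 \<Rightarrow> 2 \<Rightarrow> 2 \<Rightarrow> real" where
  "kcoef a b c = (if (a, b, c) \<in> {(1, 1, 2), (1, 2, 1), (2, 1, 1)} then 2 else 0)"

definition kform :: "real^2 \<Rightarrow> real^2 \<Rightarrow> real^2 \<Rightarrow> real" where
  "kform u v w = (\<Sum>a\<in>UNIV. \<Sum>b\<in>UNIV. \<Sum>c\<in>UNIV. kcoef a b c * u $ a * v $ b * w $ c)"

definition kvec :: "real^2 \<Rightarrow> real^2 \<Rightarrow> real^2" where
  "kvec v w = (\<chi> a. \<Sum>b\<in>UNIV. \<Sum>c\<in>UNIV. kcoef a b c * v $ b * w $ c)"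

lemma hpoly_eq_kform: "hpoly t = kform t t t / 6"
  by (simp add: hpoly_def kform_def kcoef_def sum_2 power2_eq_square)

definition \<H> :: "(real^2) set" where
  "\<H> = {x. (x $ 1)\<^sup>2 * x $ 2 = 1 \<and> x $ 1 > 0}"

definition g_PSR :: "real^2 \<Rightarrow> real^2 \<Rightarrow> real^2 \<Rightarrow> real" where
  "g_PSR x v w = - (\<Sum>a\<in>UNIV. \<Sum>b\<in>UNIV. partial a (partial b hpoly) x * v $ a * w $ b)"

text \<open>The arc-length parameter, with inverse \<open>H_curve\<close> (see the lemmas below).\<close>

definition arc_param :: "real^2 \<Rightarrow> real" where
  "arc_param x = sqrt 6 * ln (x $ 1)"

definition H_curve :: "real \<Rightarrow> real^2" where
  "H_curve s = vector [exp (s / sqrt 6), exp (- 2 * s / sqrt 6)]"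

lemma H_curve:
  "H_curve s \<in> \<H>" "arc_param (H_curve s) = s" "x \<in> \<H> \<Longrightarrow> H_curve (arc_param x) = x"
proof -
  show "H_curve s \<in> \<H>"
    by (simp add: \<H>_def H_curve_def flip: exp_double exp_add)
  show "arc_param (H_curve s) = s"
    by (simp add: arc_param_def H_curve_def)
  assume x: "x \<in> \<H>"
  then have "exp (- 2 * ln (x $ 1)) = x $ 2"
    by (simp add: \<H>_def exp_minus exp_double field_simps)
  with x show "H_curve (arc_param x) = x"
    by (simp add: vec_eq_iff forall_2 H_curve_def arc_param_def \<H>_def)
qed

lemma H_curve_unit_speed:
  "\<exists>v. (H_curve has_vector_derivative v) (at s) \<and> g_PSR (H_curve s) v v = 1"
proof (intro exI conjI)
  let ?v = "vector [exp (s / sqrt 6) / sqrt 6, - 2 * exp (- 2 * s / sqrt 6) / sqrt 6] :: real^2"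
  show "(H_curve has_vector_derivative ?v) (at s)"
  proof -
    have "H_curve = (\<lambda>s. exp (s / sqrt 6) *\<^sub>R axis 1 1 + exp (- 2 * s / sqrt 6) *\<^sub>R axis 2 1)"
      by (simp add: fun_eq_iff vec_eq_iff forall_2 H_curve_def axis_def)
    note H = this
    have v: "?v = (exp (s / sqrt 6) / sqrt 6) *\<^sub>R axis 1 1
        + (- 2 * exp (- 2 * s / sqrt 6) / sqrt 6) *\<^sub>R axis 2 1"
      by (simp add: vec_eq_iff forall_2 axis_def)
    show ?thesis
      unfolding H v has_vector_derivative_def
      by (rule derivative_eq_intros refl | simp)+
        (simp add: fun_eq_iff vec_eq_iff forall_2 axis_def field_simps)
  qed
  have d1: "partial b hpoly = (\<lambda>x::real^2. if b = 1 then 2 * x $ 1 * x $ 2 else (x $ 1)\<^sup>2)" for b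
  proof -
    have "((\<lambda>u. hpoly (x + axis b u)) has_real_derivative
            (if b = 1 then 2 * x $ 1 * x $ 2 else (x $ 1)\<^sup>2)) (at 0)" for x :: "real^2"
      using exhaust_2[of b] by (auto simp: hpoly_def axis_def intro!: derivative_eq_intros)
    then show ?thesis
      unfolding partial_def by (intro ext) (simp add: DERIV_imp_deriv)
  qed
  have d2: "partial a (partial b hpoly) x = (if a = 1 then if b = 1 then 2 * x $ 2 else 2 * x $ 1
      else if b = 1 then 2 * x $ 1 else 0)" for a b and x :: "real^2"
  proof -
    have "((\<lambda>u. (partial b hpoly) (x + axis a u)) has_real_derivative
        (if a = 1 then if b = 1 then 2 * x $ 2 else 2 * x $ 1
         else if b = 1 then 2 * x $ 1 else 0)) (at 0)"
      using exhaust_2[of a] exhaust_2[of b] unfolding d1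
      by (auto simp: axis_def intro!: derivative_eq_intros)
    then show ?thesis
      unfolding partial_def[of a] by (simp add: DERIV_imp_deriv)
  qed
  have "exp (s / sqrt 6) * exp (s / sqrt 6) * exp (- 2 * s / sqrt 6) = 1"
    by (simp flip: exp_add)
  then show "g_PSR (H_curve s) ?v ?v = 1"
    by (simp add: g_PSR_def d2 sum_2 H_curve_def field_simps)
qed

definition \<U> :: "(real^2) set" where
  "\<U> = {r *\<^sub>R x | r x. r > 0 \<and> x \<in> \<H>}"


section \<open>The tree-level q-map space\<close>

text \<open>Points \<open>(z, \<rho>, \<zeta>t, \<zeta>, \<sigma>)\<close> in type IIA coordinates, \<open>\<zeta>t\<close> standing for the variables
  \<open>\<zeta>\<close>-tilde. The same type serves for tangent vectors.\<close>

type_synonym pt = "(complex^2) \<times> real \<times> (real ^ 2 option) \<times> (real ^ 2 option) \<times> real"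

definition ImV :: "complex^2 \<Rightarrow> real^2" where "ImV z = (\<chi> a. Im (z $ a))"
definition ReV :: "complex^2 \<Rightarrow> real^2" where "ReV z = (\<chi> a. Re (z $ a))"
definition cvec :: "real^2 \<Rightarrow> real^2 \<Rightarrow> complex^2" where "cvec b t = (\<chi> a. Complex (b $ a) (t $ a))"

definition vec0 :: "'a \<Rightarrow> 'a^2 \<Rightarrow> 'a ^ 2 option" where
  "vec0 x y = (\<chi> i. case i of None \<Rightarrow> x | Some a \<Rightarrow> y $ a)"
definition spatial :: "'a ^ 2 option \<Rightarrow> 'a^2" where
  "spatial y = (\<chi> a. y $ Some a)"

definition Nbar :: "pt set" where
  "Nbar = {(z, \<rho>, \<zeta>t, \<zeta>, \<sigma>). ImV z \<in> \<U> \<and> \<rho> > 0}"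

definition prepot :: "complex ^ 2 option \<Rightarrow> complex" where
  "prepot X = - hpoly (spatial X) / X $ None"

definition tau_mat :: "complex^2 \<Rightarrow> complex ^ 2 option ^ 2 option" where
  "tau_mat z = (\<chi> i j. partial i (partial j prepot) (vec0 1 z))"

definition N_mat :: "complex^2 \<Rightarrow> real ^ 2 option ^ 2 option" where
  "N_mat z = (\<chi> i j. - 2 * Im (tau_mat z $ i $ j))"

definition W_form :: "complex^2 \<Rightarrow> real ^ 2 option \<Rightarrow> real ^ 2 option \<Rightarrow> complex ^ 2 option" where
  "W_form z d\<zeta>t d\<zeta> = (\<chi> i. complex_of_real (d\<zeta>t $ i)
                    - (\<Sum>j\<in>UNIV. tau_mat z $ i $ j * complex_of_real (d\<zeta> $ j)))"

definition g_M :: "complex^2 \<Rightarrow> complex^2 \<Rightarrow> complex^2 \<Rightarrow> real" where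
  "g_M z v w = - 1 / 4 * (\<Sum>a\<in>UNIV. \<Sum>b\<in>UNIV.
      partial a (partial b (\<lambda>t. ln (hpoly t))) (ImV z)
        * (Re (v $ a) * Re (w $ b) + Im (v $ a) * Im (w $ b)))"

text \<open>The coefficients of \<open>W\<^sub>i\<close> times the conjugate of \<open>W\<^sub>j\<close> form a Hermitian matrix, so the
  symmetric bilinear form that belongs to the quadratic expression is the real part taken below.\<close>

definition g_N :: "pt \<Rightarrow> pt \<Rightarrow> pt \<Rightarrow> real" where
  "g_N = (\<lambda>(z, \<rho>, \<zeta>t, \<zeta>, \<sigma>) (v, v\<rho>, v\<zeta>t, v\<zeta>, v\<sigma>) (w, w\<rho>, w\<zeta>t, w\<zeta>, w\<sigma>).
     let K = 8 * hpoly (ImV z); z0 = vec0 1 z in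
       g_M z v w
     + v\<rho> * w\<rho> / (4 * \<rho>\<^sup>2)
     - 1 / (4 * \<rho>) * Re (\<Sum>i\<in>UNIV. \<Sum>j\<in>UNIV.
         (complex_of_real (matrix_inv (N_mat z) $ i $ j)
            - 2 / complex_of_real K * z0 $ i * cnj (z0 $ j))
         * W_form z v\<zeta>t v\<zeta> $ i * cnj (W_form z w\<zeta>t w\<zeta> $ j))
     + 1 / (64 * \<rho>\<^sup>2) * (v\<sigma> + \<zeta>t \<bullet> v\<zeta> - \<zeta> \<bullet> v\<zeta>t) * (w\<sigma> + \<zeta>t \<bullet> w\<zeta> - \<zeta> \<bullet> w\<zeta>t))"

definition proj :: "pt \<Rightarrow> real^2" where
  "proj = (\<lambda>(z, \<rho>, \<zeta>t, \<zeta>, \<sigma>). (1 / root 3 (hpoly (ImV z))) *\<^sub>R ImV z)"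

definition fiber :: "real^2 \<Rightarrow> pt set" where
  "fiber x = {p \<in> Nbar. proj p = x}"

text \<open>Global parametrisations, by \<open>(b, r, \<rho>, \<zeta>t, \<zeta>, \<sigma>)\<close> with \<open>t = r x\<close> of the fiber over \<open>x\<close>, and by
  \<open>(b, t, \<rho>, \<zeta>t, \<zeta>, \<sigma>)\<close> of the whole space.\<close>

definition fiber_chart :: "real^2 \<Rightarrow> real^11 \<Rightarrow> pt" where
  "fiber_chart x q = (cvec (vector [q $ 1, q $ 2]) (q $ 3 *\<^sub>R x), q $ 4,
     vec0 (q $ 5) (vector [q $ 6, q $ 7]), vec0 (q $ 8) (vector [q $ 9, q $ 10]), q $ 11)"

definition fiber_dom :: "(real^11) set" where
  "fiber_dom = {q. q $ 3 > 0 \<and> q $ 4 > 0}"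

definition total_chart :: "real^12 \<Rightarrow> pt" where
  "total_chart q = (cvec (vector [q $ 1, q $ 2]) (vector [q $ 3, q $ 4]), q $ 5,
     vec0 (q $ 6) (vector [q $ 7, q $ 8]), vec0 (q $ 9) (vector [q $ 10, q $ 11]), q $ 12)"

lemma bij_betw_fiber_chart:
  assumes "x \<in> \<H>"
  shows "bij_betw (fiber_chart x) fiber_dom (fiber x)"
proof -
  have x: "x $ 1 > 0" "(x $ 1)\<^sup>2 * x $ 2 = 1"
    using assms by (auto simp: \<H>_def)
  then have x0: "x \<noteq> 0" by auto
  have r: "root 3 (hpoly (r *\<^sub>R x)) = r" if "r > 0" for r
  proof -
    have "hpoly (r *\<^sub>R x) = r ^ 3 * ((x $ 1)\<^sup>2 * x $ 2)"
      by (simp add: hpoly_def power2_eq_square power3_eq_cube)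
    with x that show ?thesis by (simp add: real_root_power_cancel)
  qed
  have eqI: "p = q" if "p $ 1 = q $ 1" "p $ 2 = q $ 2" "p $ 3 = q $ 3" "p $ 4 = q $ 4" "p $ 5 = q $ 5"
      "p $ 6 = q $ 6" "p $ 7 = q $ 7" "p $ 8 = q $ 8" "p $ 9 = q $ 9" "p $ 10 = q $ 10" "p $ 11 = q $ 11"
    for p q :: "real^11"
  proof -
    have "p $ i = q $ i" for i
    proof (cases i rule: bit1_cases)
      case (of_int z)
      then have "z \<in> {0..<11}" by simp
      also have "{0..<11} = {0,1,2,3,4,5,6,7,8,9,10::int}"
        unfolding set_eq_iff atLeastLessThan_iff insert_iff empty_iff by presburger
      finally have "z \<in> {0,1,2,3,4,5,6,7,8,9,10}" .
      moreover have "(0::11) = 11" by simp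
      then have "p $ 0 = q $ 0" using that(11) by metis
      ultimately show ?thesis using of_int(1) that by auto
    qed
    then show ?thesis by (simp add: vec_eq_iff)
  qed
  show ?thesis
  proof (rule bij_betwI')
    fix p q assume "p \<in> fiber_dom" "q \<in> fiber_dom"
    show "fiber_chart x p = fiber_chart x q \<longleftrightarrow> p = q"
    proof
      assume "fiber_chart x p = fiber_chart x q"
      with x show "p = q"
        by (intro eqI) (auto simp: fiber_chart_def cvec_def vec0_def vec_eq_iff forall_2 split_option_all)
    qed simp
  next
    fix p assume "p \<in> fiber_dom"
    then have p: "p $ 3 > 0" "p $ 4 > 0" by (auto simp: fiber_dom_def)
    have "ImV (cvec b t) = t" for b t by (simp add: ImV_def cvec_def vec_eq_iff)
    with p r[OF p(1)] assms show "fiber_chart x p \<in> fiber x"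
      by (auto simp: fiber_chart_def fiber_def Nbar_def proj_def \<U>_def)
  next
    fix y assume "y \<in> fiber x"
    then obtain z \<rho> \<zeta>t \<zeta> \<sigma> where y: "y = (z, \<rho>, \<zeta>t, \<zeta>, \<sigma>)" "ImV z \<in> \<U>" "\<rho> > 0"
        and eq: "(1 / root 3 (hpoly (ImV z))) *\<^sub>R ImV z = x"
      by (cases y) (auto simp: fiber_def Nbar_def proj_def)
    define r where "r = root 3 (hpoly (ImV z))"
    from y(2) have "hpoly (ImV z) > 0"
      by (auto simp: \<U>_def \<H>_def hpoly_def power_mult_distrib zero_less_mult_iff)
        (metis mult_not_zero not_less_iff_gr_or_eq power2_less_0 zero_less_mult_iff zero_less_one)
    then have "r > 0" by (simp add: r_def)
    then have z: "ImV z = r *\<^sub>R x"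
      unfolding eq[symmetric] by (simp add: r_def)
    define p :: "real^11" where "p = (\<chi> i.
      if i = 1 then Re (z $ 1) else if i = 2 then Re (z $ 2) else if i = 3 then r else if i = 4 then \<rho>
      else if i = 5 then \<zeta>t $ None else if i = 6 then \<zeta>t $ Some 1 else if i = 7 then \<zeta>t $ Some 2
      else if i = 8 then \<zeta> $ None else if i = 9 then \<zeta> $ Some 1 else if i = 10 then \<zeta> $ Some 2
      else \<sigma>)"
    have "z $ a = Complex (Re (z $ a)) (r * x $ a)" for a
      using z by (simp add: ImV_def vec_eq_iff complex_eq_iff)
    then have "y = fiber_chart x p"
      by (simp add: y(1) fiber_chart_def p_def cvec_def vec0_def vec_eq_iff forall_2 split_option_all)
    moreover have "p \<in> fiber_dom"
      using \<open>r > 0\<close> y(3) by (simp add: fiber_dom_def p_def)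
    ultimately show "\<exists>p\<in>fiber_dom. y = fiber_chart x p" by blast
  qed
qed

definition fiber_measure :: "real^2 \<Rightarrow> pt measure" where
  "fiber_measure x = riem_measure g_N (fiber_chart x) fiber_dom"

definition total_measure :: "pt measure" where
  "total_measure = riem_measure g_N total_chart (total_chart -` Nbar)"


section \<open>The group generated by S-duality and the nilpotent Killing fields\<close>

text \<open>Points \<open>(b + i t, \<tau>, c\<^sup>a, c\<^sub>a, c\<^sub>0, \<psi>)\<close> in type IIB coordinates; \<open>cu\<close> and \<open>cd\<close> are \<open>c\<close> with upper
  and with lower index.\<close>

type_synonym iib = "(complex^2) \<times> complex \<times> (real^2) \<times> (real^2) \<times> real \<times> real"

definition IIB :: "iib set" where
  "IIB = {(z, \<tau>, cu, cd, c0, \<psi>). ImV z \<in> \<U> \<and> Im \<tau> > 0}"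

definition of_IIB :: "iib \<Rightarrow> pt" where
  "of_IIB = (\<lambda>(z, \<tau>, cu, cd, c0, \<psi>).
     let b = ReV z; e = cu - Re \<tau> *\<^sub>R b in
       (z, (Im \<tau>)\<^sup>2 / 2 * hpoly (ImV z),
        vec0 (c0 - kform b b e / 6) (cd + (1/2) *\<^sub>R kvec b e),
        vec0 (Re \<tau>) (- e),
        - 2 * (\<psi> + Re \<tau> * c0 / 2) + cd \<bullet> e - kform b cu e / 6))"

definition S_IIB :: "real^2^2 \<Rightarrow> iib \<Rightarrow> iib" where
  "S_IIB A = (\<lambda>(z, \<tau>, cu, cd, c0, \<psi>).
     let a = A $ 1 $ 1; b = A $ 1 $ 2; c = A $ 2 $ 1; d = A $ 2 $ 2;
         m = complex_of_real c * \<tau> + complex_of_real d in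
       (cvec (c *\<^sub>R cu + d *\<^sub>R ReV z) (cmod m *\<^sub>R ImV z),
        (complex_of_real a * \<tau> + complex_of_real b) / m,
        a *\<^sub>R cu + b *\<^sub>R ReV z, cd, d * c0 - c * \<psi>, - b * c0 + a * \<psi>))"

definition S_dual :: "real^2^2 \<Rightarrow> pt \<Rightarrow> pt" where
  "S_dual A p = of_IIB (S_IIB A (the_inv_into IIB of_IIB p))"

definition field_V :: "2 \<Rightarrow> pt \<Rightarrow> pt" where
  "field_V a = (\<lambda>(z, \<rho>, \<zeta>t, \<zeta>, \<sigma>).
     (axis a 1, 0, vec0 (- \<zeta>t $ Some a) (- kvec (axis a 1) (spatial \<zeta>)), vec0 0 (axis a (\<zeta> $ None)), 0))"

definition field_Z :: "pt \<Rightarrow> pt" where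
  "field_Z p = (0, 0, 0, 0, 1)"

definition field_P :: "2 \<Rightarrow> pt \<Rightarrow> pt" where
  "field_P a = (\<lambda>(z, \<rho>, \<zeta>t, \<zeta>, \<sigma>). (0, 0, 0, axis (Some a) 1, \<zeta>t $ Some a))"

definition field_X :: "2 option \<Rightarrow> pt \<Rightarrow> pt" where
  "field_X i = (\<lambda>(z, \<rho>, \<zeta>t, \<zeta>, \<sigma>). (0, 0, axis i 1, 0, - \<zeta> $ i))"

definition n_alg :: "(pt \<Rightarrow> pt) set" where
  "n_alg = {(\<lambda>p. (\<Sum>a\<in>UNIV. v $ a *\<^sub>R field_V a p) + \<epsilon> *\<^sub>R field_Z p
                + (\<Sum>a\<in>UNIV. y $ a *\<^sub>R field_P a p) + (\<Sum>i\<in>UNIV. x $ i *\<^sub>R field_X i p))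
            | (v :: real^2) (\<epsilon> :: real) (y :: real^2) (x :: real ^ 2 option). True}"

definition time_one_flow :: "('p::real_normed_vector \<Rightarrow> 'p) \<Rightarrow> 'p \<Rightarrow> 'p" where
  "time_one_flow X p = (THE q. \<exists>c. (\<forall>s. (c has_vector_derivative X (c s)) (at s)) \<and> c 0 = p \<and> c 1 = q)"

text \<open>The group \<open>SL(2,\<real>) \<ltimes> exp(n)\<close> as a set of (extensional) transformations of \<open>Nbar\<close>, i.e. as a
  subset of \<^term>\<open>carrier (BijGroup Nbar)\<close>.\<close>

definition \<G> :: "(pt \<Rightarrow> pt) set" where
  "\<G> = {restrict (S_dual A \<circ> time_one_flow X) Nbar | A X. det A = 1 \<and> X \<in> n_alg}"

text \<open>\<open>\<G>\<close> carries the topology of pointwise convergence (the topology of the function type). For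
  a Lie group of isometries that is closed in the isometry group, as \<open>\<G>\<close> is, this is the
  compact-open topology and the Lie group topology.\<close>

definition haar_measure :: "(pt \<Rightarrow> pt) measure \<Rightarrow> bool" where
  "haar_measure \<mu> \<longleftrightarrow>
     space \<mu> = \<G> \<and> sets \<mu> = sets (restrict_space borel \<G>)
   \<and> emeasure \<mu> \<G> \<noteq> 0
   \<and> (\<forall>C. compact C \<and> C \<subseteq> \<G> \<longrightarrow> emeasure \<mu> C < \<infinity>)
   \<and> (\<forall>g\<in>\<G>. \<forall>E\<in>sets \<mu>. emeasure \<mu> (compose Nbar g ` E) = emeasure \<mu> E)"

text \<open>A discrete subgroup of finite covolume. As \<open>\<G>\<close> is unimodular, the choice of the left Haar
  measure is immaterial.\<close>

definition lattice_in_G :: "(pt \<Rightarrow> pt) set \<Rightarrow> bool" where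
  "lattice_in_G \<Gamma> \<longleftrightarrow>
     subgroup \<Gamma> (BijGroup Nbar) \<and> \<Gamma> \<subseteq> \<G> \<and> discrete \<Gamma>
   \<and> (\<exists>\<mu>. haar_measure \<mu> \<and> quot_vol \<mu> (compose Nbar ` \<Gamma>) \<G> < \<infinity>)"

text \<open>The volume of the fiber over \<open>x\<close> of \<open>Nbar / \<Gamma> \<rightarrow> \<H>\<close>; then the volume of the part of it that is
  the image of the region \<open>R\<close> of the common parameter domain of all fibers; then the total
  volume of \<open>Nbar / \<Gamma>\<close>. The transformations in \<open>\<G>\<close> preserve the fibers and read the same in the
  parametrisations of all fibers.

  Pitfall: \<open>u = sqrt (2 \<rho> r)\<close> is invariant under \<open>\<G>\<close>, and the volume of the fiber disintegrates as
  \<open>u\<close> to the power \<open>-8\<close> times \<open>du\<close> times a \<open>\<G>\<close>-invariant measure of the orbits, so that the quotient of a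
  complete fiber has volume \<open>\<infinity>\<close>, due to \<open>u \<rightarrow> 0\<close>. This is why regions of the fiber are considered
  as well.\<close>

definition fiber_volume :: "(pt \<Rightarrow> pt) set \<Rightarrow> real^2 \<Rightarrow> ennreal" where
  "fiber_volume \<Gamma> x = quot_vol (fiber_measure x) \<Gamma> (fiber x)"

definition region_volume :: "(pt \<Rightarrow> pt) set \<Rightarrow> (real^11) set \<Rightarrow> real^2 \<Rightarrow> ennreal" where
  "region_volume \<Gamma> R x = quot_vol (fiber_measure x) \<Gamma> (fiber_chart x ` R)"

definition total_volume :: "(pt \<Rightarrow> pt) set \<Rightarrow> ennreal" where
  "total_volume \<Gamma> = quot_vol total_measure \<Gamma> Nbar"

end

theory Submission
  imports Defs
begin

text \<open>The metric is diagonal in an explicit coframe that is unipotent over the coordinate coframe, so the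
  volume density of the fibre over \<open>x\<close> is \<open>x\<^sub>1\<close> times a function of the remaining coordinates only. The group
  commutes with the linear maps of \<open>Nbar\<close> that stretch the imaginary part of \<open>z\<close> by a point of \<open>\<H>\<close>, and these
  identify the fibres with each other; hence volumes in the quotients scale with \<open>x\<^sub>1 = exp (s / sqrt 6)\<close>. That
  they do not vanish is due to proper discontinuity: if discrete group elements moved points near \<open>p\<close> to points
  near \<open>p\<close> infinitely often, their parameters would subconverge, and quotients of consecutive elements
  would tend to the identity.\<close>

section \<open>The metric in an orthogonal coframe\<close>

text \<open>The exponent 1 / sqrt 6 has a single source. In the determinant of the metric the six
  directions of \<open>\<zeta>t\<close> and \<open>\<zeta>\<close> leave only a power of \<rho>,
  because their weights are reciprocal in t in pairs; the radial direction t = r x has weight 3 / (4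
  r^2). Only the two directions of b remember x: they contribute 1 / (t_1 t_2) to the density, and
  x_1^2 x_2 = 1 turns 1 / (x_1 x_2) into x_1. The stretching maps are in general not isometries;
  they multiply volumes by this factor. They commute with the group because it scales t only by
  common factors and because they preserve h, hence \<tau>_2. Subconvergence of parameters is
  properness of the action: \<tau> is an equivariant map to the upper half-plane, where SL(2,R) acts
  properly, and the nilpotent group acts freely, with parameters polynomial in a point and its
  image. Quotients of consecutive elements are formed because a limit of elements of
  \<open>\<Gamma>\<close> is not known to lie in \<open>\<Gamma>\<close>, whereas the quotients do
  and their limit, the identity, is isolated there.\<close>

lemma UNIV_2_option: "(UNIV :: 2 option set) = {None, Some 1, Some 2}"
  by (auto simp: UNIV_option_conv UNIV_2)

lemma sum_2_option: "(\<Sum>i\<in>UNIV. f i) = f None + f (Some 1) + f (Some (2 :: 2))"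
  by (simp add: UNIV_2_option add_ac)

lemma forall_2_option: "(\<forall>i. P i) \<longleftrightarrow> P None \<and> P (Some 1) \<and> P (Some (2 :: 2))"
  by (metis exhaust_2 option.exhaust)

section \<open>Partial derivatives, the period matrix and the inverse of N\<close>

lemma partial_eqI:
  assumes "((\<lambda>u. f (x + axis i u)) has_field_derivative D) (at 0)"
  shows "partial i f x = D"
  using assms by (simp add: partial_def DERIV_imp_deriv)

text \<open>Closed forms of first derivatives hold only where X^0 \<noteq> 0 or t > 0. Both
  conditions are open, so a second derivative may be taken after replacing the inner function near
  the point.\<close>

lemma partial_cong_nbhd:
  fixes x :: "'a::real_normed_field ^ 'n::finite"
  assumes "open S" "x \<in> S" "\<And>y. y \<in> S \<Longrightarrow> f y = g y"
  shows "partial i f x = partial i g x"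
  unfolding partial_def
proof (rule deriv_cong_ev)
  have "((\<lambda>u. x + axis i u) \<longlongrightarrow> x + axis i 0) (nhds (0::'a))"
  proof (intro tendsto_intros)
    show "(axis i \<longlongrightarrow> axis i (0::'a)) (nhds 0)"
      unfolding axis_def
    proof (rule tendsto_vec_lambda)
      show "((\<lambda>u. if k = i then u else 0) \<longlongrightarrow> (if k = i then 0 else (0::'a))) (nhds 0)" for k
        by (cases "k = i") (auto simp: filterlim_ident)
    qed
  qed
  moreover have "x + axis i 0 = x" by (simp add: vec_eq_iff axis_def)
  ultimately show "\<forall>\<^sub>F u in nhds 0. f (x + axis i u) = g (x + axis i u)"
    using topological_tendstoD[of "\<lambda>u. x + axis i u" x "nhds 0" S] assms
    by (auto elim: eventually_mono)
qed simp

lemma partial_prepot: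
  assumes "X $ None \<noteq> 0"
  shows "partial j prepot X = (case j of None \<Rightarrow> (X $ Some 1)\<^sup>2 * X $ Some 2 / (X $ None)\<^sup>2
     | Some a \<Rightarrow> if a = 1 then - 2 * X $ Some 1 * X $ Some 2 / X $ None else - (X $ Some 1)\<^sup>2 / X $ None)"
proof (rule partial_eqI)
  have "j = None \<or> j = Some 1 \<or> j = Some 2"
    by (metis exhaust_2 option.exhaust)
  with assms show "((\<lambda>u. prepot (X + axis j u)) has_field_derivative 
     (case j of None \<Rightarrow> (X $ Some 1)\<^sup>2 * X $ Some 2 / (X $ None)\<^sup>2
     | Some a \<Rightarrow> if a = 1 then - 2 * X $ Some 1 * X $ Some 2 / X $ None else - (X $ Some 1)\<^sup>2 / X $ None)) (at 0)"
    unfolding prepot_def hpoly_def spatial_def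
    by (elim disjE; simp only:) (auto simp: axis_def power2_eq_square intro!: derivative_eq_intros)
qed

lemma tau_mat_eq:
  "tau_mat z $ i $ j = (case i of
     None \<Rightarrow> (case j of None \<Rightarrow> - 2 * (z $ 1)\<^sup>2 * z $ 2 | Some b \<Rightarrow> if b = 1 then 2 * z $ 1 * z $ 2 else (z $ 1)\<^sup>2)
   | Some a \<Rightarrow> (case j of None \<Rightarrow> if a = 1 then 2 * z $ 1 * z $ 2 else (z $ 1)\<^sup>2
       | Some b \<Rightarrow> if a = 1 then if b = 1 then - 2 * z $ 2 else - 2 * z $ 1
           else if b = 1 then - 2 * z $ 1 else 0))" (is "_ = ?D")
proof -
  let ?g = "\<lambda>X :: complex ^ 2 option. (case j of None \<Rightarrow> (X $ Some 1)\<^sup>2 * X $ Some 2 / (X $ None)\<^sup>2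
     | Some a \<Rightarrow> if a = 1 then - 2 * X $ Some 1 * X $ Some 2 / X $ None else - (X $ Some 1)\<^sup>2 / X $ None)"
  have "open {X :: complex ^ 2 option. X $ None \<noteq> 0}"
    by (intro open_Collect_neq continuous_intros)
  then have "partial i (partial j prepot) (vec0 1 z) = partial i ?g (vec0 1 z)"
    by (rule partial_cong_nbhd) (auto simp: vec0_def partial_prepot)
  also have "\<dots> = ?D"
  proof (rule partial_eqI)
    have "i = None \<or> i = Some 1 \<or> i = Some 2" "j = None \<or> j = Some 1 \<or> j = Some 2"
      by (metis exhaust_2 option.exhaust)+
    then show "((\<lambda>u. ?g (vec0 1 z + axis i u)) has_field_derivative ?D) (at 0)"
      by (elim disjE; simp only:) (auto simp: axis_def vec0_def power2_eq_square intro!: derivative_eq_intros)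
  qed
  finally show ?thesis by (simp add: tau_mat_def)
qed

text \<open>log h = 2 log t_1 + log t_2 has a diagonal Hessian, which gives the weights 1 / (2
  t_1^2) and 1 / (4 t_2^2) to the b and the t directions alike.\<close>

lemma g_M_eq:
  assumes "Im (z $ 1) > 0" "Im (z $ 2) > 0"
  shows "g_M z v w = (Re (v $ 1) * Re (w $ 1) + Im (v $ 1) * Im (w $ 1)) / (2 * (Im (z $ 1))\<^sup>2)
     + (Re (v $ 2) * Re (w $ 2) + Im (v $ 2) * Im (w $ 2)) / (4 * (Im (z $ 2))\<^sup>2)"
proof -
  let ?S = "{t :: real^2. t $ 1 > 0 \<and> t $ 2 > 0}"
  have S: "open ?S"
    by (intro open_Collect_conj open_Collect_less continuous_intros)
  have 1: "partial b (\<lambda>t. ln (hpoly t)) t = (if b = 1 then 2 / t $ 1 else 1 / t $ 2)" if "t \<in> ?S" for b and t :: "real^2"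
  proof (rule partial_eqI)
    show "((\<lambda>u. ln (hpoly (t + axis b u))) has_field_derivative (if b = 1 then 2 / t $ 1 else 1 / t $ 2)) (at 0)"
      using that exhaust_2[of b] unfolding hpoly_def
      by (auto simp: axis_def power2_eq_square field_simps intro!: derivative_eq_intros)
  qed
  have 2: "partial a (partial b (\<lambda>t. ln (hpoly t))) t =
    (if a = b then if a = 1 then - 2 / (t $ 1)\<^sup>2 else - 1 / (t $ 2)\<^sup>2 else 0)" if t: "t \<in> ?S" for a b and t :: "real^2"
  proof -
    have "partial a (partial b (\<lambda>t. ln (hpoly t))) t = partial a (\<lambda>t. if b = 1 then 2 / t $ 1 else 1 / t $ 2) t"
      using S t 1 by (rule partial_cong_nbhd) 
    also have "\<dots> = (if a = b then if a = 1 then - 2 / (t $ 1)\<^sup>2 else - 1 / (t $ 2)\<^sup>2 else 0)"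
      using that exhaust_2[of a] exhaust_2[of b]
      by (intro partial_eqI) (auto simp: axis_def power2_eq_square field_simps intro!: derivative_eq_intros)
    finally show ?thesis .
  qed
  have "ImV z \<in> ?S" using assms by (simp add: ImV_def)
  note this [simp] and 2 [OF this, simp]
  show ?thesis
    using assms unfolding g_M_def by (simp add: sum_2) (simp add: ImV_def field_simps)
qed

lemma matrix_inv_eqI:
  fixes A B :: "'a::semiring_1^'n^'n"
  assumes "A ** B = mat 1" "B ** A = mat 1"
  shows "matrix_inv A = B"
proof -
  have "A ** matrix_inv A = mat 1 \<and> matrix_inv A ** A = mat 1"
    unfolding matrix_inv_def using assms by (intro someI_ex[of "\<lambda>A'. A ** A' = mat 1 \<and> A' ** A = mat 1"]) auto
  then show ?thesis
    by (metis assms(1) matrix_mul_assoc matrix_mul_lid matrix_mul_rid)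
qed


lemma N_mat_eq:
  "N_mat z $ i $ j = (let b1 = Re (z $ 1); b2 = Re (z $ 2); t1 = Im (z $ 1); t2 = Im (z $ 2) in
    case i of
     None \<Rightarrow> (case j of None \<Rightarrow> 4 * (2 * b1 * t1 * b2 + (b1\<^sup>2 - t1\<^sup>2) * t2)
       | Some b \<Rightarrow> if b = 1 then - 4 * (b1 * t2 + t1 * b2) else - 4 * b1 * t1)
   | Some a \<Rightarrow> (case j of None \<Rightarrow> if a = 1 then - 4 * (b1 * t2 + t1 * b2) else - 4 * b1 * t1
       | Some b \<Rightarrow> if a = 1 then if b = 1 then 4 * t2 else 4 * t1
           else if b = 1 then 4 * t1 else 0))"
  by (simp add: N_mat_def tau_mat_eq Let_def algebra_simps power2_eq_square split: option.split)

text \<open>\<open>N_mat\<close> at b + i t is congruent to \<open>N_mat\<close> at i t via the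
  unipotent map of the translation b. At b = 0 it splits into the entry - 4 h and the block with
  rows (4 t_2, 4 t_1) and (4 t_1, 0). Inverting both and transporting (1, 0, 0) to (1, b) gives the
  rank-one term and the block free of b.\<close>

lemma matrix_inv_N_mat:
  assumes "Im (z $ 1) > 0" "Im (z $ 2) > 0"
  shows "matrix_inv (N_mat z) $ i $ j = (let t1 = Im (z $ 1); t2 = Im (z $ 2); h = t1\<^sup>2 * t2;
       b = (\<lambda>i. case i of None \<Rightarrow> 1 | Some a \<Rightarrow> Re (z $ a)) in
      - b i * b j / (4 * h) +
     (case i of None \<Rightarrow> 0
   | Some a \<Rightarrow> (case j of None \<Rightarrow> 0
       | Some b \<Rightarrow> if a = 1 then if b = 1 then 0 else 1 / (4 * t1)
           else if b = 1 then 1 / (4 * t1) else - t2 / (4 * t1\<^sup>2))))" (is "_ = ?E i j")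
proof -
  have pos: "Im (z $ 1) \<noteq> 0" "Im (z $ 2) \<noteq> 0" using assms by auto
  have "matrix_inv (N_mat z) = (\<chi> i j. ?E i j)"
  proof (rule matrix_inv_eqI)
    have "(\<Sum>k\<in>UNIV. N_mat z $ i $ k * ?E k j) = (if i = j then 1 else 0)" for i j
    proof -
      have "i = None \<or> i = Some 1 \<or> i = Some 2" "j = None \<or> j = Some 1 \<or> j = Some 2"
        by (metis exhaust_2 option.exhaust)+
      then show ?thesis
        unfolding sum_2_option N_mat_eq Let_def power2_eq_square using pos
        by (elim disjE; simp; (simp add: divide_simps)?; (simp add: algebra_simps)?)
    qed
    then show "N_mat z ** (\<chi> i j. ?E i j) = mat 1"
      by (simp add: matrix_matrix_mult_def mat_def vec_eq_iff)
    then show "(\<chi> i j. ?E i j) ** N_mat z = mat 1"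
      by (simp add: matrix_left_right_inverse)
  qed
  then show ?thesis by simp
qed

text \<open>The coframe at \<open>b + i t\<close> is the pull-back of the one at \<open>i t\<close> by the symplectic transformation
  induced by the translation \<open>b\<close>; at \<open>i t\<close> the part of \<open>g_N\<close> quadratic in \<open>W\<close> is diagonal.\<close>

definition coframe0 :: "real^2 \<Rightarrow> real ^ 2 option \<Rightarrow> real ^ 2 option \<Rightarrow> real" where
  "coframe0 b v\<zeta>t v\<zeta> = v\<zeta>t $ None + b $ 1 * v\<zeta>t $ Some 1 + b $ 2 * v\<zeta>t $ Some 2
     - (b $ 1)\<^sup>2 * b $ 2 * v\<zeta> $ None + 2 * b $ 1 * b $ 2 * v\<zeta> $ Some 1 + (b $ 1)\<^sup>2 * v\<zeta> $ Some 2"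

definition coframeA :: "real^2 \<Rightarrow> real ^ 2 option \<Rightarrow> real ^ 2 option \<Rightarrow> real^2" where
  "coframeA b v\<zeta>t v\<zeta> = (\<chi> a. if a = 1
     then v\<zeta>t $ Some 1 - 2 * b $ 1 * b $ 2 * v\<zeta> $ None + 2 * b $ 2 * v\<zeta> $ Some 1 + 2 * b $ 1 * v\<zeta> $ Some 2
     else v\<zeta>t $ Some 2 - (b $ 1)\<^sup>2 * v\<zeta> $ None + 2 * b $ 1 * v\<zeta> $ Some 1)"

definition coframeB :: "real^2 \<Rightarrow> real ^ 2 option \<Rightarrow> real^2" where
  "coframeB b v\<zeta> = (\<chi> a. v\<zeta> $ Some a - b $ a * v\<zeta> $ None)"

text \<open>K = 8 h makes 2 / K equal to the coefficient 1 / (4 h) of the rank-one term in the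
  inverse of N. Hence both terms are products of pairings, with (1, b) and with z = (1, b) + i (0,
  t); \<open>W0\<close> is the first of these.\<close>

lemma N_W_form_eq:
  assumes "Im (z $ 1) > 0" "Im (z $ 2) > 0"
  defines "t1 \<equiv> Im (z $ 1)" and "t2 \<equiv> Im (z $ 2)"
  defines "W0 \<equiv> \<lambda>W. W $ None + of_real (Re (z $ 1)) * W $ Some 1 + of_real (Re (z $ 2)) * W $ Some 2"
  shows "(\<Sum>i\<in>UNIV. \<Sum>j\<in>UNIV. (complex_of_real (matrix_inv (N_mat z) $ i $ j)
            - 2 / complex_of_real (8 * hpoly (ImV z)) * vec0 1 z $ i * cnj (vec0 1 z $ j)) * V $ i * cnj (W $ j))
     = (- W0 V * cnj (W0 W) - (W0 V + \<i> * (t1 * V $ Some 1 + t2 * V $ Some 2))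
            * cnj (W0 W + \<i> * (t1 * W $ Some 1 + t2 * W $ Some 2))) / (4 * t1\<^sup>2 * t2)
      + (V $ Some 1 * cnj (W $ Some 2) + V $ Some 2 * cnj (W $ Some 1)) / (4 * t1)
      - t2 * V $ Some 2 * cnj (W $ Some 2) / (4 * t1\<^sup>2)"
proof -
  define b1 b2 where "b1 = complex_of_real (Re (z $ 1))" "b2 = complex_of_real (Re (z $ 2))"
  note b = this
  define k m l where "k = complex_of_real (1 / (4 * t1\<^sup>2 * t2))" "m = complex_of_real (1 / (4 * t1))"
    "l = complex_of_real (t2 / (4 * t1\<^sup>2))"
  note kml = this
  let ?b = "\<lambda>i. case i of None \<Rightarrow> 1 | Some a \<Rightarrow> complex_of_real (Re (z $ a))"
  let ?n = "\<lambda>i j. case i of None \<Rightarrow> 0 | Some a \<Rightarrow> (case j of None \<Rightarrow> 0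
       | Some b \<Rightarrow> if a = 1 then if b = 1 then 0 else m else if b = 1 then m else - l)"
  have N: "complex_of_real (matrix_inv (N_mat z) $ i $ j) = - k * ?b i * ?b j + ?n i j" for i j
    unfolding matrix_inv_N_mat[OF assms(1,2)] Let_def t1_def[symmetric] t2_def[symmetric] kml
    by (simp split: option.split)
  have K: "2 / complex_of_real (8 * hpoly (ImV z)) = k"
    by (simp add: hpoly_def ImV_def kml t1_def t2_def)
  have z: "z $ 1 = b1 + \<i> * t1" "z $ 2 = b2 + \<i> * t2"
    by (simp_all add: complex_eq_iff b t1_def t2_def)
  have c: "cnj (z $ 1) = b1 - \<i> * t1" "cnj (z $ 2) = b2 - \<i> * t2"
    by (simp_all add: complex_eq_iff b t1_def t2_def)
  have cb: "cnj b1 = b1" "cnj b2 = b2" by (simp_all add: b)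
  have v: "vec0 1 z $ None = 1" "vec0 1 z $ Some a = z $ a" for a
    by (simp_all add: vec0_def)
  have "(\<Sum>i\<in>UNIV. \<Sum>j\<in>UNIV. (complex_of_real (matrix_inv (N_mat z) $ i $ j)
            - 2 / complex_of_real (8 * hpoly (ImV z)) * vec0 1 z $ i * cnj (vec0 1 z $ j)) * V $ i * cnj (W $ j))
     = k * (- W0 V * cnj (W0 W) - (W0 V + \<i> * (t1 * V $ Some 1 + t2 * V $ Some 2))
            * cnj (W0 W + \<i> * (t1 * W $ Some 1 + t2 * W $ Some 2)))
      + m * (V $ Some 1 * cnj (W $ Some 2) + V $ Some 2 * cnj (W $ Some 1))
      - l * (V $ Some 2 * cnj (W $ Some 2))"
    unfolding sum_2_option N K v c W0_def option.case b[symmetric] unfolding z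
    by (simp add: algebra_simps cb)
  then show ?thesis
    by (simp add: kml)
qed

text \<open>Once the index 0 is contracted with (1, b), the period matrix at b + i t acts on the
  coframe as the one at i t acts on the coordinate forms, so that only t is left beside the coframe
  components.\<close>

lemma W_form_eq:
  fixes z v\<zeta>t v\<zeta>
  defines "t1 \<equiv> Im (z $ 1)" and "t2 \<equiv> Im (z $ 2)" and "b \<equiv> ReV z" and "W \<equiv> W_form z v\<zeta>t v\<zeta>"
  defines "A \<equiv> coframeA b v\<zeta>t v\<zeta>" and "B \<equiv> coframeB b v\<zeta>"
  shows "W $ Some 1 = Complex (A $ 1 + 2 * t1 * t2 * v\<zeta> $ None) (2 * t2 * B $ 1 + 2 * t1 * B $ 2)"
    and "W $ Some 2 = Complex (A $ 2 + t1\<^sup>2 * v\<zeta> $ None) (2 * t1 * B $ 1)"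
    and "W $ None + of_real (Re (z $ 1)) * W $ Some 1 + of_real (Re (z $ 2)) * W $ Some 2 =
      Complex (coframe0 b v\<zeta>t v\<zeta> + 2 * t1 * t2 * B $ 1 + t1\<^sup>2 * B $ 2) (- 2 * t1\<^sup>2 * t2 * v\<zeta> $ None)"
  unfolding assms
  by (simp_all add: complex_eq_iff W_form_def sum_2_option tau_mat_eq coframe0_def coframeA_def coframeB_def
     ReV_def power2_eq_square algebra_simps)

text \<open>The inverse of N has signature (1, 2); subtracting the rank-one term in z reverses its
  positive direction, so the whole bracket is negative definite. The weights of the pairs
  \<open>coframe0\<close> and d\<zeta>^0, \<open>coframeA\<close> and \<open>coframeB\<close> come
  out reciprocal in t.\<close>

lemma g_N_eq:
  assumes pos: "Im (z $ 1) > 0" "Im (z $ 2) > 0" "\<rho> > 0"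
  defines "t1 \<equiv> Im (z $ 1)" and "t2 \<equiv> Im (z $ 2)" and "b \<equiv> ReV z"
  shows "g_N (z, \<rho>, \<zeta>t, \<zeta>, \<sigma>) (v, v\<rho>, v\<zeta>t, v\<zeta>, v\<sigma>) (w, w\<rho>, w\<zeta>t, w\<zeta>, w\<sigma>) =
     (Re (v $ 1) * Re (w $ 1) + Im (v $ 1) * Im (w $ 1)) / (2 * t1\<^sup>2)
     + (Re (v $ 2) * Re (w $ 2) + Im (v $ 2) * Im (w $ 2)) / (4 * t2\<^sup>2)
     + v\<rho> * w\<rho> / (4 * \<rho>\<^sup>2)
     + coframe0 b v\<zeta>t v\<zeta> * coframe0 b w\<zeta>t w\<zeta> / (8 * \<rho> * t1\<^sup>2 * t2)
     + t1\<^sup>2 * t2 * (v\<zeta> $ None * w\<zeta> $ None) / (8 * \<rho>)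
     + coframeA b v\<zeta>t v\<zeta> $ 1 * coframeA b w\<zeta>t w\<zeta> $ 1 / (16 * \<rho> * t2)
     + t2 * (coframeA b v\<zeta>t v\<zeta> $ 2 * coframeA b w\<zeta>t w\<zeta> $ 2) / (8 * \<rho> * t1\<^sup>2)
     + t2 * (coframeB b v\<zeta> $ 1 * coframeB b w\<zeta> $ 1) / (4 * \<rho>)
     + t1\<^sup>2 * (coframeB b v\<zeta> $ 2 * coframeB b w\<zeta> $ 2) / (8 * \<rho> * t2)
     + (v\<sigma> + \<zeta>t \<bullet> v\<zeta> - \<zeta> \<bullet> v\<zeta>t) * (w\<sigma> + \<zeta>t \<bullet> w\<zeta> - \<zeta> \<bullet> w\<zeta>t) / (64 * \<rho>\<^sup>2)"
proof -
  have g: "g_M z v w = (Re (v $ 1) * Re (w $ 1) + Im (v $ 1) * Im (w $ 1)) / (2 * t1\<^sup>2)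
     + (Re (v $ 2) * Re (w $ 2) + Im (v $ 2) * Im (w $ 2)) / (4 * t2\<^sup>2)"
    unfolding t1_def t2_def by (rule g_M_eq) fact+
  define A0 B0 where "A0 = coframe0 b v\<zeta>t v\<zeta>" "B0 = coframe0 b w\<zeta>t w\<zeta>"
  define A1 B1 where "A1 = coframeA b v\<zeta>t v\<zeta> $ 1" "B1 = coframeA b w\<zeta>t w\<zeta> $ 1"
  define A2 B2 where "A2 = coframeA b v\<zeta>t v\<zeta> $ 2" "B2 = coframeA b w\<zeta>t w\<zeta> $ 2"
  define C1 D1 where "C1 = coframeB b v\<zeta> $ 1" "D1 = coframeB b w\<zeta> $ 1"
  define C2 D2 where "C2 = coframeB b v\<zeta> $ 2" "D2 = coframeB b w\<zeta> $ 2"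
  define C0 D0 where "C0 = v\<zeta> $ None" "D0 = w\<zeta> $ None"
  note defs = A0_B0_def A1_B1_def A2_B2_def C1_D1_def C2_D2_def C0_D0_def
  have pos': "t1 \<noteq> 0" "t2 \<noteq> 0" "\<rho> \<noteq> 0" using pos by (auto simp: t1_def t2_def)
  have Re_of_real_mult: "Re (of_real r * x) = r * Re x" for r x
    by simp
  have Re_mult_cnj: "Re (x * cnj y) = Re x * Re y + Im x * Im y" for x y
    by simp
  have frac1: "a / (4 * t1\<^sup>2 * t2) + b / (4 * t1) - t2 * c / (4 * t1\<^sup>2) = (a + t1 * t2 * b - t2\<^sup>2 * c) / (4 * t1\<^sup>2 * t2)" for a b c
    using pos' by (simp add: divide_simps) (simp add: algebra_simps power2_eq_square)
  have frac2: "x0 / (8 * \<rho> * t1\<^sup>2 * t2) + t1\<^sup>2 * t2 * y0 / (8 * \<rho>) + x1 / (16 * \<rho> * t2) + t2 * x2 / (8 * \<rho> * t1\<^sup>2)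
      + t2 * y1 / (4 * \<rho>) + t1\<^sup>2 * y2 / (8 * \<rho> * t2)
    = (2 * x0 + 2 * t1 ^ 4 * t2\<^sup>2 * y0 + t1\<^sup>2 * x1 + 2 * t2\<^sup>2 * x2 + 4 * t1\<^sup>2 * t2\<^sup>2 * y1 + 2 * t1 ^ 4 * y2) / (16 * \<rho> * t1\<^sup>2 * t2)"
    for x0 x1 x2 y0 y1 y2
    using pos' by (simp add: divide_simps) (simp add: algebra_simps power2_eq_square power4_eq_xxxx)
  let ?V = "W_form z v\<zeta>t v\<zeta>" and ?W = "W_form z w\<zeta>t w\<zeta>"
  let ?Q = "\<Sum>i\<in>UNIV. \<Sum>j\<in>UNIV. (complex_of_real (matrix_inv (N_mat z) $ i $ j)
            - 2 / complex_of_real (8 * hpoly (ImV z)) * vec0 1 z $ i * cnj (vec0 1 z $ j)) * ?V $ i * cnj (?W $ j)"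
  let ?p0 = "A0 + 2 * t1 * t2 * C1 + t1\<^sup>2 * C2" and ?r0 = "B0 + 2 * t1 * t2 * D1 + t1\<^sup>2 * D2"
  let ?q0 = "- 2 * t1\<^sup>2 * t2 * C0" and ?s0 = "- 2 * t1\<^sup>2 * t2 * D0"
  let ?p1 = "A1 + 2 * t1 * t2 * C0" and ?r1 = "B1 + 2 * t1 * t2 * D0"
  let ?q1 = "2 * t2 * C1 + 2 * t1 * C2" and ?s1 = "2 * t2 * D1 + 2 * t1 * D2"
  let ?p2 = "A2 + t1\<^sup>2 * C0" and ?r2 = "B2 + t1\<^sup>2 * D0"
  let ?q2 = "2 * t1 * C1" and ?s2 = "2 * t1 * D1"
  have "?Q = (- Complex ?p0 ?q0 * cnj (Complex ?r0 ?s0)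
       - Complex (?p0 - (t1 * ?q1 + t2 * ?q2)) (?q0 + t1 * ?p1 + t2 * ?p2) *
         cnj (Complex (?r0 - (t1 * ?s1 + t2 * ?s2)) (?s0 + t1 * ?r1 + t2 * ?r2))) / of_real (4 * t1\<^sup>2 * t2)
      + (Complex ?p1 ?q1 * cnj (Complex ?r2 ?s2) + Complex ?p2 ?q2 * cnj (Complex ?r1 ?s1)) / of_real (4 * t1)
      - of_real t2 * (Complex ?p2 ?q2 * cnj (Complex ?r2 ?s2)) / of_real (4 * t1\<^sup>2)"
  proof -
    have i: "Complex p0 q0 + \<i> * (complex_of_real t1 * Complex p1 q1 + complex_of_real t2 * Complex p2 q2) =
      Complex (p0 - (t1 * q1 + t2 * q2)) (q0 + t1 * p1 + t2 * p2)" for p0 q0 p1 q1 p2 q2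
      by (simp add: complex_eq_iff)
    have r: "4 * (complex_of_real t1)\<^sup>2 * t2 = of_real (4 * t1\<^sup>2 * t2)" "4 * complex_of_real t1 = of_real (4 * t1)"
      "4 * (complex_of_real t1)\<^sup>2 = of_real (4 * t1\<^sup>2)" by simp_all
    show ?thesis
      unfolding N_W_form_eq[OF pos(1,2)] W_form_eq(3)[where z = z]
      unfolding W_form_eq(1,2)[where z = z]
      unfolding t1_def[symmetric] t2_def[symmetric] b_def[symmetric] defs[symmetric] i r
      by (simp only: mult.assoc of_real_mult)
  qed
  then have "Re ?Q = (- (?p0 * ?r0 + ?q0 * ?s0) - ((?p0 - (t1 * ?q1 + t2 * ?q2)) * (?r0 - (t1 * ?s1 + t2 * ?s2)) +
      (?q0 + t1 * ?p1 + t2 * ?p2) * (?s0 + t1 * ?r1 + t2 * ?r2))) / (4 * t1\<^sup>2 * t2)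
      + (?p1 * ?r2 + ?q1 * ?s2 + (?p2 * ?r1 + ?q2 * ?s1)) / (4 * t1) - t2 * (?p2 * ?r2 + ?q2 * ?s2) / (4 * t1\<^sup>2)"
    by (simp only: minus_complex.sel plus_complex.sel Re_divide_of_real Re_mult_cnj complex.sel mult_minus_left 
         uminus_complex.sel Re_of_real_mult) 
  \<comment> \<open>All products of two different coframe components cancel here. The six diagonal
    ones survive with the same sign, which the factor - 1 / (4 \<rho>) makes positive.\<close>
  also have "\<dots> = - (2 * (A0 * B0) + 2 * t1 ^ 4 * t2\<^sup>2 * (C0 * D0) + t1\<^sup>2 * (A1 * B1) + 2 * t2\<^sup>2 * (A2 * B2)
       + 4 * t1\<^sup>2 * t2\<^sup>2 * (C1 * D1) + 2 * t1 ^ 4 * (C2 * D2)) / (4 * t1\<^sup>2 * t2)"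
    unfolding frac1 by (rule arg_cong2[where f = "(/)"]) (simp_all add: algebra_simps power2_eq_square power4_eq_xxxx)
  finally have RQ: "Re ?Q = - (2 * (A0 * B0) + 2 * t1 ^ 4 * t2\<^sup>2 * (C0 * D0) + t1\<^sup>2 * (A1 * B1) + 2 * t2\<^sup>2 * (A2 * B2)
       + 4 * t1\<^sup>2 * t2\<^sup>2 * (C1 * D1) + 2 * t1 ^ 4 * (C2 * D2)) / (4 * t1\<^sup>2 * t2)" .
  have scale: "- 1 / (4 * \<rho>) * (- N / (4 * t1\<^sup>2 * t2)) = N / (16 * \<rho> * t1\<^sup>2 * t2)" for N
    by simp
  have Q: "G - 1 / (4 * \<rho>) * Re ?Q + E = G + (A0 * B0 / (8 * \<rho> * t1\<^sup>2 * t2) + t1\<^sup>2 * t2 * (C0 * D0) / (8 * \<rho>)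
       + A1 * B1 / (16 * \<rho> * t2) + t2 * (A2 * B2) / (8 * \<rho> * t1\<^sup>2) + t2 * (C1 * D1) / (4 * \<rho>)
       + t1\<^sup>2 * (C2 * D2) / (8 * \<rho> * t2)) + E" for G E
    unfolding frac2 scale[symmetric] RQ by (simp only: minus_divide_left[symmetric] mult_minus_left)
  show ?thesis
    unfolding g_N_def prod.case Let_def g defs[symmetric] Q by (simp add: add.assoc)
qed

section \<open>The Riemannian densities\<close>

lemma UNIV_11: "(UNIV :: 11 set) = {1, 2, 3, 4, 5, 6, 7, 8, 9, 10, 11}"
proof -
  have "i \<in> {1, 2, 3, 4, 5, 6, 7, 8, 9, 10, 11}" for i :: 11
  proof (cases i rule: bit1_cases)
    case (of_int z)
    then have "z = 0 \<or> z = 1 \<or> z = 2 \<or> z = 3 \<or> z = 4 \<or> z = 5 \<or> z = 6 \<or> z = 7 \<or> z = 8 \<or> z = 9 \<or> z = 10"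
      by (simp add: atLeastLessThan_iff) presburger
    then show ?thesis using of_int(1) by (elim disjE) simp_all
  qed
  then show ?thesis by blast
qed

lemma UNIV_12: "(UNIV :: 12 set) = {1, 2, 3, 4, 5, 6, 7, 8, 9, 10, 11, 12}"
proof -
  have "i \<in> {1, 2, 3, 4, 5, 6, 7, 8, 9, 10, 11, 12}" for i :: 12
  proof (cases i rule: bit0_cases)
    case (of_int z)
    then have "z = 0 \<or> z = 1 \<or> z = 2 \<or> z = 3 \<or> z = 4 \<or> z = 5 \<or> z = 6 \<or> z = 7 \<or> z = 8 \<or> z = 9 \<or> z = 10 \<or> z = 11"
      by (simp add: atLeastLessThan_iff) presburger
    then show ?thesis using of_int(1) by (elim disjE) simp_all
  qed
  then show ?thesis by blast
qed

lemma frechet_derivative_linear: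
  fixes f :: "'a::euclidean_space \<Rightarrow> 'b::real_normed_vector"
  assumes "linear f"
  shows "frechet_derivative f (at x) = f"
  using linear_imp_has_derivative[OF assms, of "at x"] by (metis frechet_derivative_at)

section \<open>Gram determinants from unitriangular coframes\<close>

lemma det_gram_coframe:
  fixes \<phi> :: "real^'m::finite \<Rightarrow> 'p::real_normed_vector"
  assumes \<phi>: "linear \<phi>" and T: "linear T" "linear S"
    and g: "\<And>v w. g (\<phi> q) (\<phi> v) (\<phi> w) = (\<Sum>k\<in>UNIV. c k * T (S v) $ k * T (S w) $ k)"
  shows "det (gram g \<phi> q) = (\<Prod>k\<in>UNIV. c k) * (det (matrix T) * det (matrix S))\<^sup>2"
proof -
  have "gram g \<phi> q = transpose (matrix (T \<circ> S)) ** ((\<chi> i j. if i = j then c i else 0) ** matrix (T \<circ> S))"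
    by (simp add: gram_def frechet_derivative_linear[OF \<phi>] g vec_eq_iff matrix_matrix_mult_def transpose_def
        matrix_def if_distrib[of "\<lambda>x. x * _"] sum.delta cong: if_cong) (simp add: ac_simps)
  moreover have "det (\<chi> i j. if i = j then c i else 0) = (\<Prod>k\<in>UNIV. c k)"
    by (subst det_diagonal) auto
  ultimately show ?thesis
    by (simp add: det_mul matrix_compose T power2_eq_square)
qed

lemma det_matrix_unipotent:
  fixes T :: "real^('n::{finite,wellorder}) \<Rightarrow> real^('n::{finite,wellorder})"
  assumes "(\<forall>i j. j < i \<longrightarrow> T (axis j 1) $ i = 0) \<or> (\<forall>i j. i < j \<longrightarrow> T (axis j 1) $ i = 0)"
    and "\<And>i. T (axis i 1) $ i = 1"
  shows "det (matrix T) = 1"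
  using assms(1)
proof
  assume "\<forall>i j. j < i \<longrightarrow> T (axis j 1) $ i = 0"
  then show ?thesis by (subst det_upperdiagonal) (simp_all add: matrix_def assms(2))
next
  assume "\<forall>i j. i < j \<longrightarrow> T (axis j 1) $ i = 0"
  then show ?thesis by (subst det_lowerdiagonal) (simp_all add: matrix_def assms(2))
qed


lemma all_11: "(\<forall>i::11. P i) \<longleftrightarrow> P 1 \<and> P 2 \<and> P 3 \<and> P 4 \<and> P 5 \<and> P 6 \<and> P 7 \<and> P 8 \<and> P 9 \<and> P 10 \<and> P 11"
proof -
  have "(\<forall>i::11. P i) \<longleftrightarrow> (\<forall>i\<in>UNIV. P i)" by simp
  then show ?thesis unfolding UNIV_11 by simp
qed

lemma all_12: "(\<forall>i::12. P i) \<longleftrightarrow> P 1 \<and> P 2 \<and> P 3 \<and> P 4 \<and> P 5 \<and> P 6 \<and> P 7 \<and> P 8 \<and> P 9 \<and> P 10 \<and> P 11 \<and> P 12"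
proof -
  have "(\<forall>i::12. P i) \<longleftrightarrow> (\<forall>i\<in>UNIV. P i)" by simp
  then show ?thesis unfolding UNIV_12 by simp
qed

lemmas less_11 = less_bit1_def bit1.Rep_numeral bit1.Rep_1
lemmas less_12 = less_bit0_def bit0.Rep_numeral bit0.Rep_1

text \<open>The coframe is the composition of an upper and a lower unitriangular matrix. Recall \<open>11 = 0\<close> and
  \<open>12 = 0\<close> in the index types, so that the row of \<open>\<sigma>\<close>, which involves all other coordinates, comes first.\<close>

definition nil_upper11 :: "real^2 \<Rightarrow> real ^ 2 option \<Rightarrow> real ^ 2 option \<Rightarrow> real^11 \<Rightarrow> real^11" where
  "nil_upper11 b \<zeta>t \<zeta> u = (\<chi> k.
     if k = 5 then u $ 5 + b $ 1 * u $ 6 + b $ 2 * u $ 7 + 2 * (b $ 1)\<^sup>2 * b $ 2 * u $ 8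
       + 2 * b $ 1 * b $ 2 * u $ 9 + (b $ 1)\<^sup>2 * u $ 10
     else if k = 6 then u $ 6 + 2 * b $ 1 * b $ 2 * u $ 8 + 2 * b $ 2 * u $ 9 + 2 * b $ 1 * u $ 10
     else if k = 7 then u $ 7 + (b $ 1)\<^sup>2 * u $ 8 + 2 * b $ 1 * u $ 9
     else if k = 11 then u $ 11 + \<zeta>t $ None * u $ 8 + \<zeta>t $ Some 1 * (u $ 9 + b $ 1 * u $ 8)
       + \<zeta>t $ Some 2 * (u $ 10 + b $ 2 * u $ 8) - \<zeta> $ None * u $ 5 - \<zeta> $ Some 1 * u $ 6 - \<zeta> $ Some 2 * u $ 7
     else u $ k)"

definition nil_lower11 :: "real^2 \<Rightarrow> real^11 \<Rightarrow> real^11" where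
  "nil_lower11 b u = (\<chi> k. if k = 9 then u $ 9 - b $ 1 * u $ 8
     else if k = 10 then u $ 10 - b $ 2 * u $ 8 else u $ k)"

lemma linear_nil11: "linear (nil_upper11 b \<zeta>t \<zeta>)" "linear (nil_lower11 b)"
  by (rule linearI; simp add: nil_upper11_def nil_lower11_def vec_eq_iff algebra_simps)+

lemma det_nil11: "det (matrix (nil_upper11 b \<zeta>t \<zeta>)) = 1" "det (matrix (nil_lower11 b)) = 1"
proof -
  have "\<forall>i j. j < i \<longrightarrow> nil_upper11 b \<zeta>t \<zeta> (axis j 1) $ i = 0"
    unfolding all_11 nil_upper11_def by (simp add: axis_def less_11)
  moreover have "\<forall>i. nil_upper11 b \<zeta>t \<zeta> (axis i 1) $ i = 1"
    unfolding all_11 nil_upper11_def by (simp add: axis_def)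
  ultimately show "det (matrix (nil_upper11 b \<zeta>t \<zeta>)) = 1"
    by (intro det_matrix_unipotent) auto
  have "\<forall>i j. i < j \<longrightarrow> nil_lower11 b (axis j 1) $ i = 0"
    unfolding all_11 nil_lower11_def by (simp add: axis_def less_11)
  moreover have "\<forall>i. nil_lower11 b (axis i 1) $ i = 1"
    unfolding all_11 nil_lower11_def by (simp add: axis_def)
  ultimately show "det (matrix (nil_lower11 b)) = 1"
    by (intro det_matrix_unipotent) auto
qed

text \<open>The coefficients differ from those of \<open>coframe0\<close> and
  \<open>coframeA\<close> because this map acts after \<open>nil_lower12\<close>, on the components
  of \<open>coframeB\<close>: re-expressing \<zeta>^1 and \<zeta>^2 through them turns - b_1^2 b_2
  into + 2 b_1^2 b_2, for instance.\<close>

definition nil_upper12 :: "real^2 \<Rightarrow> real ^ 2 option \<Rightarrow> real ^ 2 option \<Rightarrow> real^12 \<Rightarrow> real^12" where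
  "nil_upper12 b \<zeta>t \<zeta> u = (\<chi> k.
     if k = 6 then u $ 6 + b $ 1 * u $ 7 + b $ 2 * u $ 8 + 2 * (b $ 1)\<^sup>2 * b $ 2 * u $ 9
       + 2 * b $ 1 * b $ 2 * u $ 10 + (b $ 1)\<^sup>2 * u $ 11
     else if k = 7 then u $ 7 + 2 * b $ 1 * b $ 2 * u $ 9 + 2 * b $ 2 * u $ 10 + 2 * b $ 1 * u $ 11
     else if k = 8 then u $ 8 + (b $ 1)\<^sup>2 * u $ 9 + 2 * b $ 1 * u $ 10
     else if k = 12 then u $ 12 + \<zeta>t $ None * u $ 9 + \<zeta>t $ Some 1 * (u $ 10 + b $ 1 * u $ 9)
       + \<zeta>t $ Some 2 * (u $ 11 + b $ 2 * u $ 9) - \<zeta> $ None * u $ 6 - \<zeta> $ Some 1 * u $ 7 - \<zeta> $ Some 2 * u $ 8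
     else u $ k)"

definition nil_lower12 :: "real^2 \<Rightarrow> real^12 \<Rightarrow> real^12" where
  "nil_lower12 b u = (\<chi> k. if k = 10 then u $ 10 - b $ 1 * u $ 9
     else if k = 11 then u $ 11 - b $ 2 * u $ 9 else u $ k)"

lemma linear_nil12: "linear (nil_upper12 b \<zeta>t \<zeta>)" "linear (nil_lower12 b)"
  by (rule linearI; simp add: nil_upper12_def nil_lower12_def vec_eq_iff algebra_simps)+

lemma det_nil12: "det (matrix (nil_upper12 b \<zeta>t \<zeta>)) = 1" "det (matrix (nil_lower12 b)) = 1"
proof -
  have "\<forall>i j. j < i \<longrightarrow> nil_upper12 b \<zeta>t \<zeta> (axis j 1) $ i = 0"
    unfolding all_12 nil_upper12_def by (simp add: axis_def less_12)
  moreover have "\<forall>i. nil_upper12 b \<zeta>t \<zeta> (axis i 1) $ i = 1"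
    unfolding all_12 nil_upper12_def by (simp add: axis_def)
  ultimately show "det (matrix (nil_upper12 b \<zeta>t \<zeta>)) = 1"
    by (intro det_matrix_unipotent) auto
  have "\<forall>i j. i < j \<longrightarrow> nil_lower12 b (axis j 1) $ i = 0"
    unfolding all_12 nil_lower12_def by (simp add: axis_def less_12)
  moreover have "\<forall>i. nil_lower12 b (axis i 1) $ i = 1"
    unfolding all_12 nil_lower12_def by (simp add: axis_def)
  ultimately show "det (matrix (nil_lower12 b)) = 1"
    by (intro det_matrix_unipotent) auto
qed

lemma linear_fiber_chart: "linear (fiber_chart x)"
  by (rule linearI)
    (auto simp: fiber_chart_def cvec_def vec0_def vec_eq_iff forall_2 complex_eq_iff algebra_simps
       split: option.split)

lemma linear_total_chart: "linear total_chart"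
  by (rule linearI)
    (auto simp: total_chart_def cvec_def vec0_def vec_eq_iff forall_2 complex_eq_iff algebra_simps
       split: option.split)

lemma prod_11: "prod f (UNIV :: 11 set) = f 1 * f 2 * f 3 * f 4 * f 5 * f 6 * f 7 * f 8 * f 9 * f 10 * f 11"
  unfolding UNIV_11 by (simp add: mult.assoc)
lemma sum_11: "sum f (UNIV :: 11 set) = f 1 + f 2 + f 3 + f 4 + f 5 + f 6 + f 7 + f 8 + f 9 + f 10 + f 11"
  unfolding UNIV_11 by (simp add: add.assoc)
lemma prod_12: "prod f (UNIV :: 12 set) = f 1 * f 2 * f 3 * f 4 * f 5 * f 6 * f 7 * f 8 * f 9 * f 10 * f 11 * f 12"
  unfolding UNIV_12 by (simp add: mult.assoc)
lemma sum_12: "sum f (UNIV :: 12 set) = f 1 + f 2 + f 3 + f 4 + f 5 + f 6 + f 7 + f 8 + f 9 + f 10 + f 11 + f 12"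
  unfolding UNIV_12 by (simp add: add.assoc)

section \<open>Component rules, type IIB coordinates and the inverse of S-duality\<close>

lemma vec0_nth [simp]: "vec0 x y $ None = x" "vec0 x y $ Some a = y $ a"
  by (simp_all add: vec0_def)

lemma spatial_nth [simp]: "spatial y $ a = y $ Some a"
  by (simp add: spatial_def)

lemma spatial_vec0 [simp]: "spatial (vec0 x y) = y"
  by (simp add: vec_eq_iff)

lemma ReV_nth [simp]: "ReV z $ a = Re (z $ a)" and ImV_nth [simp]: "ImV z $ a = Im (z $ a)"
  by (simp_all add: ReV_def ImV_def)

lemma cvec_nth [simp]: "cvec b t $ a = Complex (b $ a) (t $ a)"
  by (simp add: cvec_def)

lemma ReV_cvec [simp]: "ReV (cvec b t) = b" and ImV_cvec [simp]: "ImV (cvec b t) = t"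
  by (simp_all add: vec_eq_iff)

lemma kvec_nth: "kvec v w $ a = (if a = 1 then 2 * (v $ 1 * w $ 2 + v $ 2 * w $ 1) else 2 * v $ 1 * w $ 1)"
  using exhaust_2[of a] by (auto simp: kvec_def kcoef_def sum_2)

lemma kform_eq: "kform u v w = 2 * (u $ 1 * v $ 1 * w $ 2 + u $ 1 * v $ 2 * w $ 1 + u $ 2 * v $ 1 * w $ 1)"
  by (simp add: kform_def kcoef_def sum_2 algebra_simps)

lemma inner_2: "(x :: real^2) \<bullet> y = x $ 1 * y $ 1 + x $ 2 * y $ 2"
  by (simp add: inner_vec_def sum_2)

lemma inner_2_option: "(x :: real ^ 2 option) \<bullet> y = x $ None * y $ None + x $ Some 1 * y $ Some 1 + x $ Some 2 * y $ Some 2"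
  by (simp add: inner_vec_def sum_2_option)

lemma \<U>_iff: "t \<in> \<U> \<longleftrightarrow> t $ 1 > 0 \<and> t $ 2 > 0"
proof
  assume "t \<in> \<U>"
  then obtain r x where "t = r *\<^sub>R x" "r > 0" "x $ 1 > 0" "(x $ 1)\<^sup>2 * x $ 2 = 1"
    by (auto simp: \<U>_def \<H>_def)
  moreover from this(3,4) have "x $ 2 > 0"
    by (metis zero_less_mult_pos zero_less_one zero_less_power)
  ultimately show "t $ 1 > 0 \<and> t $ 2 > 0" by simp
next
  assume t: "t $ 1 > 0 \<and> t $ 2 > 0"
  \<comment> \<open>h is homogeneous of degree 3, so this is the only positive factor by which t can
    be divided to reach the curve.\<close>
  define r where "r = root 3 (hpoly t)"
  have h: "hpoly t > 0" using t by (simp add: hpoly_def)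
  then have r: "r > 0" "r ^ 3 = hpoly t" by (simp_all add: r_def)
  have "(t $ 1 / r)\<^sup>2 * (t $ 2 / r) = hpoly t / r ^ 3"
    by (simp add: hpoly_def power2_eq_square power3_eq_cube)
  with h have "(t $ 1 / r)\<^sup>2 * (t $ 2 / r) = 1" unfolding r(2) by simp
  with r t have "(1 / r) *\<^sub>R t \<in> \<H>"
    by (simp add: \<H>_def)
  then show "t \<in> \<U>"
    using r by (auto simp: \<U>_def intro!: exI[of _ r] exI[of _ "(1 / r) *\<^sub>R t"])
qed

lemma Nbar_iff: "p \<in> Nbar \<longleftrightarrow> Im (fst p $ 1) > 0 \<and> Im (fst p $ 2) > 0 \<and> fst (snd p) > 0"
  by (cases p) (simp add: Nbar_def \<U>_iff)

lemma hpoly_pos: "p \<in> Nbar \<Longrightarrow> hpoly (ImV (fst p)) > 0"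
  by (simp add: Nbar_iff hpoly_def)

lemma open_Nbar: "open Nbar"
proof -
  have "Nbar = {p. Im (fst p $ 1) > 0 \<and> Im (fst p $ 2) > 0 \<and> fst (snd p) > 0}"
    by (auto simp: Nbar_iff)
  also have "open \<dots>"
    by (intro open_Collect_conj open_Collect_less continuous_intros)
  finally show ?thesis .
qed

text \<open>The equations of \<open>of_IIB\<close> solved one after the other: \<open>e\<close> is
  c^a - \<tau>_1 b^a, and \<tau>_2 is the positive root of \<rho> = \<tau>_2^2 h / 2. With it
  \<open>S_dual\<close>, which is defined through an abstract inverse, becomes an explicit
  formula.\<close>

definition to_IIB :: "pt \<Rightarrow> iib" where
  "to_IIB = (\<lambda>(z, \<rho>, \<zeta>t, \<zeta>, \<sigma>).
     let b = ReV z; e = - spatial \<zeta>; cu = e + \<zeta> $ None *\<^sub>R b; cd = spatial \<zeta>t - (1/2) *\<^sub>R kvec b e;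
         c0 = \<zeta>t $ None + kform b b e / 6
     in (z, Complex (\<zeta> $ None) (sqrt (2 * \<rho> / hpoly (ImV z))), cu, cd, c0,
         - (\<sigma> - cd \<bullet> e + kform b cu e / 6) / 2 - \<zeta> $ None * c0 / 2))"

lemma to_IIB_of_IIB: "q \<in> IIB \<Longrightarrow> to_IIB (of_IIB q) = q"
  by (cases q;
    auto simp: to_IIB_def of_IIB_def IIB_def Let_def \<U>_iff hpoly_def vec_eq_iff complex_eq_iff real_sqrt_mult
      inner_2 kform_eq; argo)

lemma of_IIB_to_IIB: "p \<in> Nbar \<Longrightarrow> of_IIB (to_IIB p) = p"
  by (cases p;
    auto simp: to_IIB_def of_IIB_def Nbar_def Let_def \<U>_iff hpoly_def vec_eq_iff split_option_all; argo)

lemma to_IIB_in_IIB: "p \<in> Nbar \<Longrightarrow> to_IIB p \<in> IIB"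
  by (cases p) (auto simp: to_IIB_def IIB_def Nbar_def Let_def \<U>_iff hpoly_def)

lemma of_IIB_in_Nbar: "q \<in> IIB \<Longrightarrow> of_IIB q \<in> Nbar"
  by (cases q) (auto simp: of_IIB_def IIB_def Nbar_def Let_def \<U>_iff hpoly_def)

lemma S_dual_eq:
  assumes "p \<in> Nbar"
  shows "S_dual A p = of_IIB (S_IIB A (to_IIB p))"
proof -
  have "inj_on of_IIB IIB" by (rule inj_on_inverseI) (rule to_IIB_of_IIB)
  then have "the_inv_into IIB of_IIB p = to_IIB p"
    using assms by (metis of_IIB_to_IIB the_inv_into_f_f to_IIB_in_IIB)
  then show ?thesis by (simp add: S_dual_def)
qed

text \<open>The inverse of a matrix of determinant 1. Being polynomial in the entries, it passes to
  limits at once.\<close>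

definition adj2 :: "real^2^2 \<Rightarrow> real^2^2" where
  "adj2 A = vector [vector [A $ 2 $ 2, - A $ 1 $ 2], vector [- A $ 2 $ 1, A $ 1 $ 1]]"

lemma det_adj2: "det (adj2 A) = det A"
  by (simp add: det_2 adj2_def algebra_simps)

lemma moebius_denom_nz:
  assumes "det (A :: real^2^2) = 1" "Im \<tau> > 0"
  shows "complex_of_real (A $ 2 $ 1) * \<tau> + complex_of_real (A $ 2 $ 2) \<noteq> 0"
proof
  assume *: "complex_of_real (A $ 2 $ 1) * \<tau> + complex_of_real (A $ 2 $ 2) = 0"
  from arg_cong[OF *, of Im] assms(2) have "A $ 2 $ 1 = 0" by simp
  with * have "A $ 2 $ 2 = 0" by simp
  with \<open>A $ 2 $ 1 = 0\<close> assms(1) show False by (simp add: det_2)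
qed

lemma Im_moebius:
  assumes "det (A :: real^2^2) = 1" "Im \<tau> > 0"
  defines "m \<equiv> complex_of_real (A $ 2 $ 1) * \<tau> + complex_of_real (A $ 2 $ 2)"
  shows "Im ((complex_of_real (A $ 1 $ 1) * \<tau> + complex_of_real (A $ 1 $ 2)) / m) = Im \<tau> / (cmod m)\<^sup>2"
proof -
  let ?n = "complex_of_real (A $ 1 $ 1) * \<tau> + complex_of_real (A $ 1 $ 2)"
  have "?n / m = ?n * cnj m / (cmod m)\<^sup>2" by (rule complex_div_cnj)
  also have "Im \<dots> = Im (?n * cnj m) / (cmod m)\<^sup>2"
    by (metis Im_divide_of_real of_real_power)
  also have "Im (?n * cnj m) = det A * Im \<tau>"
    by (simp add: m_def det_2 algebra_simps)
  finally show ?thesis using assms by simp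
qed

lemma S_IIB_in_IIB:
  assumes "det A = 1" "q \<in> IIB"
  shows "S_IIB A q \<in> IIB"
  using assms Im_moebius[OF assms(1)] moebius_denom_nz[OF assms(1)]
  by (cases q) (auto simp: S_IIB_def IIB_def Let_def \<U>_iff)

text \<open>The automorphy factor of the inverse matrix at the image point is 1 / m. This undoes the
  fractional linear map and also the scaling of t by the modulus of m; the remaining coordinates
  transform linearly.\<close>

lemma S_IIB_adj2:
  assumes "det A = 1" "q \<in> IIB"
  shows "S_IIB (adj2 A) (S_IIB A q) = q"
proof -
  obtain z \<tau> cu cd c0 \<psi> where q: "q = (z, \<tau>, cu, cd, c0, \<psi>)" by (cases q)
  define a b c d where "a = A $ 1 $ 1" "b = A $ 1 $ 2" "c = A $ 2 $ 1" "d = A $ 2 $ 2"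
  note abcd = this
  have D: "a * d - b * c = 1" using assms by (simp add: det_2 abcd)
  have D': "a * d = 1 + b * c" using D by simp
  define m where "m = complex_of_real c * \<tau> + complex_of_real d"
  have m: "m \<noteq> 0"
    using moebius_denom_nz[of A \<tau>] assms by (auto simp: abcd m_def q IIB_def)
  have "complex_of_real (a * d) = complex_of_real (1 + b * c)" by (simp only: D')
  then have D'': "complex_of_real a * complex_of_real d = 1 + complex_of_real b * complex_of_real c"
    by simp
  let ?\<tau> = "(complex_of_real a * \<tau> + complex_of_real b) / m"
  have 1: "complex_of_real (- c) * ?\<tau> + complex_of_real a = 1 / m"
  proof -
    have "complex_of_real (- c) * (complex_of_real a * \<tau> + complex_of_real b) + complex_of_real a * m = 1"
      using D'' by (simp add: m_def algebra_simps)
    with m show ?thesis by (simp add: divide_simps)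
  qed
  have 2: "complex_of_real d * ?\<tau> + complex_of_real (- b) = \<tau> / m"
  proof -
    have "complex_of_real d * (complex_of_real a * \<tau> + complex_of_real b) + complex_of_real (- b) * m = 
        (complex_of_real a * complex_of_real d - complex_of_real b * complex_of_real c) * \<tau>"
      by (simp add: m_def algebra_simps)
    also have "\<dots> = \<tau>" using D'' by simp
    finally have "complex_of_real d * (complex_of_real a * \<tau> + complex_of_real b) + complex_of_real (- b) * m = \<tau>" .
    with m show ?thesis by (simp add: divide_simps)
  qed
  have lin: "d * (a * s + b * r) + - b * (c * s + d * r) = s" "- c * (a * s + b * r) + a * (c * s + d * r) = r"
     "a * (d * s - c * r) - - c * (- b * s + a * r) = s" "- (- b) * (d * s - c * r) + d * (- b * s + a * r) = r" for r s
  proof -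
    have "d * (a * s + b * r) + - b * (c * s + d * r) = (a * d - b * c) * s"
         "- c * (a * s + b * r) + a * (c * s + d * r) = (a * d - b * c) * r"
         "a * (d * s - c * r) - - c * (- b * s + a * r) = (a * d - b * c) * s"
         "- (- b) * (d * s - c * r) + d * (- b * s + a * r) = (a * d - b * c) * r"
      by (simp_all add: algebra_simps)
    then show "d * (a * s + b * r) + - b * (c * s + d * r) = s" "- c * (a * s + b * r) + a * (c * s + d * r) = r"
     "a * (d * s - c * r) - - c * (- b * s + a * r) = s" "- (- b) * (d * s - c * r) + d * (- b * s + a * r) = r"
      unfolding D by simp_all
  qed
  have adj: "adj2 A $ 1 $ 1 = d" "adj2 A $ 1 $ 2 = - b" "adj2 A $ 2 $ 1 = - c" "adj2 A $ 2 $ 2 = a"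
    by (simp_all add: adj2_def abcd)
  show ?thesis
    unfolding q S_IIB_def prod.case Let_def adj abcd[symmetric] m_def[symmetric] 1 2 ReV_cvec ImV_cvec lin
    using m lin(1,2) by (auto simp: vec_eq_iff complex_eq_iff norm_divide)
qed

lemma det_gram_total:
  assumes "q $ 3 > 0" "q $ 4 > 0" "q $ 5 > 0"
  shows "det (gram g_N total_chart q) = 1 / (2 ^ 32 * (q $ 3) ^ 4 * (q $ 4) ^ 4 * (q $ 5) ^ 10)"
proof -
  define b :: "real^2" where "b = vector [q $ 1, q $ 2]"
  define \<zeta>t \<zeta> where "\<zeta>t = vec0 (q $ 6) (vector [q $ 7, q $ 8])" "\<zeta> = vec0 (q $ 9) (vector [q $ 10, q $ 11])"
  note \<zeta> = this
  define c :: "12 \<Rightarrow> real" where "c = (\<lambda>k. let t1 = q $ 3; t2 = q $ 4; \<rho> = q $ 5 in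
    if k = 1 \<or> k = 3 then 1 / (2 * t1\<^sup>2) else if k = 2 \<or> k = 4 then 1 / (4 * t2\<^sup>2)
    else if k = 5 then 1 / (4 * \<rho>\<^sup>2)
    else if k = 6 then 1 / (8 * \<rho> * t1\<^sup>2 * t2) else if k = 7 then 1 / (16 * \<rho> * t2)
    else if k = 8 then t2 / (8 * \<rho> * t1\<^sup>2) else if k = 9 then t1\<^sup>2 * t2 / (8 * \<rho>)
    else if k = 10 then t2 / (4 * \<rho>) else if k = 11 then t1\<^sup>2 / (8 * \<rho> * t2)
    else 1 / (64 * \<rho>\<^sup>2))"
  have bc: "ReV (cvec (vector [q $ 1, q $ 2]) t) = b" for t by (simp add: b_def)
  have "g_N (total_chart q) (total_chart v) (total_chart w)
    = (\<Sum>k\<in>UNIV. c k * nil_upper12 b \<zeta>t \<zeta> (nil_lower12 b v) $ k * nil_upper12 b \<zeta>t \<zeta> (nil_lower12 b w) $ k)"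
    for v w
  proof -
    have cf: "coframe0 b (vec0 (v $ 6) (vector [v $ 7, v $ 8])) (vec0 (v $ 9) (vector [v $ 10, v $ 11]))
       = nil_upper12 b \<zeta>t \<zeta> (nil_lower12 b v) $ 6"
     "coframeA b (vec0 (v $ 6) (vector [v $ 7, v $ 8])) (vec0 (v $ 9) (vector [v $ 10, v $ 11])) $ 1
       = nil_upper12 b \<zeta>t \<zeta> (nil_lower12 b v) $ 7"
     "coframeA b (vec0 (v $ 6) (vector [v $ 7, v $ 8])) (vec0 (v $ 9) (vector [v $ 10, v $ 11])) $ 2
       = nil_upper12 b \<zeta>t \<zeta> (nil_lower12 b v) $ 8"
     "v $ 9 = nil_upper12 b \<zeta>t \<zeta> (nil_lower12 b v) $ 9"
     "coframeB b (vec0 (v $ 9) (vector [v $ 10, v $ 11])) $ 1 = nil_upper12 b \<zeta>t \<zeta> (nil_lower12 b v) $ 10"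
     "coframeB b (vec0 (v $ 9) (vector [v $ 10, v $ 11])) $ 2 = nil_upper12 b \<zeta>t \<zeta> (nil_lower12 b v) $ 11"
     "v $ 12 + \<zeta>t \<bullet> vec0 (v $ 9) (vector [v $ 10, v $ 11]) - \<zeta> \<bullet> vec0 (v $ 6) (vector [v $ 7, v $ 8])
       = nil_upper12 b \<zeta>t \<zeta> (nil_lower12 b v) $ 12"
     "v $ 1 = nil_upper12 b \<zeta>t \<zeta> (nil_lower12 b v) $ 1" "v $ 2 = nil_upper12 b \<zeta>t \<zeta> (nil_lower12 b v) $ 2"
     "v $ 3 = nil_upper12 b \<zeta>t \<zeta> (nil_lower12 b v) $ 3" "v $ 4 = nil_upper12 b \<zeta>t \<zeta> (nil_lower12 b v) $ 4"
     "v $ 5 = nil_upper12 b \<zeta>t \<zeta> (nil_lower12 b v) $ 5" for v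
      by (simp_all add: coframe0_def coframeA_def coframeB_def nil_upper12_def nil_lower12_def inner_2_option
          algebra_simps power2_eq_square)
    show ?thesis
      unfolding total_chart_def \<zeta>[symmetric]
      apply (subst g_N_eq)
      subgoal using assms by (simp add: cvec_def)
      subgoal using assms by (simp add: cvec_def)
      subgoal using assms by (simp add: cvec_def)
      subgoal
        unfolding bc vec0_nth cf(1,2,3,5,6,7) sum_12
        by (simp add: cvec_def c_def Let_def cf(4,8-)[symmetric] add_divide_distrib)
      done
  qed
  then have "det (gram g_N total_chart q) = (\<Prod>k\<in>UNIV. c k) * 1"
    by (subst det_gram_coframe[OF linear_total_chart linear_nil12(1) linear_nil12(2)]) (auto simp: det_nil12)
  \<comment> \<open>The weights 6 to 11 are reciprocal in t in pairs and leave \<rho>^-6; the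
    directions of b and t give t_1^-4 t_2^-4, those of \<rho> and \<sigma> a further
    \<rho>^-4.\<close>
  also have "(\<Prod>k\<in>UNIV. c k) = 1 / (2 ^ 32 * (q $ 3) ^ 4 * (q $ 4) ^ 4 * (q $ 5) ^ 10)"
    unfolding prod_12 c_def Let_def using assms
    by (simp add: divide_simps) (simp add: eval_nat_numeral)
  finally show ?thesis by simp
qed

text \<open>Within a fibre t = r x varies only radially, with weight 1 / (2 r^2) + 1 / (4 r^2) = 3 /
  (4 r^2): this is the origin of the 3. Up to the factor 1 / 8 the weights of b multiply to 1 / (t_1
  t_2)^2 = x_1^2 / r^4, by x_1^2 x_2 = 1.\<close>

lemma det_gram_fiber:
  assumes x: "x \<in> \<H>" and "q \<in> fiber_dom"
  shows "det (gram g_N (fiber_chart x) q) = 3 / 2 ^ 31 * (x $ 1)\<^sup>2 / ((q $ 3) ^ 6 * (q $ 4) ^ 10)"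
proof -
  have q: "q $ 3 > 0" "q $ 4 > 0" and x1: "x $ 1 > 0" using assms by (auto simp: fiber_dom_def \<H>_def)
  have x2: "x $ 2 = 1 / (x $ 1)\<^sup>2" using x by (auto simp: \<H>_def field_simps)
  define b :: "real^2" where "b = vector [q $ 1, q $ 2]"
  define \<zeta>t \<zeta> where "\<zeta>t = vec0 (q $ 5) (vector [q $ 6, q $ 7])" "\<zeta> = vec0 (q $ 8) (vector [q $ 9, q $ 10])"
  note \<zeta> = this
  define c :: "11 \<Rightarrow> real" where "c = (\<lambda>k. let t1 = q $ 3 * x $ 1; t2 = q $ 3 * x $ 2; \<rho> = q $ 4 in
    if k = 1 then 1 / (2 * t1\<^sup>2) else if k = 2 then 1 / (4 * t2\<^sup>2)
    else if k = 3 then (x $ 1)\<^sup>2 / (2 * t1\<^sup>2) + (x $ 2)\<^sup>2 / (4 * t2\<^sup>2)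
    else if k = 4 then 1 / (4 * \<rho>\<^sup>2)
    else if k = 5 then 1 / (8 * \<rho> * t1\<^sup>2 * t2) else if k = 6 then 1 / (16 * \<rho> * t2)
    else if k = 7 then t2 / (8 * \<rho> * t1\<^sup>2) else if k = 8 then t1\<^sup>2 * t2 / (8 * \<rho>)
    else if k = 9 then t2 / (4 * \<rho>) else if k = 10 then t1\<^sup>2 / (8 * \<rho> * t2)
    else 1 / (64 * \<rho>\<^sup>2))"
  have bc: "ReV (cvec (vector [q $ 1, q $ 2]) t) = b" for t by (simp add: b_def)
  have "g_N (fiber_chart x q) (fiber_chart x v) (fiber_chart x w)
    = (\<Sum>k\<in>UNIV. c k * nil_upper11 b \<zeta>t \<zeta> (nil_lower11 b v) $ k * nil_upper11 b \<zeta>t \<zeta> (nil_lower11 b w) $ k)"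
    for v w
  proof -
    have cf: "coframe0 b (vec0 (v $ 5) (vector [v $ 6, v $ 7])) (vec0 (v $ 8) (vector [v $ 9, v $ 10]))
       = nil_upper11 b \<zeta>t \<zeta> (nil_lower11 b v) $ 5"
     "coframeA b (vec0 (v $ 5) (vector [v $ 6, v $ 7])) (vec0 (v $ 8) (vector [v $ 9, v $ 10])) $ 1
       = nil_upper11 b \<zeta>t \<zeta> (nil_lower11 b v) $ 6"
     "coframeA b (vec0 (v $ 5) (vector [v $ 6, v $ 7])) (vec0 (v $ 8) (vector [v $ 9, v $ 10])) $ 2
       = nil_upper11 b \<zeta>t \<zeta> (nil_lower11 b v) $ 7"
     "v $ 8 = nil_upper11 b \<zeta>t \<zeta> (nil_lower11 b v) $ 8"
     "coframeB b (vec0 (v $ 8) (vector [v $ 9, v $ 10])) $ 1 = nil_upper11 b \<zeta>t \<zeta> (nil_lower11 b v) $ 9"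
     "coframeB b (vec0 (v $ 8) (vector [v $ 9, v $ 10])) $ 2 = nil_upper11 b \<zeta>t \<zeta> (nil_lower11 b v) $ 10"
     "v $ 11 + \<zeta>t \<bullet> vec0 (v $ 8) (vector [v $ 9, v $ 10]) - \<zeta> \<bullet> vec0 (v $ 5) (vector [v $ 6, v $ 7])
       = nil_upper11 b \<zeta>t \<zeta> (nil_lower11 b v) $ 11"
     "v $ 1 = nil_upper11 b \<zeta>t \<zeta> (nil_lower11 b v) $ 1" "v $ 2 = nil_upper11 b \<zeta>t \<zeta> (nil_lower11 b v) $ 2"
     "v $ 3 = nil_upper11 b \<zeta>t \<zeta> (nil_lower11 b v) $ 3" "v $ 4 = nil_upper11 b \<zeta>t \<zeta> (nil_lower11 b v) $ 4" for v
      by (simp_all add: coframe0_def coframeA_def coframeB_def nil_upper11_def nil_lower11_def inner_2_option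
          algebra_simps power2_eq_square)
    show ?thesis
      unfolding fiber_chart_def \<zeta>[symmetric]
      apply (subst g_N_eq)
      subgoal using q x1 by (simp add: cvec_def)
      subgoal using q x1 by (simp add: cvec_def x2)
      subgoal using q by (simp add: cvec_def)
      subgoal
        unfolding bc vec0_nth cf(1,2,3,5,6,7) sum_11
        by (simp add: cvec_def c_def Let_def cf(4,8-)[symmetric] add_divide_distrib distrib_left distrib_right
            power2_eq_square)
      done
  qed
  then have "det (gram g_N (fiber_chart x) q) = (\<Prod>k\<in>UNIV. c k) * 1"
    by (subst det_gram_coframe[OF linear_fiber_chart linear_nil11(1) linear_nil11(2)]) (auto simp: det_nil11)
  also have "(\<Prod>k\<in>UNIV. c k) = 3 / 2 ^ 31 * (x $ 1)\<^sup>2 / ((q $ 3) ^ 6 * (q $ 4) ^ 10)"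
    unfolding prod_11 c_def Let_def x2 using q x1
    by (simp add: divide_simps) (simp add: eval_nat_numeral)
  finally show ?thesis by simp
qed

section \<open>The group action\<close>

definition nil_vf :: "real^2 \<Rightarrow> real \<Rightarrow> real^2 \<Rightarrow> real ^ 2 option \<Rightarrow> pt \<Rightarrow> pt" where
  "nil_vf v \<epsilon> y x = (\<lambda>(z, \<rho>, \<zeta>t, \<zeta>, \<sigma>).
     (cvec v 0, 0, vec0 (x $ None - v \<bullet> spatial \<zeta>t) (spatial x - kvec v (spatial \<zeta>)),
      vec0 0 (y + \<zeta> $ None *\<^sub>R v), \<epsilon> + y \<bullet> spatial \<zeta>t - x \<bullet> \<zeta>))"

lemma pt_eqI:
  fixes p q :: pt
  assumes "fst p $ 1 = fst q $ 1" "fst p $ 2 = fst q $ 2" "fst (snd p) = fst (snd q)"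
    "fst (snd (snd p)) $ None = fst (snd (snd q)) $ None"
    "fst (snd (snd p)) $ Some 1 = fst (snd (snd q)) $ Some 1"
    "fst (snd (snd p)) $ Some 2 = fst (snd (snd q)) $ Some 2"
    "fst (snd (snd (snd p))) $ None = fst (snd (snd (snd q))) $ None"
    "fst (snd (snd (snd p))) $ Some 1 = fst (snd (snd (snd q))) $ Some 1"
    "fst (snd (snd (snd p))) $ Some 2 = fst (snd (snd (snd q))) $ Some 2"
    "snd (snd (snd (snd p))) = snd (snd (snd (snd q)))"
  shows "p = q"
  using assms by (simp add: prod_eq_iff vec_eq_iff forall_2 forall_2_option)

lemma n_alg_eq: "n_alg = {nil_vf v \<epsilon> y x | v \<epsilon> y x. True}"
proof -
  have "(\<lambda>p. (\<Sum>a\<in>UNIV. v $ a *\<^sub>R field_V a p) + \<epsilon> *\<^sub>R field_Z p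
                + (\<Sum>a\<in>UNIV. y $ a *\<^sub>R field_P a p) + (\<Sum>i\<in>UNIV. x $ i *\<^sub>R field_X i p)) = nil_vf v \<epsilon> y x"
    for v \<epsilon> y x
  proof (rule ext)
    fix p :: pt
    obtain z \<rho> \<zeta>t \<zeta> \<sigma> where p: "p = (z, \<rho>, \<zeta>t, \<zeta>, \<sigma>)" by (cases p)
    show "(\<Sum>a\<in>UNIV. v $ a *\<^sub>R field_V a p) + \<epsilon> *\<^sub>R field_Z p
                + (\<Sum>a\<in>UNIV. y $ a *\<^sub>R field_P a p) + (\<Sum>i\<in>UNIV. x $ i *\<^sub>R field_X i p) = nil_vf v \<epsilon> y x p"
      unfolding p nil_vf_def field_V_def field_Z_def field_P_def field_X_def sum_2 sum_2_option prod.case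
      by (rule pt_eqI)
        (simp_all add: axis_def kvec_nth inner_2 inner_2_option complex_eq_iff)
  qed
  then show ?thesis unfolding n_alg_def by auto
qed

lemma has_vector_derivative_eqI:
  fixes f g :: "real \<Rightarrow> 'a::real_normed_vector"
  assumes "\<And>s. (f has_vector_derivative d s) (at s)" "\<And>s. (g has_vector_derivative d s) (at s)" "f 0 = g 0"
  shows "f s = g s"
proof -
  have "((\<lambda>s. f s - g s) has_vector_derivative 0) (at s)" for s
    using has_vector_derivative_diff[OF assms(1,2)] by simp
  then obtain c where "\<And>s. f s - g s = c"
    using has_vector_derivative_zero_constant[of UNIV "\<lambda>s. f s - g s"] by auto
  with assms(3) show ?thesis
    by (metis eq_iff_diff_eq_0)
qed

text \<open>The system is triangular in the order z and \<rho>, \<zeta>^0, \<zeta>^a, \<zeta>t_a,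
  \<zeta>t_0, \<sigma>: the derivative of each component involves earlier ones only. Two solutions
  thus agree component by component, since a function with zero derivative is constant. Uniqueness
  is what the definite description in \<open>time_one_flow\<close> requires.\<close>

lemma nil_vf_solution_unique:
  assumes c: "\<And>s. (c has_vector_derivative nil_vf v \<epsilon> y x (c s)) (at s)"
    and d: "\<And>s. (d has_vector_derivative nil_vf v \<epsilon> y x (d s)) (at s)"
    and 0: "c 0 = d 0"
  shows "c s = d s"
proof -
  let ?z = "\<lambda>p :: pt. fst p" and ?\<rho> = "\<lambda>p :: pt. fst (snd p)" and ?\<zeta>t = "\<lambda>p :: pt. fst (snd (snd p))"
    and ?\<zeta> = "\<lambda>p :: pt. fst (snd (snd (snd p)))" and ?\<sigma> = "\<lambda>p :: pt. snd (snd (snd (snd p)))"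
  have vf: "?z (nil_vf v \<epsilon> y x p) = cvec v 0" "?\<rho> (nil_vf v \<epsilon> y x p) = 0"
    "?\<zeta>t (nil_vf v \<epsilon> y x p) $ None = x $ None - v \<bullet> spatial (?\<zeta>t p)"
    "?\<zeta>t (nil_vf v \<epsilon> y x p) $ Some a = x $ Some a - kvec v (spatial (?\<zeta> p)) $ a"
    "?\<zeta> (nil_vf v \<epsilon> y x p) $ None = 0" "?\<zeta> (nil_vf v \<epsilon> y x p) $ Some a = y $ a + ?\<zeta> p $ None * v $ a"
    "?\<sigma> (nil_vf v \<epsilon> y x p) = \<epsilon> + y \<bullet> spatial (?\<zeta>t p) - x \<bullet> ?\<zeta> p" for p a
    by (simp_all add: nil_vf_def case_prod_beta)
  have *: "f (c s) = f (d s)" if f: "linear f" and eq: "\<And>s. f (nil_vf v \<epsilon> y x (c s)) = f (nil_vf v \<epsilon> y x (d s))"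
    for f :: "pt \<Rightarrow> 'b::real_normed_vector" and s
  proof (rule has_vector_derivative_eqI)
    have bl: "bounded_linear f" using f by (simp add: linear_conv_bounded_linear)
    show "((\<lambda>s. f (c s)) has_vector_derivative f (nil_vf v \<epsilon> y x (c s))) (at s)" for s
      using bounded_linear.has_vector_derivative[OF bl c] .
    show "((\<lambda>s. f (d s)) has_vector_derivative f (nil_vf v \<epsilon> y x (c s))) (at s)" for s
      unfolding eq using bounded_linear.has_vector_derivative[OF bl d] .
    show "f (c 0) = f (d 0)" by (simp add: 0)
  qed
  have z: "?z (c s) = ?z (d s)" and \<rho>: "?\<rho> (c s) = ?\<rho> (d s)" for s
    by (rule *; (rule linearI)?; simp add: vf)+
  have nth: "linear (\<lambda>p :: pt. ?\<zeta> p $ i)" "linear (\<lambda>p :: pt. ?\<zeta>t p $ i)" "linear ?\<sigma>" for i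
    by (rule linearI; simp)+
  have \<zeta>0: "?\<zeta> (c s) $ None = ?\<zeta> (d s) $ None" for s
    by (rule *[OF nth(1)]) (simp add: vf)
  have "?\<zeta> (c s) $ i = ?\<zeta> (d s) $ i" for s i
    by (rule *[OF nth(1)], cases i) (simp_all add: vf \<zeta>0)
  then have \<zeta>: "?\<zeta> (c s) = ?\<zeta> (d s)" for s by (simp add: vec_eq_iff)
  have \<zeta>ta: "?\<zeta>t (c s) $ Some a = ?\<zeta>t (d s) $ Some a" for s a
    by (rule *[OF nth(2)]) (simp add: vf \<zeta>)
  then have sp: "spatial (?\<zeta>t (c s)) = spatial (?\<zeta>t (d s))" for s
    by (simp add: vec_eq_iff)
  have "?\<zeta>t (c s) $ None = ?\<zeta>t (d s) $ None" for s
    by (rule *[OF nth(2)]) (simp add: vf sp)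
  with \<zeta>ta have "?\<zeta>t (c s) $ i = ?\<zeta>t (d s) $ i" for s i
    by (cases i) simp_all
  then have \<zeta>t: "?\<zeta>t (c s) = ?\<zeta>t (d s)" for s by (simp add: vec_eq_iff)
  have "?\<sigma> (c s) = ?\<sigma> (d s)" for s
    by (rule *[OF nth(3)]) (simp add: vf \<zeta>t \<zeta>)
  with z \<rho> \<zeta> \<zeta>t show ?thesis by (simp add: prod_eq_iff)
qed

text \<open>The flow of \<open>nil_vf\<close> for time \<open>s\<close>. The field is affine with
  nilpotent linear part, so the exponential series stops at the third power; \<open>w\<close> and
  \<open>u\<close> are the initial velocities of \<zeta>^a and \<zeta>t_a.\<close>

definition nil_act :: "real^2 \<Rightarrow> real \<Rightarrow> real^2 \<Rightarrow> real ^ 2 option \<Rightarrow> real \<Rightarrow> pt \<Rightarrow> pt" where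
  "nil_act v \<epsilon> y x s = (\<lambda>(z, \<rho>, \<zeta>t, \<zeta>, \<sigma>).
     let w = y + \<zeta> $ None *\<^sub>R v; u = spatial x - kvec v (spatial \<zeta>) in
     (z, \<rho>, \<zeta>t, \<zeta>, \<sigma>) + s *\<^sub>R nil_vf v \<epsilon> y x (z, \<rho>, \<zeta>t, \<zeta>, \<sigma>)
     + (s\<^sup>2 / 2) *\<^sub>R (0, 0, vec0 (- (v \<bullet> u)) (- kvec v w), 0, y \<bullet> u - spatial x \<bullet> w)
     + (s ^ 3 / 6) *\<^sub>R (0, 0, vec0 (v \<bullet> kvec v w) 0, 0, - (y \<bullet> kvec v w)))"

lemma nil_act_0: "nil_act v \<epsilon> y x 0 p = p"
  by (cases p) (simp add: nil_act_def Let_def nil_vf_def zero_prod_def[symmetric])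

lemma nil_act_solution:
  "((\<lambda>s. nil_act v \<epsilon> y x s p) has_vector_derivative nil_vf v \<epsilon> y x (nil_act v \<epsilon> y x s p)) (at s)"
proof -
  obtain z \<rho> \<zeta>t \<zeta> \<sigma> where p: "p = (z, \<rho>, \<zeta>t, \<zeta>, \<sigma>)" by (cases p)
  define w where "w = y + \<zeta> $ None *\<^sub>R v"
  define u where "u = spatial x - kvec v (spatial \<zeta>)"
  define c1 c2 c3 :: pt where "c1 = nil_vf v \<epsilon> y x p"
    "c2 = (0, 0, vec0 (- (v \<bullet> u)) (- kvec v w), 0, y \<bullet> u - spatial x \<bullet> w)"
    "c3 = (0, 0, vec0 (v \<bullet> kvec v w) 0, 0, - (y \<bullet> kvec v w))"
  note c = this
  have path: "(\<lambda>s. nil_act v \<epsilon> y x s p) = (\<lambda>s. p + s *\<^sub>R c1 + (s\<^sup>2 / 2) *\<^sub>R c2 + (s ^ 3 / 6) *\<^sub>R c3)"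
    by (simp add: fun_eq_iff nil_act_def p Let_def c u_def w_def)
  have "((\<lambda>s. p + s *\<^sub>R c1 + (s\<^sup>2 / 2) *\<^sub>R c2 + (s ^ 3 / 6) *\<^sub>R c3) has_vector_derivative
      c1 + s *\<^sub>R c2 + (s\<^sup>2 / 2) *\<^sub>R c3) (at s)"
    unfolding has_vector_derivative_def
    by (rule derivative_eq_intros refl | simp)+ (simp add: fun_eq_iff algebra_simps power2_eq_square)
  also have "c1 + s *\<^sub>R c2 + (s\<^sup>2 / 2) *\<^sub>R c3 = nil_vf v \<epsilon> y x (p + s *\<^sub>R c1 + (s\<^sup>2 / 2) *\<^sub>R c2 + (s ^ 3 / 6) *\<^sub>R c3)"
    unfolding c p nil_vf_def u_def w_def
    by (rule pt_eqI; simp add: complex_eq_iff kvec_nth inner_2 inner_2_option; simp add: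
        algebra_simps power2_eq_square power3_eq_cube add_divide_distrib diff_divide_distrib)
  finally show ?thesis unfolding path fun_cong[OF path] .
qed

lemma time_one_flow_nil: "time_one_flow (nil_vf v \<epsilon> y x) p = nil_act v \<epsilon> y x 1 p"
  unfolding time_one_flow_def
proof (rule the_equality)
  show "\<exists>c. (\<forall>s. (c has_vector_derivative nil_vf v \<epsilon> y x (c s)) (at s)) \<and> c 0 = p \<and> c 1 = nil_act v \<epsilon> y x 1 p"
    by (intro exI[of _ "\<lambda>s. nil_act v \<epsilon> y x s p"]) (simp add: nil_act_0 nil_act_solution)
next
  fix q assume "\<exists>c. (\<forall>s. (c has_vector_derivative nil_vf v \<epsilon> y x (c s)) (at s)) \<and> c 0 = p \<and> c 1 = q"
  then show "q = nil_act v \<epsilon> y x 1 p"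
    using nil_vf_solution_unique[of _ v \<epsilon> y x "\<lambda>s. nil_act v \<epsilon> y x s p"] nil_act_solution nil_act_0 by metis
qed

text \<open>Following the flow for time s + r, and following it for time r from the point reached at
  time s, solve the same equation in r with the same initial value; then r = - s.\<close>

lemma nil_act_inverse: "nil_act v \<epsilon> y x (- s) (nil_act v \<epsilon> y x s p) = p"
proof -
  have "((\<lambda>r. nil_act v \<epsilon> y x (s + r) p) has_vector_derivative nil_vf v \<epsilon> y x (nil_act v \<epsilon> y x (s + r) p)) (at r)" for r
  proof -
    have "((\<lambda>r. s + r) has_vector_derivative 1) (at r)"
      by (auto intro!: derivative_eq_intros)
    from vector_diff_chain_at[OF this nil_act_solution[of v \<epsilon> y x p]] show ?thesis
      by (simp add: o_def)
  qed
  then have "nil_act v \<epsilon> y x (s + r) p = nil_act v \<epsilon> y x r (nil_act v \<epsilon> y x s p)" for r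
    by (rule nil_vf_solution_unique[OF _ nil_act_solution]) (simp add: nil_act_0)
  from this[of "- s"] show ?thesis by (simp add: nil_act_0)
qed

section \<open>Elements of the group and their inverses\<close>

definition S_act :: "real^2^2 \<Rightarrow> pt \<Rightarrow> pt" where
  "S_act A p = of_IIB (S_IIB A (to_IIB p))"

lemma S_act_in_Nbar: "det A = 1 \<Longrightarrow> p \<in> Nbar \<Longrightarrow> S_act A p \<in> Nbar"
  by (simp add: S_act_def of_IIB_in_Nbar S_IIB_in_IIB to_IIB_in_IIB)

lemma S_act_adj2: "det A = 1 \<Longrightarrow> p \<in> Nbar \<Longrightarrow> S_act (adj2 A) (S_act A p) = p"
  by (simp add: S_act_def to_IIB_of_IIB S_IIB_in_IIB to_IIB_in_IIB S_IIB_adj2 of_IIB_to_IIB)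

lemma nil_act_fst [simp]: "Im (fst (nil_act v \<epsilon> y x s p) $ a) = Im (fst p $ a)"
  and nil_act_fst_snd [simp]: "fst (snd (nil_act v \<epsilon> y x s p)) = fst (snd p)"
  by (simp_all add: nil_act_def nil_vf_def Let_def case_prod_beta)

lemma nil_act_in_Nbar [simp]: "nil_act v \<epsilon> y x s p \<in> Nbar \<longleftrightarrow> p \<in> Nbar"
  by (simp add: Nbar_iff)

definition G_elem :: "real^2^2 \<Rightarrow> real^2 \<Rightarrow> real \<Rightarrow> real^2 \<Rightarrow> real ^ 2 option \<Rightarrow> pt \<Rightarrow> pt" where
  "G_elem A v \<epsilon> y x = (\<lambda>p\<in>Nbar. S_act A (nil_act v \<epsilon> y x 1 p))"

lemma \<G>_eq: "\<G> = {G_elem A v \<epsilon> y x | A v \<epsilon> y x. det A = 1}"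
proof -
  have "restrict (S_dual A \<circ> time_one_flow (nil_vf v \<epsilon> y x)) Nbar = G_elem A v \<epsilon> y x" for A v \<epsilon> y x
    unfolding G_elem_def by (intro restrict_ext) (simp add: time_one_flow_nil S_dual_eq S_act_def)
  then show ?thesis
    unfolding \<G>_def n_alg_eq by (auto; metis)
qed

section \<open>Stretching along the curve\<close>

definition stretch :: "real^2 \<Rightarrow> pt \<Rightarrow> pt" where
  "stretch x = (\<lambda>(z, r). (cvec (ReV z) (\<chi> a. x $ a * Im (z $ a)), r))"

lemma hpoly_stretch:
  assumes "x \<in> \<H>"
  shows "hpoly (\<chi> a. x $ a * t $ a) = hpoly t"
proof -
  have "hpoly (\<chi> a. x $ a * t $ a) = ((x $ 1)\<^sup>2 * x $ 2) * hpoly t"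
    by (simp add: hpoly_def power2_eq_square)
  with assms show ?thesis by (simp add: \<H>_def)
qed

lemma \<H>_pos: "x \<in> \<H> \<Longrightarrow> x $ 1 > 0 \<and> x $ 2 > 0"
  by (auto simp: \<H>_def) (metis zero_less_mult_pos zero_less_one zero_less_power)

lemma stretch_in_Nbar: "x \<in> \<H> \<Longrightarrow> p \<in> Nbar \<Longrightarrow> stretch x p \<in> Nbar"
  using \<H>_pos[of x] by (simp add: Nbar_iff stretch_def case_prod_beta)

lemma ImV_vec: "(\<chi> a. x $ a * Im (z $ a)) = (\<chi> a. x $ a * ImV z $ a)"
  by simp

text \<open>Stretching by a point of \<H> preserves h, hence \<tau>_2 = sqrt (2 \<rho> / h), and no
  other type IIB coordinate except t itself is affected. S-duality multiplies t by a common factor,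
  which commutes with a diagonal map.\<close>

lemma S_act_stretch:
  assumes "x \<in> \<H>"
  shows "S_act A (stretch x p) = stretch x (S_act A p)"
proof -
  obtain z \<rho> \<zeta>t \<zeta> \<sigma> where p: "p = (z, \<rho>, \<zeta>t, \<zeta>, \<sigma>)" by (cases p)
  have h: "hpoly (\<chi> a. x $ a * Im (z $ a)) = hpoly (ImV z)" for z
    unfolding ImV_vec by (rule hpoly_stretch[OF assms])
  have hs: "hpoly (m *\<^sub>R (\<chi> a. x $ a * Im (z $ a))) = hpoly (m *\<^sub>R ImV z)" for m z
  proof -
    have "m *\<^sub>R (\<chi> a. x $ a * Im (z $ a)) = (\<chi> a. x $ a * (m *\<^sub>R ImV z) $ a)"
      by (simp add: vec_eq_iff)
    then show ?thesis by (simp only: hpoly_stretch[OF assms])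
  qed
  show ?thesis
    unfolding S_act_def p stretch_def of_IIB_def S_IIB_def to_IIB_def prod.case Let_def ReV_cvec ImV_cvec h
    by (simp add: vec_eq_iff hs)
qed

lemma nil_act_stretch: "nil_act v \<epsilon> y u s (stretch x p) = stretch x (nil_act v \<epsilon> y u s p)"
  by (cases p; rule pt_eqI)
    (simp_all add: nil_act_def stretch_def nil_vf_def Let_def complex_eq_iff)

lemma \<G>_stretch:
  assumes "\<gamma> \<in> \<G>" "x \<in> \<H>" "p \<in> Nbar"
  shows "\<gamma> (stretch x p) = stretch x (\<gamma> p)"
  using assms by (auto simp: \<G>_eq G_elem_def stretch_in_Nbar nil_act_stretch S_act_stretch)

lemma G_elem_inverse:
  assumes "det A = 1" "p \<in> Nbar"
  shows "nil_act v \<epsilon> y x (- 1) (S_act (adj2 A) (G_elem A v \<epsilon> y x p)) = p"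
  using assms by (simp add: G_elem_def S_act_adj2 nil_act_inverse)

section \<open>Joint continuity in group parameters and points\<close>

lemma tendsto_spatial [tendsto_intros]: "(f \<longlongrightarrow> (l :: real ^ 2 option)) F \<Longrightarrow> ((\<lambda>n. spatial (f n)) \<longlongrightarrow> spatial l) F"
  unfolding spatial_def by (intro tendsto_intros)

lemma tendsto_vec0 [tendsto_intros]:
  assumes "(f \<longlongrightarrow> a) F" "(g \<longlongrightarrow> b) F"
  shows "((\<lambda>n. vec0 (f n) (g n :: real^2)) \<longlongrightarrow> vec0 a b) F"
  unfolding vec0_def
proof (rule tendsto_vec_lambda)
  fix i :: "2 option"
  show "((\<lambda>n. case i of None \<Rightarrow> f n | Some a \<Rightarrow> g n $ a) \<longlongrightarrow> (case i of None \<Rightarrow> a | Some a \<Rightarrow> b $ a)) F"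
    using assms by (cases i) (auto intro!: tendsto_intros)
qed

lemma tendsto_kvec [tendsto_intros]:
  assumes "(f \<longlongrightarrow> a) F" "(g \<longlongrightarrow> b) F"
  shows "((\<lambda>n. kvec (f n) (g n)) \<longlongrightarrow> kvec a b) F"
  unfolding kvec_def by (intro tendsto_intros assms)

lemma tendsto_kform [tendsto_intros]:
  assumes "(f \<longlongrightarrow> a) F" "(g \<longlongrightarrow> b) F" "(h \<longlongrightarrow> c) F"
  shows "((\<lambda>n. kform (f n) (g n) (h n)) \<longlongrightarrow> kform a b c) F"
  unfolding kform_def by (intro tendsto_intros assms)

lemma tendsto_hpoly [tendsto_intros]: "(f \<longlongrightarrow> l) F \<Longrightarrow> ((\<lambda>n. hpoly (f n)) \<longlongrightarrow> hpoly l) F"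
  unfolding hpoly_def by (intro tendsto_intros)

lemma tendsto_ReV [tendsto_intros]: "(f \<longlongrightarrow> l) F \<Longrightarrow> ((\<lambda>n. ReV (f n)) \<longlongrightarrow> ReV l) F"
  unfolding ReV_def by (intro tendsto_intros)

lemma tendsto_ImV [tendsto_intros]: "(f \<longlongrightarrow> l) F \<Longrightarrow> ((\<lambda>n. ImV (f n)) \<longlongrightarrow> ImV l) F"
  unfolding ImV_def by (intro tendsto_intros)

lemma tendsto_cvec [tendsto_intros]:
  "(f \<longlongrightarrow> a) F \<Longrightarrow> (g \<longlongrightarrow> b) F \<Longrightarrow> ((\<lambda>n. cvec (f n) (g n)) \<longlongrightarrow> cvec a b) F"
  unfolding cvec_def by (intro tendsto_intros)

lemma tendsto_adj2 [tendsto_intros]: 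
  assumes "(A \<longlongrightarrow> B) F"
  shows "((\<lambda>n. adj2 (A n)) \<longlongrightarrow> adj2 B) F"
proof -
  have adj2: "adj2 A = (\<chi> i j. if i = 1 then if j = 1 then A $ 2 $ 2 else - A $ 1 $ 2
      else if j = 1 then - A $ 2 $ 1 else A $ 1 $ 1)" for A
    by (simp add: adj2_def vec_eq_iff forall_2)
  show ?thesis
    unfolding adj2 by (intro tendsto_vec_lambda; simp; intro impI conjI tendsto_intros assms)
qed

lemma tendsto_nil_act [tendsto_intros]:
  assumes "(v \<longlongrightarrow> v0) F" "(\<epsilon> \<longlongrightarrow> \<epsilon>0) F" "(y \<longlongrightarrow> y0) F" "(x \<longlongrightarrow> x0) F" "(p \<longlongrightarrow> p0) F"
  shows "((\<lambda>n. nil_act (v n) (\<epsilon> n) (y n) (x n) s (p n)) \<longlongrightarrow> nil_act v0 \<epsilon>0 y0 x0 s p0) F"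
  unfolding nil_act_def nil_vf_def Let_def case_prod_beta
  by (intro tendsto_intros assms) simp_all

text \<open>Later the group elements vary along with the points, so continuity in both at once is
  required. The formula divides by h and by c \<tau> + d, neither of which vanishes at the
  limit.\<close>

lemma tendsto_S_act [tendsto_intros]:
  assumes A: "(A \<longlongrightarrow> A0) F" "det A0 = 1" and p: "(p \<longlongrightarrow> p0) F" "p0 \<in> Nbar"
  shows "((\<lambda>n. S_act (A n) (p n)) \<longlongrightarrow> S_act A0 p0) F"
proof -
  have h: "hpoly (ImV (fst p0)) \<noteq> 0"
    using hpoly_pos[OF p(2)] by simp
  have m: "complex_of_real (A0 $ 2 $ 1) * Complex (fst (snd (snd (snd p0))) $ None) (sqrt (2 * fst (snd p0) / hpoly (ImV (fst p0))))
      + complex_of_real (A0 $ 2 $ 2) \<noteq> 0"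
    using hpoly_pos[OF p(2)] p(2) by (intro moebius_denom_nz A(2)) (auto simp: Nbar_iff)
  show ?thesis
    unfolding S_act_def of_IIB_def S_IIB_def to_IIB_def Let_def case_prod_beta fst_conv snd_conv
    by (intro tendsto_intros A(1) p(1) h m) simp_all
qed

lemma isCont_\<G>:
  assumes "\<gamma> \<in> \<G>" "p \<in> Nbar"
  shows "isCont \<gamma> p"
proof -
  obtain A v \<epsilon> y x where \<gamma>: "\<gamma> = G_elem A v \<epsilon> y x" "det A = 1"
    using assms(1) by (auto simp: \<G>_eq)
  have "((\<lambda>p. S_act A (nil_act v \<epsilon> y x 1 p)) \<longlongrightarrow> S_act A (nil_act v \<epsilon> y x 1 p)) (at p)"
    using assms \<gamma>(2) by (intro tendsto_intros) simp_all
  \<comment> \<open>Outside \<open>Nbar\<close> the restricted map is \<open>undefined\<close>;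
    openness of \<open>Nbar\<close> keeps this away from the point.\<close>
  moreover have "\<forall>\<^sub>F p in at p. S_act A (nil_act v \<epsilon> y x 1 p) = \<gamma> p"
    using assms(2) open_Nbar unfolding eventually_at_topological by (auto simp: \<gamma>(1) G_elem_def)
  ultimately show ?thesis
    unfolding isCont_def using assms(2) by (auto simp: \<gamma>(1) G_elem_def intro: Lim_transform_eventually)
qed

section \<open>Proper discontinuity\<close>

text \<open>The type IIB coordinate \<tau>. It is an equivariant map to the upper half-plane: the
  nilpotent flows fix it, and SL(2,R) moves it by fractional linear maps.\<close>

definition tau_of :: "pt \<Rightarrow> complex" where
  "tau_of p = Complex (fst (snd (snd (snd p))) $ None) (sqrt (2 * fst (snd p) / hpoly (ImV (fst p))))"

lemma tau_of_to_IIB: "fst (snd (to_IIB p)) = tau_of p"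
  by (simp add: to_IIB_def tau_of_def Let_def case_prod_beta)

lemma Im_tau_of_pos: "p \<in> Nbar \<Longrightarrow> Im (tau_of p) > 0"
  using hpoly_pos[of p] by (simp add: tau_of_def Nbar_iff)

lemma tendsto_tau_of [tendsto_intros]:
  assumes "(p \<longlongrightarrow> p0) F" "p0 \<in> Nbar"
  shows "((\<lambda>n. tau_of (p n)) \<longlongrightarrow> tau_of p0) F"
  unfolding tau_of_def using hpoly_pos[OF assms(2)] by (intro tendsto_intros assms) simp

lemma tau_of_nil_act: "tau_of (nil_act v \<epsilon> y x s p) = tau_of p"
proof -
  have "ImV (fst (nil_act v \<epsilon> y x s p)) = ImV (fst p)" by (simp add: vec_eq_iff)
  moreover have "fst (snd (snd (snd (nil_act v \<epsilon> y x s p)))) $ None = fst (snd (snd (snd p))) $ None"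
    by (simp add: nil_act_def nil_vf_def Let_def case_prod_beta)
  ultimately show ?thesis by (simp add: tau_of_def)
qed

lemma tau_of_S_act:
  assumes "det A = 1" "p \<in> Nbar"
  shows "tau_of (S_act A p) = (complex_of_real (A $ 1 $ 1) * tau_of p + complex_of_real (A $ 1 $ 2))
    / (complex_of_real (A $ 2 $ 1) * tau_of p + complex_of_real (A $ 2 $ 2))"
  unfolding tau_of_to_IIB[symmetric] S_act_def
  by (subst to_IIB_of_IIB) (simp_all add: S_IIB_in_IIB assms to_IIB_in_IIB, simp add: S_IIB_def case_prod_beta Let_def)

section \<open>Properness of the action, in terms of sequences\<close>

lemma Bseq_dominated: "Bseq g \<Longrightarrow> (\<And>n. norm (f n) \<le> norm (g n)) \<Longrightarrow> Bseq f"
  by (rule Bseq_eventually_mono[of f g]) auto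

lemma Bseq_plus:
  fixes f g :: "nat \<Rightarrow> 'a::real_normed_vector"
  assumes "Bseq f" "Bseq g"
  shows "Bseq (\<lambda>n. f n + g n)"
proof -
  obtain K L where "\<And>n. norm (f n) \<le> K" "\<And>n. norm (g n) \<le> L"
    using assms by (metis BseqE)
  then have "norm (f n + g n) \<le> K + L" for n
    by (meson add_mono norm_triangle_le)
  then show ?thesis by (rule BseqI')
qed

text \<open>Properness of the action of SL(2,R) on the upper half-plane. From Im t = Im s / |m|^2
  the denominators m = c s + d are bounded, hence so are the numerators k = t m. As Im s stays away
  from 0, the imaginary parts of m and k bound c and a, and the real parts then bound d and
  b.\<close>

lemma Bseq_SL2:
  fixes A :: "nat \<Rightarrow> real^2^2" and s t :: "nat \<Rightarrow> complex"
  assumes det: "\<And>n. det (A n) = 1"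
    and s: "s \<longlonglongrightarrow> s0" "Im s0 > 0" "\<And>n. Im (s n) > 0"
    and t: "t \<longlonglongrightarrow> t0" "Im t0 > 0" "\<And>n. Im (t n) > 0"
    and eq: "\<And>n. t n = (complex_of_real (A n $ 1 $ 1) * s n + complex_of_real (A n $ 1 $ 2))
        / (complex_of_real (A n $ 2 $ 1) * s n + complex_of_real (A n $ 2 $ 2))"
  shows "Bseq A"
proof -
  define m where "m = (\<lambda>n. complex_of_real (A n $ 2 $ 1) * s n + complex_of_real (A n $ 2 $ 2))"
  define k where "k = (\<lambda>n. complex_of_real (A n $ 1 $ 1) * s n + complex_of_real (A n $ 1 $ 2))"
  have m0: "m n \<noteq> 0" for n
    unfolding m_def using moebius_denom_nz det s(3) by blast
  have "Im (t n) = Im (s n) / (cmod (m n))\<^sup>2" for n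
    unfolding eq m_def by (rule Im_moebius[OF det s(3)])
  then have "(cmod (m n))\<^sup>2 = Im (s n) / Im (t n)" for n
    using t(3)[of n] m0[of n] by (simp add: field_simps)
  then have "cmod (m n) = sqrt (Im (s n) / Im (t n))" for n
    by (metis norm_ge_zero real_sqrt_unique)
  moreover have "(\<lambda>n. sqrt (Im (s n) / Im (t n))) \<longlonglongrightarrow> sqrt (Im s0 / Im t0)"
    using t(2) by (intro tendsto_intros s t) simp
  ultimately have "Bseq (\<lambda>n. cmod (m n))"
    by (simp add: convergent_def convergent_imp_Bseq) (metis convergentI convergent_imp_Bseq)
  then have m: "Bseq m" by (rule Bseq_dominated) simp
  have invs: "Bseq (\<lambda>n. 1 / Im (s n))"
  proof (rule convergent_imp_Bseq, rule convergentI)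
    show "(\<lambda>n. 1 / Im (s n)) \<longlonglongrightarrow> 1 / Im s0" using s(2) by (intro tendsto_intros s) simp
  qed
  have sB: "Bseq s" "Bseq t" using s t by (auto intro!: convergent_imp_Bseq convergentI)
  have Re_Im: "Bseq (\<lambda>n. Re (f n))" "Bseq (\<lambda>n. Im (f n))" if "Bseq f" for f
    by (rule Bseq_dominated[OF that]; simp add: abs_Re_le_cmod abs_Im_le_cmod)+
  have k: "Bseq k"
  proof -
    have "k n = t n * m n" for n using m0[of n] eq[of n] by (simp add: k_def m_def)
    then have "k = (\<lambda>n. t n * m n)" by auto
    then show ?thesis using Bseq_mult[OF sB(2) m] by simp
  qed
  have c: "Bseq (\<lambda>n. A n $ 2 $ 1)"
  proof -
    have "A n $ 2 $ 1 = Im (m n) * (1 / Im (s n))" for n using s(3)[of n] by (simp add: m_def)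
    then show ?thesis using Bseq_mult[OF Re_Im(2)[OF m] invs] by simp
  qed
  have a: "Bseq (\<lambda>n. A n $ 1 $ 1)"
  proof -
    have "A n $ 1 $ 1 = Im (k n) * (1 / Im (s n))" for n using s(3)[of n] by (simp add: k_def)
    then show ?thesis using Bseq_mult[OF Re_Im(2)[OF k] invs] by simp
  qed
  have d: "Bseq (\<lambda>n. A n $ 2 $ 2)"
  proof -
    have "A n $ 2 $ 2 = Re (m n) + - (A n $ 2 $ 1 * Re (s n))" for n by (simp add: m_def)
    then show ?thesis
      using Bseq_plus[OF Re_Im(1)[OF m] Bseq_minus_iff[THEN iffD2, OF Bseq_mult[OF c Re_Im(1)[OF sB(1)]]]] by simp
  qed
  have b: "Bseq (\<lambda>n. A n $ 1 $ 2)"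
  proof -
    have "A n $ 1 $ 2 = Re (k n) + - (A n $ 1 $ 1 * Re (s n))" for n by (simp add: k_def)
    then show ?thesis
      using Bseq_plus[OF Re_Im(1)[OF k] Bseq_minus_iff[THEN iffD2, OF Bseq_mult[OF a Re_Im(1)[OF sB(1)]]]] by simp
  qed
  have "norm (A n) \<le> norm (\<bar>A n $ 1 $ 1\<bar> + \<bar>A n $ 1 $ 2\<bar> + (\<bar>A n $ 2 $ 1\<bar> + \<bar>A n $ 2 $ 2\<bar>))" for n
  proof -
    have "norm (A n) \<le> (\<Sum>i\<in>UNIV. norm (A n $ i))"
      unfolding norm_vec_def by (rule L2_set_le_sum) simp
    also have "\<dots> \<le> (\<Sum>i\<in>UNIV. \<Sum>j\<in>UNIV. \<bar>A n $ i $ j\<bar>)"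
      by (intro sum_mono norm_le_l1_cart)
    finally show ?thesis by (simp add: sum_2)
  qed
  moreover have "Bseq (\<lambda>n. \<bar>A n $ 1 $ 1\<bar> + \<bar>A n $ 1 $ 2\<bar> + (\<bar>A n $ 2 $ 1\<bar> + \<bar>A n $ 2 $ 2\<bar>))"
    by (intro Bseq_plus; rule Bseq_dominated, rule a b c d, simp)
  ultimately show ?thesis by (blast intro: Bseq_dominated)
qed

text \<open>The nilpotent group acts freely. Its parameters are recovered in triangular order, v
  from b, y from \<zeta>^a, x_a from \<zeta>t_a, x_0 from \<zeta>t_0 and \<epsilon> from \<sigma>;
  each right-hand side involves earlier parameters only.\<close>

lemma nil_act_param:
  assumes "q = nil_act v \<epsilon> y x 1 p"
  defines "\<zeta>t \<equiv> fst (snd (snd p))" and "\<zeta> \<equiv> fst (snd (snd (snd p)))" and "w \<equiv> y + fst (snd (snd (snd p))) $ None *\<^sub>R v"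
    and "u \<equiv> spatial x - kvec v (spatial (fst (snd (snd (snd p)))))"
  shows "v = ReV (fst q) - ReV (fst p)"
    and "y = spatial (fst (snd (snd (snd q)))) - spatial \<zeta> - \<zeta> $ None *\<^sub>R v"
    and "spatial x = spatial (fst (snd (snd q))) - spatial \<zeta>t + (1/2) *\<^sub>R kvec v w + kvec v (spatial \<zeta>)"
    and "x $ None = fst (snd (snd q)) $ None - \<zeta>t $ None + v \<bullet> spatial \<zeta>t + v \<bullet> u / 2 - v \<bullet> kvec v w / 6"
    and "\<epsilon> = snd (snd (snd (snd q))) - snd (snd (snd (snd p))) - y \<bullet> spatial \<zeta>t + x \<bullet> \<zeta> - (y \<bullet> u - spatial x \<bullet> w) / 2
      + y \<bullet> kvec v w / 6"
proof -
  have q: "q = p + nil_vf v \<epsilon> y x p + (1 / 2) *\<^sub>R (0, 0, vec0 (- (v \<bullet> u)) (- kvec v w), 0, y \<bullet> u - spatial x \<bullet> w)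
     + (1 / 6) *\<^sub>R (0, 0, vec0 (v \<bullet> kvec v w) 0, 0, - (y \<bullet> kvec v w))"
    by (simp add: assms nil_act_def Let_def case_prod_beta)
  have vf: "nil_vf v \<epsilon> y x p = (cvec v 0, 0, vec0 (x $ None - v \<bullet> spatial \<zeta>t) u, vec0 0 w,
     \<epsilon> + y \<bullet> spatial \<zeta>t - x \<bullet> \<zeta>)"
    by (simp add: nil_vf_def case_prod_beta \<zeta>t_def \<zeta>_def u_def w_def)
  show "v = ReV (fst q) - ReV (fst p)" unfolding q vf by (simp add: vec_eq_iff)
  have "spatial (fst (snd (snd (snd q)))) = spatial \<zeta> + w"
    unfolding q vf by (simp add: vec_eq_iff \<zeta>_def)
  then show "y = spatial (fst (snd (snd (snd q)))) - spatial \<zeta> - \<zeta> $ None *\<^sub>R v"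
    by (simp add: w_def \<zeta>_def)
  have "spatial (fst (snd (snd q))) = spatial \<zeta>t + u - (1/2) *\<^sub>R kvec v w"
    unfolding q vf by (simp add: vec_eq_iff \<zeta>t_def)
  then show "spatial x = spatial (fst (snd (snd q))) - spatial \<zeta>t + (1/2) *\<^sub>R kvec v w + kvec v (spatial \<zeta>)"
    by (simp add: u_def \<zeta>_def)
  show "x $ None = fst (snd (snd q)) $ None - \<zeta>t $ None + v \<bullet> spatial \<zeta>t + v \<bullet> u / 2 - v \<bullet> kvec v w / 6"
    unfolding q vf by (simp add: \<zeta>t_def)
  have "snd (snd (snd (snd q))) = snd (snd (snd (snd p))) + (\<epsilon> + y \<bullet> spatial \<zeta>t - x \<bullet> \<zeta>)
      + (y \<bullet> u - spatial x \<bullet> w) / 2 - y \<bullet> kvec v w / 6"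
    unfolding q vf by simp
  then show "\<epsilon> = snd (snd (snd (snd q))) - snd (snd (snd (snd p))) - y \<bullet> spatial \<zeta>t + x \<bullet> \<zeta> - (y \<bullet> u - spatial x \<bullet> w) / 2
      + y \<bullet> kvec v w / 6" by linarith
qed

lemma vec0_None_spatial: "vec0 (x $ None) (spatial x) = x"
  by (simp add: vec_eq_iff split_option_all)

lemma nil_act_param_convergent:
  assumes q: "\<And>n. q n = nil_act (v n) (\<epsilon> n) (y n) (x n) 1 (p n)"
    and p0: "p \<longlonglongrightarrow> p0" and q0: "q \<longlonglongrightarrow> q0"
  shows "convergent v" "convergent \<epsilon>" "convergent y" "convergent x"
proof -
  let ?\<zeta>t = "\<lambda>p :: pt. fst (snd (snd p))" and ?\<zeta> = "\<lambda>p :: pt. fst (snd (snd (snd p)))"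
  note par = nil_act_param[OF q]
  note lim = tendsto_fst[OF p0] tendsto_fst[OF q0] tendsto_snd[OF p0] tendsto_snd[OF q0]
  have v: "v \<longlonglongrightarrow> ReV (fst q0) - ReV (fst p0)" (is "_ \<longlonglongrightarrow> ?v")
    unfolding par(1)[abs_def] by (intro tendsto_intros p0 q0)
  then show "convergent v" by (rule convergentI)
  have y: "y \<longlonglongrightarrow> spatial (?\<zeta> q0) - spatial (?\<zeta> p0) - ?\<zeta> p0 $ None *\<^sub>R ?v" (is "_ \<longlonglongrightarrow> ?y")
    by (subst par(2)[abs_def]) (intro tendsto_intros p0 q0 v)
  then show "convergent y" by (rule convergentI)
  have xs: "(\<lambda>n. spatial (x n)) \<longlonglongrightarrow> spatial (?\<zeta>t q0) - spatial (?\<zeta>t p0)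
      + (1/2) *\<^sub>R kvec ?v (?y + ?\<zeta> p0 $ None *\<^sub>R ?v) + kvec ?v (spatial (?\<zeta> p0))" (is "_ \<longlonglongrightarrow> ?xs")
    by (subst par(3)) (intro tendsto_intros p0 q0 v y)
  obtain c where x0: "(\<lambda>n. x n $ None) \<longlonglongrightarrow> c"
  proof
    show "(\<lambda>n. x n $ None) \<longlonglongrightarrow> ?\<zeta>t q0 $ None - ?\<zeta>t p0 $ None + ?v \<bullet> spatial (?\<zeta>t p0)
       + ?v \<bullet> (?xs - kvec ?v (spatial (?\<zeta> p0))) / 2 - ?v \<bullet> kvec ?v (?y + ?\<zeta> p0 $ None *\<^sub>R ?v) / 6"
    by (subst par(4)) (intro tendsto_intros p0 q0 v y xs; simp)
  qed
  have "(\<lambda>n. vec0 (x n $ None) (spatial (x n))) \<longlonglongrightarrow> vec0 c ?xs"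
    by (intro tendsto_intros x0 xs)
  then have x: "x \<longlonglongrightarrow> vec0 c ?xs" by (simp add: vec0_None_spatial)
  then show "convergent x" by (rule convergentI)
  show "convergent \<epsilon>"
  proof (rule convergentI)
    show "\<epsilon> \<longlonglongrightarrow> snd (snd (snd (snd q0))) - snd (snd (snd (snd p0))) - ?y \<bullet> spatial (?\<zeta>t p0) + vec0 c ?xs \<bullet> ?\<zeta> p0
        - (?y \<bullet> (?xs - kvec ?v (spatial (?\<zeta> p0))) - ?xs \<bullet> (?y + ?\<zeta> p0 $ None *\<^sub>R ?v)) / 2
        + ?y \<bullet> kvec ?v (?y + ?\<zeta> p0 $ None *\<^sub>R ?v) / 6"
      by (subst par(5)[abs_def]) (intro tendsto_intros p0 q0 v y xs x; simp)
  qed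
qed

text \<open>Boundedness of the matrices comes from \<tau>, which the nilpotent part does not move. A
  point of the half-plane has a circle as stabiliser, so only a subsequence of matrices converges.
  Undoing these matrices makes the nilpotent images converge, and they determine the other
  parameters.\<close>

lemma G_elem_seq_convergent:
  assumes det: "\<And>n. det (A n) = 1"
    and p: "\<And>n. p n \<in> Nbar" "p \<longlonglongrightarrow> p0" "p0 \<in> Nbar"
    and q: "(\<lambda>n. G_elem (A n) (v n) (\<epsilon> n) (y n) (x n) (p n)) \<longlonglongrightarrow> q0" "q0 \<in> Nbar"
  obtains r A0 v0 \<epsilon>0 y0 x0 where "strict_mono (r :: nat \<Rightarrow> nat)" "det A0 = 1" "(A \<circ> r) \<longlonglongrightarrow> A0"
    "(v \<circ> r) \<longlonglongrightarrow> v0" "(\<epsilon> \<circ> r) \<longlonglongrightarrow> \<epsilon>0" "(y \<circ> r) \<longlonglongrightarrow> y0" "(x \<circ> r) \<longlonglongrightarrow> x0"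
proof -
  define q' where "q' n = nil_act (v n) (\<epsilon> n) (y n) (x n) 1 (p n)" for n
  have q': "q' n \<in> Nbar" for n using p(1) by (simp add: q'_def)
  have G: "G_elem (A n) (v n) (\<epsilon> n) (y n) (x n) (p n) = S_act (A n) (q' n)" for n
    using p(1) by (simp add: G_elem_def q'_def)
  note q = q[unfolded G]
  have "Bseq A"
  proof (rule Bseq_SL2[where s = "\<lambda>n. tau_of (p n)" and t = "\<lambda>n. tau_of (S_act (A n) (q' n))"])
    show "tau_of (S_act (A n) (q' n)) = (complex_of_real (A n $ 1 $ 1) * tau_of (p n) + complex_of_real (A n $ 1 $ 2))
      / (complex_of_real (A n $ 2 $ 1) * tau_of (p n) + complex_of_real (A n $ 2 $ 2))" for n
      unfolding tau_of_S_act[OF det q'] by (simp add: q'_def tau_of_nil_act)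
  qed (use det p q q' in \<open>auto intro!: tendsto_intros Im_tau_of_pos S_act_in_Nbar\<close>)
  then have "bounded (range A)" by (auto simp: Bseq_def bounded_iff)
  from bounded_imp_convergent_subsequence[OF this] obtain A0 r
    where r: "strict_mono (r :: nat \<Rightarrow> nat)" and A0: "(A \<circ> r) \<longlonglongrightarrow> A0" by auto
  have "(\<lambda>n. det ((A \<circ> r) n)) \<longlonglongrightarrow> det A0"
    unfolding det_2 by (intro tendsto_intros A0)
  with det have det0: "det A0 = 1" by (simp add: LIMSEQ_const_iff)
  have sub: "(f \<circ> r) \<longlonglongrightarrow> l" if "f \<longlonglongrightarrow> l" for f :: "nat \<Rightarrow> pt" and l
    using that r by (rule LIMSEQ_subseq_LIMSEQ)
  have "(\<lambda>n. S_act (adj2 ((A \<circ> r) n)) (((\<lambda>n. S_act (A n) (q' n)) \<circ> r) n)) \<longlonglongrightarrow> S_act (adj2 A0) q0"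
    using det0 by (intro tendsto_intros A0 sub q) (simp_all add: det_adj2)
  then have "(\<lambda>n. (q' \<circ> r) n) \<longlonglongrightarrow> S_act (adj2 A0) q0"
    by (simp add: S_act_adj2 det q')
  then have lim: "(q' \<circ> r) \<longlonglongrightarrow> S_act (adj2 A0) q0" by (simp add: o_def)
  have "(q' \<circ> r) n = nil_act ((v \<circ> r) n) ((\<epsilon> \<circ> r) n) ((y \<circ> r) n) ((x \<circ> r) n) 1 ((p \<circ> r) n)" for n
    by (simp add: q'_def)
  note nil_act_param_convergent[OF this sub[OF p(2)] lim]
  with that[OF r det0 A0] show ?thesis unfolding convergent_def by blast
qed

section \<open>Finiteness near a point, and open sets that embed in the quotient\<close>

lemma tendsto_fun_componentwise:
  fixes f :: "'a \<Rightarrow> 'b \<Rightarrow> 'c::topological_space"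
  assumes "\<And>i. ((\<lambda>n. f n i) \<longlongrightarrow> l i) F"
  shows "(f \<longlongrightarrow> l) F"
proof -
  have "limitin (product_topology (\<lambda>i. euclidean) UNIV) f l F"
    using assms by (simp add: limitin_componentwise)
  then show ?thesis by (simp add: euclidean_product_topology)
qed

text \<open>Discreteness is used only at the identity: it isolates the identity in
  \<open>\<Gamma>\<close>, and quotients of consecutive elements of a convergent sequence stay in
  \<open>\<Gamma>\<close>. This avoids showing that \<open>\<Gamma>\<close> is closed.\<close>

lemma finite_moving_near:
  assumes \<Gamma>: "subgroup \<Gamma> (BijGroup Nbar)" "\<Gamma> \<subseteq> \<G>" "discrete \<Gamma>" and p0: "p0 \<in> Nbar"
  obtains V where "open V" "p0 \<in> V" "V \<subseteq> Nbar" "finite {\<gamma> \<in> \<Gamma>. \<exists>p\<in>V. \<gamma> p \<in> V}"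
proof -
  obtain e where e: "e > 0" "ball p0 e \<subseteq> Nbar"
    using open_Nbar p0 openE by blast
  define V where "V n = ball p0 (e / real (Suc n))" for n
  have V: "open (V n)" "p0 \<in> V n" "V n \<subseteq> Nbar" for n
  proof -
    have "e / real (Suc n) \<le> e" using e(1) by (simp add: divide_le_eq)
    then have "V n \<subseteq> ball p0 e" unfolding V_def by (rule subset_ball)
    with e(2) show "V n \<subseteq> Nbar" by blast
  qed (use e in \<open>auto simp: V_def\<close>)
  have "\<exists>n. finite {\<gamma> \<in> \<Gamma>. \<exists>p\<in>V n. \<gamma> p \<in> V n}"
  proof (rule ccontr)
    assume "\<nexists>n. finite {\<gamma> \<in> \<Gamma>. \<exists>p\<in>V n. \<gamma> p \<in> V n}"
    then have inf: "infinite {\<gamma> \<in> \<Gamma>. \<exists>p\<in>V n. \<gamma> p \<in> V n}" for n by blast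
    \<comment> \<open>Each choice avoids the finitely many earlier ones, which is possible as every
      one of these sets is infinite. The resulting injectivity is what fails at the end.\<close>
    have "\<exists>g. \<forall>n. g n \<in> {\<gamma> \<in> \<Gamma>. \<exists>p\<in>V n. \<gamma> p \<in> V n} \<and> g n \<notin> g ` {..<n}"
    proof (rule dependent_wellorder_choice)
      fix r :: "pt \<Rightarrow> pt" and f g :: "nat \<Rightarrow> pt \<Rightarrow> pt" and n
      assume "\<And>m. m < n \<Longrightarrow> f m = g m"
      then have "f ` {..<n} = g ` {..<n}" by (intro image_cong) auto
      then show "(r \<in> {\<gamma> \<in> \<Gamma>. \<exists>p\<in>V n. \<gamma> p \<in> V n} \<and> r \<notin> f ` {..<n}) = (r \<in> {\<gamma> \<in> \<Gamma>. \<exists>p\<in>V n. \<gamma> p \<in> V n} \<and> r \<notin> g ` {..<n})"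
        by simp
    next
      fix n and f :: "nat \<Rightarrow> pt \<Rightarrow> pt"
      show "\<exists>r. r \<in> {\<gamma> \<in> \<Gamma>. \<exists>p\<in>V n. \<gamma> p \<in> V n} \<and> r \<notin> f ` {..<n}"
        using inf[of n] by (meson finite_imageI finite_lessThan finite_subset subsetI)
    qed
    then obtain g where g: "\<And>n. g n \<in> \<Gamma>" "\<And>n. \<exists>p\<in>V n. g n p \<in> V n" "\<And>n. g n \<notin> g ` {..<n}"
      by blast
    then have neq: "g m \<noteq> g n" if "m < n" for m n
      using that by (metis imageI lessThan_iff)
    from g(2) obtain p where p: "\<And>n. p n \<in> V n" "\<And>n. g n (p n) \<in> V n" by metis
    have lim: "f \<longlonglongrightarrow> p0" if "\<And>n. f n \<in> V n" for f
    proof (rule metric_tendsto_imp_tendsto)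
      have "(\<lambda>n. e * inverse (real (Suc n))) \<longlonglongrightarrow> e * 0"
        by (intro tendsto_intros LIMSEQ_inverse_real_of_nat)
      then show "(\<lambda>n. e / real (Suc n)) \<longlonglongrightarrow> 0" by (simp add: divide_inverse)
      show "\<forall>\<^sub>F n in sequentially. dist (f n) p0 \<le> dist (e / real (Suc n)) 0"
        using that e(1) by (intro always_eventually) (auto simp: V_def dist_commute less_imp_le)
    qed
    have "\<exists>A v \<epsilon> y x. det A = 1 \<and> g n = G_elem A v \<epsilon> y x" for n
      using g(1)[of n] \<Gamma>(2) unfolding \<G>_eq by blast
    then obtain A v \<epsilon> y x where det: "\<And>n. det (A n) = 1" and gn: "\<And>n. g n = G_elem (A n) (v n) (\<epsilon> n) (y n) (x n)"
      by metis
    have pN: "p n \<in> Nbar" for n using p(1) V(3) by blast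
    obtain r A0 v0 \<epsilon>0 y0 x0 where r: "strict_mono (r :: nat \<Rightarrow> nat)" "det A0 = 1" and
      lims: "(A \<circ> r) \<longlonglongrightarrow> A0" "(v \<circ> r) \<longlonglongrightarrow> v0" "(\<epsilon> \<circ> r) \<longlonglongrightarrow> \<epsilon>0" "(y \<circ> r) \<longlonglongrightarrow> y0" "(x \<circ> r) \<longlonglongrightarrow> x0"
      by (rule G_elem_seq_convergent[OF det pN lim[OF p(1)] p0 lim[OF p(2)[unfolded gn]] p0])
    define h where "h n = g (r n)" for n
    define \<delta> where "\<delta> n = inv\<^bsub>BijGroup Nbar\<^esub> (h n) \<otimes>\<^bsub>BijGroup Nbar\<^esub> h (Suc n)" for n
    have hB: "h n \<in> Bij Nbar" for n
      using subgroup.subset[OF \<Gamma>(1)] g(1) by (auto simp: h_def BijGroup_def)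
    have inv: "inv\<^bsub>BijGroup Nbar\<^esub> (h n) \<in> Bij Nbar" for n
      using hB by (simp add: inv_BijGroup restrict_inv_into_Bij)
    have \<delta>: "\<delta> n = compose Nbar (\<lambda>p\<in>Nbar. inv_into Nbar (h n) p) (h (Suc n))" for n
    proof -
      have "f \<otimes>\<^bsub>BijGroup Nbar\<^esub> g = compose Nbar f g" if "f \<in> Bij Nbar" "g \<in> Bij Nbar" for f g
        using that by (simp add: BijGroup_def)
      from this[OF inv hB] show ?thesis by (simp only: \<delta>_def inv_BijGroup[OF hB])
    qed
    have "\<delta> \<longlonglongrightarrow> (\<lambda>p\<in>Nbar. p)"
    proof (rule tendsto_fun_componentwise)
      fix p :: pt
      show "(\<lambda>n. \<delta> n p) \<longlonglongrightarrow> (\<lambda>p\<in>Nbar. p) p"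
      \<comment> \<open>Outside \<open>Nbar\<close> both sides are \<open>undefined\<close>, the
        elements being extensional.\<close>
      proof (cases "p \<in> Nbar")
        case True
        let ?S = "\<lambda>n. S_act (A (r n)) (nil_act (v (r n)) (\<epsilon> (r n)) (y (r n)) (x (r n)) 1 p)"
        let ?T = "\<lambda>n p. nil_act (v (r n)) (\<epsilon> (r n)) (y (r n)) (x (r n)) (- 1) (S_act (adj2 (A (r n))) p)"
        let ?Slim = "S_act A0 (nil_act v0 \<epsilon>0 y0 x0 1 p)"
        let ?Tlim = "\<lambda>p. nil_act v0 \<epsilon>0 y0 x0 (- 1) (S_act (adj2 A0) p)"
        \<comment> \<open>The abstract inverse in the group of bijections is the explicit one, so
          the convergent parameters of \<open>h n\<close> also control the inverse.\<close>
        have inv_into: "inv_into Nbar (h n) q = ?T n q" if q: "q \<in> Nbar" for n q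
        proof -
          have bij: "inj_on (h n) Nbar" "h n ` Nbar = Nbar" using hB[of n] by (auto simp: Bij_def bij_betw_def)
          then obtain q' where q': "q = h n q'" "q' \<in> Nbar"
            using q by blast
          have "inv_into Nbar (h n) q = q'"
            unfolding q'(1) by (rule inv_into_f_f) fact+
          also have "\<dots> = ?T n q"
            unfolding q'(1) h_def gn using G_elem_inverse[OF det q'(2)] by simp
          finally show ?thesis .
        qed
        have S: "?S n \<in> Nbar" for n using True det by (simp add: S_act_in_Nbar)
        have "\<delta> n p = ?T n (?S (Suc n))" for n
          using True S inv_into by (simp add: \<delta> compose_def h_def gn G_elem_def)
        moreover have "(\<lambda>n. ?T n (?S (Suc n))) \<longlonglongrightarrow> ?Tlim ?Slim"
        proof -
          note l = lims[unfolded o_def]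
          have "?S \<longlonglongrightarrow> ?Slim"
            using True r(2) by (intro tendsto_S_act tendsto_nil_act tendsto_const l) auto
          then have "(\<lambda>n. ?S (Suc n)) \<longlonglongrightarrow> ?Slim"
            by (rule LIMSEQ_Suc)
          from tendsto_S_act[OF tendsto_adj2[OF l(1)] _ this]
          have "(\<lambda>n. S_act (adj2 (A (r n))) (?S (Suc n))) \<longlonglongrightarrow> S_act (adj2 A0) ?Slim"
            using True r(2) by (simp add: det_adj2 S_act_in_Nbar)
          then show ?thesis by (rule tendsto_nil_act[OF l(2-5)])
        qed
        moreover have "?Tlim ?Slim = p"
          using True r(2) by (simp add: S_act_adj2 nil_act_inverse)
        ultimately show ?thesis using True by simp
      qed (simp add: \<delta> compose_def)
    qed
    moreover have "(\<lambda>p\<in>Nbar. p) \<in> \<Gamma>"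
      using subgroup.one_closed[OF \<Gamma>(1)] by (simp add: BijGroup_def)
    with \<Gamma>(3) obtain T where T: "open T" "T \<inter> \<Gamma> = {\<lambda>p\<in>Nbar. p}"
      unfolding discrete_def isolated_in_def by blast
    ultimately have "\<forall>\<^sub>F n in sequentially. \<delta> n \<in> T"
      by (intro topological_tendstoD) auto
    then obtain n where "\<delta> n \<in> T" by (auto simp: eventually_sequentially)
    moreover have "\<delta> n \<in> \<Gamma>"
      unfolding \<delta>_def h_def by (intro subgroup.m_closed[OF \<Gamma>(1)] subgroup.m_inv_closed[OF \<Gamma>(1)] g(1))
    ultimately have "\<delta> n = \<one>\<^bsub>BijGroup Nbar\<^esub>"
      using T(2) by (auto simp: BijGroup_def)
    then have "h (Suc n) = h n"
    proof -
      interpret group "BijGroup Nbar" by (rule group_BijGroup)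
      have c: "h k \<in> carrier (BijGroup Nbar)" for k using hB by (simp add: BijGroup_def)
      have "h (Suc n) = h n \<otimes>\<^bsub>BijGroup Nbar\<^esub> \<delta> n"
        by (simp add: \<delta>_def m_assoc[symmetric] c)
      with \<open>\<delta> n = \<one>\<^bsub>BijGroup Nbar\<^esub>\<close> show ?thesis by (simp add: c)
    qed
    moreover have "r n < r (Suc n)" using r(1) by (simp add: strict_mono_Suc_iff)
    ultimately show False using neq unfolding h_def by metis
  qed
  with that V show ?thesis by blast
qed

text \<open>Points may have non-trivial finite stabilisers, so the set is shrunk for one group element after the
  other, until each of them either displaces it or fixes it pointwise.\<close>

lemma ex_injective_open:
  fixes \<phi> :: "'a::t2_space \<Rightarrow> pt"
  assumes \<Gamma>: "subgroup \<Gamma> (BijGroup Nbar)" "\<Gamma> \<subseteq> \<G>" "discrete \<Gamma>"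
    and R: "open R" "R \<noteq> {}" and \<phi>: "continuous_on R \<phi>" "\<phi> ` R \<subseteq> Nbar"
  obtains B where "open B" "B \<noteq> {}" "B \<subseteq> R" "\<And>p \<gamma>. p \<in> \<phi> ` B \<Longrightarrow> \<gamma> \<in> \<Gamma> \<Longrightarrow> \<gamma> p \<in> \<phi> ` B \<Longrightarrow> \<gamma> p = p"
proof -
  from R obtain q0 where q0: "q0 \<in> R" by blast
  with \<phi> have "\<phi> q0 \<in> Nbar" by auto
  from finite_moving_near[OF \<Gamma> this] obtain V where V: "open V" "\<phi> q0 \<in> V" "V \<subseteq> Nbar"
    and fin: "finite {\<gamma> \<in> \<Gamma>. \<exists>p\<in>V. \<gamma> p \<in> V}" .
  have "\<exists>B. open B \<and> B \<noteq> {} \<and> B \<subseteq> R \<inter> \<phi> -` V \<and> (\<forall>\<gamma>\<in>F. \<forall>p\<in>\<phi> ` B. \<gamma> p \<in> \<phi> ` B \<longrightarrow> \<gamma> p = p)"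
    if "finite F" "F \<subseteq> \<Gamma>" for F
    using that
  proof (induction F)
    case empty
    have "open (R \<inter> \<phi> -` V)"
      using continuous_open_preimage[OF \<phi>(1) R(1) V(1)] .
    with q0 V show ?case by (intro exI[of _ "R \<inter> \<phi> -` V"]) auto
  next
    case (insert \<gamma> F)
    then obtain B where B: "open B" "B \<noteq> {}" "B \<subseteq> R \<inter> \<phi> -` V" "\<forall>\<gamma>\<in>F. \<forall>p\<in>\<phi> ` B. \<gamma> p \<in> \<phi> ` B \<longrightarrow> \<gamma> p = p"
      by auto
    show ?case
    proof (cases "\<forall>p\<in>\<phi> ` B. \<gamma> p = p")
      case True
      with B show ?thesis by (intro exI[of _ B]) auto
    next
      case False
      then obtain q where q: "q \<in> B" "\<gamma> (\<phi> q) \<noteq> \<phi> q" by auto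
      obtain U W where UW: "open U" "open W" "\<gamma> (\<phi> q) \<in> U" "\<phi> q \<in> W" "U \<inter> W = {}"
        using hausdorff[OF q(2)] by blast
      have c1: "continuous_on B \<phi>" using \<phi>(1) B(3) by (auto intro: continuous_on_subset)
      have "continuous_on Nbar \<gamma>"
        using isCont_\<G> insert.prems \<Gamma>(2) by (intro continuous_at_imp_continuous_on) auto
      then have c2: "continuous_on B (\<lambda>q. \<gamma> (\<phi> q))"
        by (rule continuous_on_compose2[OF _ c1]) (use B(3) \<phi>(2) in auto)
      define B' where "B' = (B \<inter> (\<lambda>q. \<gamma> (\<phi> q)) -` U) \<inter> (B \<inter> \<phi> -` W)"
      have B': "open B'"
        unfolding B'_def by (intro open_Int continuous_open_preimage c1 c2 B(1) UW)
      have "q \<in> B'" using q(1) UW(3,4) by (simp add: B'_def)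
      then have ne: "B' \<noteq> {}" by blast
      have moved: "\<gamma> p \<notin> \<phi> ` B'" if "p \<in> \<phi> ` B'" for p
      proof
        assume "\<gamma> p \<in> \<phi> ` B'"
        then have "\<gamma> p \<in> W" by (auto simp: B'_def)
        moreover have "\<gamma> p \<in> U" using that by (auto simp: B'_def)
        ultimately show False using UW(5) by blast
      qed
      have sub: "B' \<subseteq> B" by (auto simp: B'_def)
      have "\<gamma>' p = p" if "\<gamma>' \<in> insert \<gamma> F" "p \<in> \<phi> ` B'" "\<gamma>' p \<in> \<phi> ` B'" for \<gamma>' p
      proof -
        have "\<gamma>' \<in> F" using that moved by blast
        moreover have "p \<in> \<phi> ` B" "\<gamma>' p \<in> \<phi> ` B" using that(2,3) sub by blast+
        ultimately show ?thesis using B(4) by blast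
      qed
      with B' ne sub B(3) show ?thesis by (intro exI[of _ B']) auto
    qed
  qed
  note this[OF fin]
  moreover have "{\<gamma> \<in> \<Gamma>. \<exists>p\<in>V. \<gamma> p \<in> V} \<subseteq> \<Gamma>" by blast
  ultimately obtain B where B: "open B" "B \<noteq> {}" "B \<subseteq> R \<inter> \<phi> -` V"
    and inj: "\<forall>\<gamma>\<in>{\<gamma> \<in> \<Gamma>. \<exists>p\<in>V. \<gamma> p \<in> V}. \<forall>p\<in>\<phi> ` B. \<gamma> p \<in> \<phi> ` B \<longrightarrow> \<gamma> p = p"
    by meson
  show ?thesis
  proof (rule that[OF B(1,2)])
    \<comment> \<open>An element outside the finite set carries no point of \<open>V\<close> into
      \<open>V\<close>, whereas here p and its image both lie in \<open>V\<close>.\<close>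
    show "\<gamma> p = p" if "p \<in> \<phi> ` B" "\<gamma> \<in> \<Gamma>" "\<gamma> p \<in> \<phi> ` B" for p \<gamma>
    proof -
      have "\<phi> ` B \<subseteq> V" using B(3) by blast
      with that inj show ?thesis by blast
    qed
  qed (use B(3) in auto)
qed

section \<open>Volumes\<close>

text \<open>The density of the fibre over x without its factor x_1, with r = \<open>q $ 3\<close>
  and \<rho> = \<open>q $ 4\<close>; it is the same for all fibres.\<close>

definition fiber_density :: "real^11 \<Rightarrow> real" where
  "fiber_density q = sqrt (3 / 2 ^ 31) / ((q $ 3) ^ 3 * (q $ 4) ^ 5)"

definition total_density :: "real^12 \<Rightarrow> real" where
  "total_density q = 1 / (2 ^ 16 * (q $ 3 * q $ 4)\<^sup>2 * (q $ 5) ^ 5)"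

definition fiber_content :: "(real^11) set \<Rightarrow> ennreal" where
  "fiber_content V = (\<integral>\<^sup>+ q. indicator (fiber_dom \<inter> V) q * ennreal (fiber_density q) \<partial>lborel)"

definition total_content :: "(real^12) set \<Rightarrow> ennreal" where
  "total_content V = (\<integral>\<^sup>+ q. indicator (total_chart -` Nbar \<inter> V) q * ennreal (total_density q) \<partial>lborel)"

lemma total_dom_iff: "q \<in> total_chart -` Nbar \<longleftrightarrow> q $ 3 > 0 \<and> q $ 4 > 0 \<and> q $ 5 > 0"
  by (simp add: Nbar_iff total_chart_def)

lemma fiber_density_pos: "q \<in> fiber_dom \<Longrightarrow> fiber_density q > 0"
  by (simp add: fiber_density_def fiber_dom_def)

lemma sqrt_det_gram_fiber:
  assumes "x \<in> \<H>" "q \<in> fiber_dom"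
  shows "sqrt (det (gram g_N (fiber_chart x) q)) = x $ 1 * fiber_density q"
proof (rule real_sqrt_unique)
  have "((q $ 3) ^ 3 * (q $ 4) ^ 5)\<^sup>2 = (q $ 3) ^ 6 * (q $ 4) ^ 10"
    by (simp add: power_mult_distrib flip: power_mult)
  then show "(x $ 1 * fiber_density q)\<^sup>2 = det (gram g_N (fiber_chart x) q)"
    by (simp add: det_gram_fiber[OF assms] fiber_density_def power_mult_distrib power_divide)
  show "0 \<le> x $ 1 * fiber_density q"
    using fiber_density_pos[OF assms(2)] \<H>_pos[OF assms(1)] by simp
qed

lemma sqrt_det_gram_total:
  assumes "q \<in> total_chart -` Nbar"
  shows "sqrt (det (gram g_N total_chart q)) = total_density q"
proof (rule real_sqrt_unique)
  have q: "q $ 3 > 0" "q $ 4 > 0" "q $ 5 > 0" using assms by (auto simp only: total_dom_iff)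
  have "(2 ^ 16 * (q $ 3 * q $ 4)\<^sup>2 * (q $ 5) ^ 5)\<^sup>2 = 2 ^ 32 * (q $ 3) ^ 4 * (q $ 4) ^ 4 * (q $ 5) ^ 10"
    by (simp add: power_mult_distrib flip: power_mult)
  then show "(total_density q)\<^sup>2 = det (gram g_N total_chart q)"
    by (simp add: det_gram_total[OF q] total_density_def power_divide)
  show "0 \<le> total_density q"
    using q by (simp add: total_density_def)
qed

section \<open>The volume measures in the charts\<close>

lemma continuous_on_linear_image: "linear (f :: 'a::euclidean_space \<Rightarrow> 'b::real_normed_vector) \<Longrightarrow> continuous_on S f"
  by (simp add: linear_continuous_on linear_conv_bounded_linear)

lemma fiber_chart_measurable [measurable]: "fiber_chart x \<in> borel_measurable borel"
  by (intro borel_measurable_continuous_onI continuous_on_linear_image linear_fiber_chart)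

lemma total_chart_measurable [measurable]: "total_chart \<in> borel_measurable borel"
  by (intro borel_measurable_continuous_onI continuous_on_linear_image linear_total_chart)

lemma vec_nth_measurable: "(\<lambda>q :: real^'n. q $ i) \<in> borel_measurable borel"
  by (intro borel_measurable_continuous_onI continuous_intros)

lemma fiber_dom_borel [measurable]: "fiber_dom \<in> sets borel"
  unfolding fiber_dom_def by (intro borel_open open_Collect_conj open_Collect_less continuous_intros)

lemma total_dom_borel [measurable]: "total_chart -` Nbar \<in> sets borel"
  using measurable_sets[OF total_chart_measurable borel_open[OF open_Nbar]] by simp

lemma density_measurable [measurable]:
  "fiber_density \<in> borel_measurable borel" "total_density \<in> borel_measurable borel"
  unfolding fiber_density_def[abs_def] total_density_def[abs_def]
  using vec_nth_measurable[measurable] by measurable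

lemma fiber_integrand_measurable:
  "V \<in> sets borel \<Longrightarrow> (\<lambda>q. indicator V q * ennreal (fiber_density q)) \<in> borel_measurable lborel"
  using density_measurable(1)
  by (auto intro!: borel_measurable_times_ennreal borel_measurable_indicator
    measurable_compose[OF _ measurable_ennreal])

lemma total_integrand_measurable:
  "V \<in> sets borel \<Longrightarrow> (\<lambda>q. indicator V q * ennreal (total_density q)) \<in> borel_measurable lborel"
  using density_measurable(2)
  by (auto intro!: borel_measurable_times_ennreal borel_measurable_indicator
    measurable_compose[OF _ measurable_ennreal])

lemma emeasure_fiber_measure:
  assumes x: "x \<in> \<H>" and B: "B \<in> sets borel"
  shows "emeasure (fiber_measure x) B = ennreal (x $ 1) * fiber_content (fiber_chart x -` B)"
proof -
  let ?f = "\<lambda>q. ennreal (x $ 1) * (indicator fiber_dom q * ennreal (fiber_density q))"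
  have V: "fiber_chart x -` B \<in> sets borel"
    using measurable_sets[OF fiber_chart_measurable B] by simp
  have "indicator fiber_dom q * ennreal (sqrt (det (gram g_N (fiber_chart x) q))) = ?f q" for q
    using \<H>_pos[OF x] fiber_density_pos[of q]
    by (cases "q \<in> fiber_dom") (simp_all add: sqrt_det_gram_fiber[OF x] ennreal_mult less_imp_le)
  then have "fiber_measure x = distr (density lborel ?f) borel (fiber_chart x)"
    by (simp add: fiber_measure_def riem_measure_def)
  then have "emeasure (fiber_measure x) B = emeasure (density lborel ?f) (fiber_chart x -` B)"
    using B by (simp add: emeasure_distr)
  also have "\<dots> = (\<integral>\<^sup>+ q. ennreal (x $ 1) * (indicator (fiber_dom \<inter> (fiber_chart x -` B)) q * ennreal (fiber_density q)) \<partial>lborel)"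
    using V by (subst emeasure_density) (auto intro!: nn_integral_cong simp: indicator_def)
  also have "\<dots> = ennreal (x $ 1) * fiber_content (fiber_chart x -` B)"
    unfolding fiber_content_def
    by (intro nn_integral_cmult fiber_integrand_measurable sets.Int V fiber_dom_borel)
  finally show ?thesis .
qed

lemma emeasure_total_measure:
  assumes B: "B \<in> sets borel"
  shows "emeasure total_measure B = total_content (total_chart -` B)"
proof -
  let ?f = "\<lambda>q. indicator (total_chart -` Nbar) q * ennreal (total_density q)"
  have V: "total_chart -` B \<in> sets borel"
    using measurable_sets[OF total_chart_measurable B] by simp
  have "indicator (total_chart -` Nbar) q * ennreal (sqrt (det (gram g_N total_chart q))) = ?f q" for q
    by (cases "q \<in> total_chart -` Nbar") (simp_all add: sqrt_det_gram_total)
  then have tm: "total_measure = distr (density lborel ?f) borel total_chart"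
    by (simp add: total_measure_def riem_measure_def)
  have "total_chart \<in> measurable (density lborel ?f) borel"
    using total_chart_measurable by simp
  then have "emeasure total_measure B = emeasure (density lborel ?f) (total_chart -` B)"
    unfolding tm by (subst emeasure_distr[OF _ B]) simp_all
  also have "\<dots> = total_content (total_chart -` B)"
    unfolding total_content_def using V total_integrand_measurable[OF total_dom_borel]
    by (subst emeasure_density) (auto intro!: nn_integral_cong simp: indicator_def simp del: vimage_eq)
  finally show ?thesis .
qed

lemma sets_fiber_measure: "sets (fiber_measure x) = sets borel" and sets_total_measure: "sets total_measure = sets borel"
  by (simp_all add: fiber_measure_def total_measure_def riem_measure_def)

text \<open>The unit of \<H> under componentwise multiplication, with arc-length parameter 0.
  Stretching by x takes its fibre to the fibre over x, and the constants C in
  \<open>corollary3p30\<close> are volumes over this point.\<close>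

definition base_point :: "real^2" where "base_point = vector [1, 1]"

lemma base_point_in_\<H>: "base_point \<in> \<H>"
  by (simp add: base_point_def \<H>_def)

section \<open>Transport of fibre volumes by stretching\<close>

lemma stretch_fiber_chart: "stretch x (fiber_chart base_point q) = fiber_chart x q"
  by (simp add: stretch_def fiber_chart_def base_point_def vec_eq_iff forall_2 complex_eq_iff)

lemma stretch_inverse:
  assumes "x \<in> \<H>"
  shows "stretch (\<chi> a. 1 / x $ a) (stretch x p) = p" "stretch x (stretch (\<chi> a. 1 / x $ a) p) = p"
  using \<H>_pos[OF assms] by (cases p; simp add: stretch_def vec_eq_iff forall_2 complex_eq_iff)+

lemma continuous_stretch: "continuous_on S (stretch x)"
  by (intro continuous_on_linear_image linearI)
    (simp_all add: stretch_def case_prod_beta prod_eq_iff vec_eq_iff complex_eq_iff algebra_simps)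

lemma inj_stretch: "x \<in> \<H> \<Longrightarrow> inj (stretch x)"
  using stretch_inverse(1) by (metis injI)

lemma stretch_image_borel:
  assumes "x \<in> \<H>" "B \<in> sets borel"
  shows "stretch x ` B \<in> sets borel" "stretch x -` B \<in> sets borel"
proof -
  have m: "stretch y \<in> borel_measurable borel" for y
    by (intro borel_measurable_continuous_onI continuous_stretch)
  have "stretch x ` B = stretch (\<chi> a. 1 / x $ a) -` B"
    using stretch_inverse[OF assms(1)] by (auto simp: image_iff) metis+
  then show "stretch x ` B \<in> sets borel"
    using measurable_sets[OF m assms(2)] by simp
  show "stretch x -` B \<in> sets borel"
    using measurable_sets[OF m assms(2)] by simp
qed

lemma stretch_injective_iff:
  assumes "\<Gamma> \<subseteq> \<G>" "x \<in> \<H>" "B \<subseteq> Nbar"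
  shows "(\<forall>p\<in>stretch x ` B. \<forall>\<gamma>\<in>\<Gamma>. \<gamma> p \<in> stretch x ` B \<longrightarrow> \<gamma> p = p) \<longleftrightarrow>
    (\<forall>p\<in>B. \<forall>\<gamma>\<in>\<Gamma>. \<gamma> p \<in> B \<longrightarrow> \<gamma> p = p)"
proof -
  have "(\<gamma> (stretch x p) \<in> stretch x ` B \<longrightarrow> \<gamma> (stretch x p) = stretch x p) \<longleftrightarrow> (\<gamma> p \<in> B \<longrightarrow> \<gamma> p = p)"
    if "\<gamma> \<in> \<Gamma>" "p \<in> B" for \<gamma> p
  proof -
    have "\<gamma> (stretch x p) = stretch x (\<gamma> p)"
      using \<G>_stretch that assms by blast
    then show ?thesis
      using inj_stretch[OF assms(2)] by (simp add: inj_image_mem_iff inj_eq)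
  qed
  then show ?thesis by blast
qed

lemma quot_vol_stretch:
  assumes \<Gamma>: "\<Gamma> \<subseteq> \<G>" and x: "x \<in> \<H>" and E: "E \<subseteq> Nbar"
  shows "quot_vol (fiber_measure x) \<Gamma> (stretch x ` E) = quot_vol (fiber_measure base_point) \<Gamma> E * ennreal (x $ 1)"
proof -
  let ?S = "\<lambda>E. {B \<in> sets borel. B \<subseteq> E \<and> (\<forall>p\<in>B. \<forall>\<gamma>\<in>\<Gamma>. \<gamma> p \<in> B \<longrightarrow> \<gamma> p = p)}"
  have S: "?S (stretch x ` E) = (`) (stretch x) ` ?S E"
  proof (rule subset_antisym; rule subsetI)
    fix B assume B: "B \<in> ?S (stretch x ` E)"
    let ?B = "stretch x -` B"
    have eq: "B = stretch x ` ?B" using B by auto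
    have sub: "?B \<subseteq> E"
    proof
      fix p assume "p \<in> ?B"
      then have "stretch x p \<in> stretch x ` E" using B by blast
      then show "p \<in> E" by (simp add: inj_image_mem_iff[OF inj_stretch[OF x]])
    qed
    have "(\<forall>p\<in>?B. \<forall>\<gamma>\<in>\<Gamma>. \<gamma> p \<in> ?B \<longrightarrow> \<gamma> p = p)"
      using stretch_injective_iff[OF \<Gamma> x, of ?B] sub E B eq by auto
    then have "?B \<in> ?S E" using B sub stretch_image_borel(2)[OF x] by auto
    with eq show "B \<in> (`) (stretch x) ` ?S E" by blast
  next
    fix B assume "B \<in> (`) (stretch x) ` ?S E"
    then obtain B' where B': "B = stretch x ` B'" "B' \<in> ?S E" by blast
    moreover have "B' \<subseteq> Nbar" using B' E by auto
    ultimately show "B \<in> ?S (stretch x ` E)"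
      using stretch_injective_iff[OF \<Gamma> x, of B'] stretch_image_borel(1)[OF x] by auto
  qed
  have e: "emeasure (fiber_measure x) (stretch x ` B) = emeasure (fiber_measure base_point) B * ennreal (x $ 1)"
    if "B \<in> sets borel" for B
  proof -
    have "fiber_chart x -` stretch x ` B = fiber_chart base_point -` B"
      unfolding vimage_def stretch_fiber_chart[of x, symmetric] inj_image_mem_iff[OF inj_stretch[OF x]] ..
    then show ?thesis
      by (simp add: emeasure_fiber_measure x base_point_in_\<H> that stretch_image_borel mult.commute)
        (simp add: base_point_def)
  qed
  have "quot_vol (fiber_measure x) \<Gamma> (stretch x ` E) = (SUP B\<in>?S E. emeasure (fiber_measure x) (stretch x ` B))"
    unfolding quot_vol_def sets_fiber_measure S by (simp add: image_image)
  also have "\<dots> = (SUP B\<in>?S E. emeasure (fiber_measure base_point) B * ennreal (x $ 1))"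
    by (intro SUP_cong refl e) simp
  also have "\<dots> = quot_vol (fiber_measure base_point) \<Gamma> E * ennreal (x $ 1)"
    unfolding quot_vol_def sets_fiber_measure by (rule SUP_mult_right_ennreal[symmetric])
  finally show ?thesis .
qed

lemma fiber_chart_image_Nbar: "R \<subseteq> fiber_dom \<Longrightarrow> fiber_chart base_point ` R \<subseteq> Nbar"
  using bij_betw_fiber_chart[OF base_point_in_\<H>] by (auto simp: bij_betw_def fiber_def)

lemma region_volume_eq:
  assumes "\<Gamma> \<subseteq> \<G>" "x \<in> \<H>" "R \<subseteq> fiber_dom"
  shows "region_volume \<Gamma> R x = region_volume \<Gamma> R base_point * ennreal (x $ 1)"
proof -
  have "fiber_chart x ` R = stretch x ` fiber_chart base_point ` R"
    by (simp add: image_image stretch_fiber_chart)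
  then show ?thesis
    unfolding region_volume_def by (simp add: quot_vol_stretch[OF assms(1,2) fiber_chart_image_Nbar[OF assms(3)]])
qed

lemma fiber_volume_eq_region: "x \<in> \<H> \<Longrightarrow> fiber_volume \<Gamma> x = region_volume \<Gamma> fiber_dom x"
  using bij_betw_fiber_chart[of x] by (simp add: fiber_volume_def region_volume_def bij_betw_def)

section \<open>Bounds for quotient volumes\<close>

lemma quot_vol_upper:
  assumes "B \<in> sets \<mu>" "B \<subseteq> E" "\<And>p \<gamma>. p \<in> B \<Longrightarrow> \<gamma> \<in> \<Gamma> \<Longrightarrow> \<gamma> p \<in> B \<Longrightarrow> \<gamma> p = p"
  shows "emeasure \<mu> B \<le> quot_vol \<mu> \<Gamma> E"
  unfolding quot_vol_def using assms by (intro SUP_upper) auto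

lemma quot_vol_le:
  assumes "E \<subseteq> E'" "E' \<in> sets \<mu>"
  shows "quot_vol \<mu> \<Gamma> E \<le> emeasure \<mu> E'"
  unfolding quot_vol_def using assms by (intro SUP_least emeasure_mono) auto

lemma linear_image_compact_borel:
  assumes "linear (f :: 'a::euclidean_space \<Rightarrow> 'b::real_normed_vector)" "compact K"
  shows "f ` K \<in> sets borel"
  using assms by (intro borel_closed compact_imp_closed compact_continuous_image continuous_on_linear_image)

lemma inj_fiber_chart: "inj (fiber_chart base_point)"
proof (rule injI)
  fix p q assume eq: "fiber_chart base_point p = fiber_chart base_point q"
  have "\<forall>i. p $ i = q $ i"
    using eq unfolding all_11
    by (auto simp: fiber_chart_def base_point_def vec_eq_iff forall_2 complex_eq_iff forall_2_option)
  then show "p = q" by (simp add: vec_eq_iff)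
qed

lemma nn_integral_indicator_ge:
  fixes f :: "'a \<Rightarrow> real"
  assumes "K \<in> sets M" "K \<subseteq> V" "\<And>q. q \<in> K \<Longrightarrow> c \<le> f q"
  shows "ennreal c * emeasure M K \<le> (\<integral>\<^sup>+ q. indicator V q * ennreal (f q) \<partial>M)"
proof -
  have "ennreal c * emeasure M K = (\<integral>\<^sup>+ q. ennreal c * indicator K q \<partial>M)"
    using assms(1) by (simp add: nn_integral_cmult_indicator)
  also have "\<dots> \<le> (\<integral>\<^sup>+ q. indicator V q * ennreal (f q) \<partial>M)"
    using assms(2,3) by (intro nn_integral_mono) (auto simp: indicator_def ennreal_leI)
  finally show ?thesis .
qed

lemma emeasure_cbox_cart:
  assumes "\<And>i. a $ i < b $ i"
  shows "emeasure lborel (cbox a b) = ennreal (\<Prod>i\<in>UNIV. b $ i - a $ i)" "(\<Prod>i\<in>UNIV. b $ i - a $ i) > 0"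
proof -
  have "a \<in> cbox a b" using assms by (simp add: mem_box_cart less_imp_le)
  then have "measure lborel (cbox a b) = (\<Prod>i\<in>UNIV. b $ i - a $ i)"
    by (intro content_cbox_cart) auto
  then show "emeasure lborel (cbox a b) = ennreal (\<Prod>i\<in>UNIV. b $ i - a $ i)"
    using emeasure_lborel_cbox_finite[of a b] by (simp add: emeasure_eq_ennreal_measure)
  show "(\<Prod>i\<in>UNIV. b $ i - a $ i) > 0"
    using assms by (intro prod_pos) simp
qed

lemma open_contains_cbox_cart:
  fixes A :: "(real^'n) set"
  assumes "open A" "A \<noteq> {}"
  obtains a b where "cbox a b \<subseteq> A" "\<And>i. a $ i < b $ i"
proof -
  obtain x where "x \<in> A" using assms by blast
  from open_contains_cbox[OF assms(1) this] obtain a b where ab: "cbox a b \<subseteq> A" "\<forall>i\<in>Basis. a \<bullet> i < b \<bullet> i"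
    by metis
  have "a $ i < b $ i" for i
    using ab(2)[rule_format, of "axis i 1"] by (auto simp: Basis_vec_def inner_axis)
  with ab(1) that show ?thesis by blast
qed

lemma region_volume_pos:
  assumes \<Gamma>: "subgroup \<Gamma> (BijGroup Nbar)" "\<Gamma> \<subseteq> \<G>" "discrete \<Gamma>"
    and R: "open R" "R \<noteq> {}" "R \<subseteq> fiber_dom"
  shows "region_volume \<Gamma> R base_point > 0"
proof -
  let ?\<phi> = "fiber_chart base_point"
  obtain B where B: "open B" "B \<noteq> {}" "B \<subseteq> R"
    and inj: "\<And>p \<gamma>. p \<in> ?\<phi> ` B \<Longrightarrow> \<gamma> \<in> \<Gamma> \<Longrightarrow> \<gamma> p \<in> ?\<phi> ` B \<Longrightarrow> \<gamma> p = p"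
    by (rule ex_injective_open[OF \<Gamma> R(1,2) continuous_on_linear_image[OF linear_fiber_chart]
          fiber_chart_image_Nbar[OF R(3)]]) blast
  obtain a b where K: "cbox a b \<subseteq> B" "\<And>i. a $ i < b $ i"
    by (rule open_contains_cbox_cart[OF B(1,2)]) blast
  let ?K = "cbox a b"
  have dom: "?K \<subseteq> fiber_dom" using K(1) B(3) R(3) by blast
  have ab: "a \<in> ?K" "b \<in> ?K" using K(2) by (simp_all add: mem_box_cart less_imp_le)
  then have pos: "b $ 3 > 0" "b $ 4 > 0" using dom by (auto simp: fiber_dom_def)
  have P: "?\<phi> ` ?K \<in> sets borel" by (intro linear_image_compact_borel linear_fiber_chart compact_cbox)
  \<comment> \<open>The density decreases in r and in \<rho>, so on the box it is smallest at the
    upper corner \<open>b\<close>.\<close>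
  have "fiber_density b \<le> fiber_density q" if "q \<in> ?K" for q
  proof -
    have "q \<in> fiber_dom" using that dom by blast
    moreover have "q $ 3 \<le> b $ 3" "q $ 4 \<le> b $ 4"
      using that by (auto simp: mem_box_cart)
    ultimately show ?thesis
      unfolding fiber_density_def fiber_dom_def
      by (intro divide_left_mono mult_mono power_mono) auto
  qed
  then have "ennreal (fiber_density b) * emeasure lborel ?K \<le> fiber_content (?\<phi> -` ?\<phi> ` ?K)"
    unfolding fiber_content_def using dom by (intro nn_integral_indicator_ge) auto
  also have "\<dots> = emeasure (fiber_measure base_point) (?\<phi> ` ?K)"
    unfolding emeasure_fiber_measure[OF base_point_in_\<H> P] by (simp add: base_point_def)
  also have "\<dots> \<le> region_volume \<Gamma> R base_point"
    unfolding region_volume_def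
  proof (rule quot_vol_upper)
    have sub: "?\<phi> ` ?K \<subseteq> ?\<phi> ` B" using K(1) by blast
    show "\<gamma> p = p" if "p \<in> ?\<phi> ` ?K" "\<gamma> \<in> \<Gamma>" "\<gamma> p \<in> ?\<phi> ` ?K" for p \<gamma>
      by (rule inj[OF subsetD[OF sub that(1)] that(2) subsetD[OF sub that(3)]])
    show "?\<phi> ` ?K \<subseteq> ?\<phi> ` R" using K(1) B(3) by blast
  qed (simp add: sets_fiber_measure P)
  finally have "ennreal (fiber_density b) * emeasure lborel ?K \<le> region_volume \<Gamma> R base_point" .
  moreover have "fiber_density b > 0"
    using ab(2) dom by (blast intro: fiber_density_pos)
  then have "ennreal (fiber_density b) * emeasure lborel ?K > 0"
    unfolding emeasure_cbox_cart(1)[OF K(2)] using emeasure_cbox_cart(2)[OF K(2)]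
    by (simp add: ennreal_zero_less_mult_iff)
  ultimately show ?thesis by (simp add: less_le_trans)
qed

text \<open>A quotient volume is at most the volume upstairs. There the density, which blows up for
  r or \<rho> tending to 0, is bounded on a compact closure inside \<open>fiber_dom\<close>.\<close>

lemma region_volume_finite:
  assumes R: "compact (closure R)" "closure R \<subseteq> fiber_dom"
  shows "region_volume \<Gamma> R base_point < \<infinity>"
proof -
  let ?\<phi> = "fiber_chart base_point" and ?K = "closure R"
  have "continuous_on ?K fiber_density"
    using R(2) unfolding fiber_density_def[abs_def] by (intro continuous_intros) (auto simp: fiber_dom_def)
  then have "bounded (fiber_density ` ?K)"
    using R(1) by (intro compact_imp_bounded compact_continuous_image)
  then obtain M where M: "\<And>q. q \<in> ?K \<Longrightarrow> fiber_density q \<le> M"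
    unfolding bounded_iff by (auto simp: abs_le_iff)
  have P: "?\<phi> ` ?K \<in> sets borel" by (intro linear_image_compact_borel linear_fiber_chart R)
  have "region_volume \<Gamma> R base_point \<le> emeasure (fiber_measure base_point) (?\<phi> ` ?K)"
    unfolding region_volume_def
    by (intro quot_vol_le image_mono closure_subset) (simp add: sets_fiber_measure P)
  also have "\<dots> = fiber_content ?K"
    unfolding emeasure_fiber_measure[OF base_point_in_\<H> P] inj_vimage_image_eq[OF inj_fiber_chart]
    by (simp add: base_point_def)
  also have "\<dots> \<le> (\<integral>\<^sup>+ q. ennreal M * indicator ?K q \<partial>lborel)"
    unfolding fiber_content_def using M by (intro nn_integral_mono) (auto simp: indicator_def ennreal_leI)
  also have "\<dots> = ennreal M * emeasure lborel ?K"
    by (intro nn_integral_cmult_indicator) simp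
  also have "\<dots> < \<infinity>"
    using emeasure_compact_finite[OF R(1)] by (simp add: ennreal_mult_less_top)
  finally show ?thesis .
qed

text \<open>Stretching a small box by \<open>(l, 1 / l\<^sup>2)\<close> multiplies its volume in the total space by \<open>l\<close> and keeps it
  injectively embedded in the quotient.\<close>

lemma total_volume_infinite:
  assumes \<Gamma>: "subgroup \<Gamma> (BijGroup Nbar)" "\<Gamma> \<subseteq> \<G>" "discrete \<Gamma>"
  shows "total_volume \<Gamma> = \<infinity>"
proof -
  let ?D = "total_chart -` Nbar"
  have "open ?D"
    using open_Nbar continuous_on_linear_image[OF linear_total_chart, of UNIV] by (auto intro: open_vimage)
  moreover have "(\<chi> i. 1) \<in> ?D" by (simp only: total_dom_iff) simp
  ultimately obtain B where B: "open B" "B \<noteq> {}" "B \<subseteq> ?D"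
    and inj: "\<And>p \<gamma>. p \<in> total_chart ` B \<Longrightarrow> \<gamma> \<in> \<Gamma> \<Longrightarrow> \<gamma> p \<in> total_chart ` B \<Longrightarrow> \<gamma> p = p"
    using ex_injective_open[OF \<Gamma> _ _ continuous_on_linear_image[OF linear_total_chart], of ?D]
    by (metis empty_iff image_vimage_subset)
  obtain a b where K: "cbox a b \<subseteq> B" and ab: "\<And>i. a $ i < b $ i"
    by (rule open_contains_cbox_cart[OF B(1,2)]) blast
  have dom: "cbox a b \<subseteq> ?D" using K B(3) by blast
  have "a \<in> cbox a b" "b \<in> cbox a b" using ab by (simp_all add: mem_box_cart less_imp_le)
  with dom have "a \<in> ?D" "b \<in> ?D" by blast+
  then have pos: "a $ 3 > 0" "a $ 4 > 0" "a $ 5 > 0" "b $ 3 > 0" "b $ 4 > 0" "b $ 5 > 0"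
    by (simp_all only: total_dom_iff)
  define c where "c = total_density b * (\<Prod>i\<in>UNIV. b $ i - a $ i)"
  have c: "c > 0"
    unfolding c_def using emeasure_cbox_cart(2)[OF ab] pos by (simp add: total_density_def)
  have *: "ennreal (l * c) \<le> total_volume \<Gamma>" if l: "l > 0" for l :: real
  proof -
    define x :: "real^2" where "x = vector [l, 1 / l\<^sup>2]"
    \<comment> \<open>\<open>sc\<close> is the stretching by \<open>x\<close> read in the chart and
      \<open>us\<close> is its inverse; both act on the coordinates 3 and 4, which hold t.\<close>
    define sc :: "real^12 \<Rightarrow> real^12" where "sc q = (\<chi> i. (if i = 3 then l else if i = 4 then 1 / l\<^sup>2 else 1) * q $ i)" for q
    define us :: "real^12 \<Rightarrow> real^12" where "us q = (\<chi> i. q $ i / (if i = 3 then l else if i = 4 then 1 / l\<^sup>2 else 1))" for q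
    have x: "x \<in> \<H>" using l by (simp add: x_def \<H>_def)
    have chart: "total_chart (sc q) = stretch x (total_chart q)" for q
      by (simp add: total_chart_def stretch_def x_def sc_def vec_eq_iff forall_2 complex_eq_iff)
    have sc_us: "sc (us q) = q" for q
      using l by (simp add: sc_def us_def vec_eq_iff)
    let ?K = "cbox (sc a) (sc b)"
    have us: "us q \<in> cbox a b" if "q \<in> ?K" for q
    proof -
      have "\<forall>i. sc a $ i \<le> q $ i \<and> q $ i \<le> sc b $ i" using that by (simp add: mem_box_cart)
      then show ?thesis
        using l by (auto simp: mem_box_cart us_def sc_def field_simps)
    qed
    have sub: "total_chart ` ?K \<subseteq> stretch x ` total_chart ` B"
    proof
      fix p assume "p \<in> total_chart ` ?K"
      then obtain q where q: "q \<in> ?K" "p = total_chart q" by blast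
      then have "p = stretch x (total_chart (us q))" by (simp add: sc_us flip: chart)
      with us[OF q(1)] K show "p \<in> stretch x ` total_chart ` B" by blast
    qed
    have BN: "total_chart ` B \<subseteq> Nbar" using B(3) by blast
    have KN: "total_chart ` ?K \<subseteq> Nbar"
    proof
      fix p assume "p \<in> total_chart ` ?K"
      then obtain p' where "p' \<in> total_chart ` B" "p = stretch x p'" using sub by blast
      with BN show "p \<in> Nbar" using stretch_in_Nbar[OF x, of p'] by blast
    qed
    have inj_x: "\<gamma> p = p" if "p \<in> stretch x ` total_chart ` B" "\<gamma> \<in> \<Gamma>" "\<gamma> p \<in> stretch x ` total_chart ` B" for p \<gamma>
    proof -
      have "\<forall>p\<in>total_chart ` B. \<forall>\<gamma>\<in>\<Gamma>. \<gamma> p \<in> total_chart ` B \<longrightarrow> \<gamma> p = p"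
        using inj by blast
      then show ?thesis
        unfolding stretch_injective_iff[OF \<Gamma>(2) x BN, symmetric] using that by blast
    qed
    have P: "total_chart ` ?K \<in> sets borel"
      by (intro linear_image_compact_borel linear_total_chart compact_cbox)
    have sc_less: "sc a $ i < sc b $ i" for i
      using ab l by (simp add: sc_def divide_strict_right_mono)
    \<comment> \<open>On the curve the two stretching factors multiply to 1 / l. The density
      contains (t_1 t_2)^-2 and so gains l^2, while the Lebesgue measure of the box loses a factor
      l; this leaves the factor l.\<close>
    have dens: "l\<^sup>2 * total_density b \<le> total_density q" if q: "q \<in> ?K" for q
    proof -
      have "q $ 3 \<le> l * b $ 3" "q $ 4 \<le> b $ 4 / l\<^sup>2" "q $ 5 \<le> b $ 5"
        using q[unfolded mem_box_cart] by (auto simp: sc_def dest: spec[of _ 3] spec[of _ 4] spec[of _ 5])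
      moreover have q0: "q $ 3 > 0" "q $ 4 > 0" "q $ 5 > 0"
        using q KN total_dom_iff by blast+
      ultimately have "q $ 3 * q $ 4 \<le> (l * b $ 3) * (b $ 4 / l\<^sup>2)"
        using l pos by (intro mult_mono) auto
      also have "\<dots> = b $ 3 * b $ 4 / l" using l by (simp add: power2_eq_square)
      finally have "2 ^ 16 * (q $ 3 * q $ 4)\<^sup>2 * (q $ 5) ^ 5 \<le> 2 ^ 16 * (b $ 3 * b $ 4 / l)\<^sup>2 * (b $ 5) ^ 5"
        using q0 \<open>q $ 5 \<le> b $ 5\<close> pos l by (intro mult_mono power_mono) auto
      then have "1 / (2 ^ 16 * (b $ 3 * b $ 4 / l)\<^sup>2 * (b $ 5) ^ 5) \<le> total_density q"
        unfolding total_density_def using q0 pos l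
        by (intro divide_left_mono mult_pos_pos zero_less_power divide_pos_pos) auto
      moreover have "1 / (2 ^ 16 * (b $ 3 * b $ 4 / l)\<^sup>2 * (b $ 5) ^ 5) = l\<^sup>2 * total_density b"
        using l pos by (simp add: total_density_def power_divide)
      ultimately show ?thesis by simp
    qed
    have "(\<Prod>i\<in>UNIV. sc b $ i - sc a $ i) = (\<Prod>i\<in>UNIV. b $ i - a $ i) / l"
    proof -
      have "sc b $ i - sc a $ i = (if i = 3 then l else if i = 4 then 1 / l\<^sup>2 else 1) * (b $ i - a $ i)" for i
        by (simp add: sc_def algebra_simps diff_divide_distrib)
      then have "(\<Prod>i\<in>UNIV. sc b $ i - sc a $ i) =
        (\<Prod>i\<in>(UNIV :: 12 set). if i = 3 then l else if i = 4 then 1 / l\<^sup>2 else 1) * (\<Prod>i\<in>UNIV. b $ i - a $ i)"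
        by (simp only: prod.distrib)
      also have "(\<Prod>i\<in>(UNIV :: 12 set). if i = 3 then l else if i = 4 then 1 / l\<^sup>2 else 1) = 1 / l"
        using l unfolding prod_12 by (simp add: power2_eq_square)
      finally show ?thesis by simp
    qed
    then have vol: "emeasure lborel ?K = ennreal ((\<Prod>i\<in>UNIV. b $ i - a $ i) / l)"
      using emeasure_cbox_cart(1)[OF sc_less] by simp
    have "l * c = l\<^sup>2 * total_density b * ((\<Prod>i\<in>UNIV. b $ i - a $ i) / l)"
      using l by (simp add: c_def power2_eq_square)
    then have "ennreal (l * c) = ennreal (l\<^sup>2 * total_density b) * emeasure lborel ?K"
      unfolding vol using emeasure_cbox_cart(2)[OF ab] pos l
      by (simp add: total_density_def ennreal_mult[symmetric])
    also have "\<dots> \<le> total_content (total_chart -` total_chart ` ?K)"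
      unfolding total_content_def
    proof (rule nn_integral_indicator_ge)
      show "?K \<subseteq> ?D \<inter> total_chart -` total_chart ` ?K" using KN by blast
    qed (simp_all only: dens sets_lborel cbox_borel)
    also have "\<dots> = emeasure total_measure (total_chart ` ?K)"
      by (rule emeasure_total_measure[OF P, symmetric])
    also have "\<dots> \<le> total_volume \<Gamma>"
      unfolding total_volume_def
    proof (rule quot_vol_upper)
      show "\<gamma> p = p" if "p \<in> total_chart ` ?K" "\<gamma> \<in> \<Gamma>" "\<gamma> p \<in> total_chart ` ?K" for p \<gamma>
        by (rule inj_x[OF subsetD[OF sub that(1)] that(2) subsetD[OF sub that(3)]])
      show "total_chart ` ?K \<subseteq> Nbar" by (rule KN)
      show "total_chart ` ?K \<in> sets total_measure" unfolding sets_total_measure by (rule P)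
    qed
    finally show ?thesis .
  qed
  show ?thesis
  \<comment> \<open>A finite value r is refuted by l = (r + 1) / c, for which the lower bound l c is
    r + 1.\<close>
  proof (cases "total_volume \<Gamma>")
    case (real r)
    have "ennreal ((r + 1) / c * c) \<le> ennreal r"
      using *[of "(r + 1) / c"] c real by simp
    then show ?thesis using c real by (simp add: ennreal_le_iff)
  qed simp
qed

theorem corollary3p30:
  fixes \<Gamma> :: "(pt \<Rightarrow> pt) set"
  assumes "lattice_in_G \<Gamma>"
  shows "\<exists>\<kappa>>0.
       (\<exists>C>0. \<forall>x\<in>\<H>. fiber_volume \<Gamma> x = C * ennreal (exp (\<kappa> * arc_param x)))
     \<and> (\<forall>R\<in>sets borel. R \<subseteq> fiber_dom \<longrightarrow>
          (\<exists>C. (\<forall>x\<in>\<H>. region_volume \<Gamma> R x = C * ennreal (exp (\<kappa> * arc_param x)))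
             \<and> (open R \<and> R \<noteq> {} \<longrightarrow> C > 0)
             \<and> (compact (closure R) \<and> closure R \<subseteq> fiber_dom \<longrightarrow> C < \<infinity>)))
     \<and> total_volume \<Gamma> = \<infinity>"
proof -
  have \<Gamma>: "subgroup \<Gamma> (BijGroup Nbar)" "\<Gamma> \<subseteq> \<G>" "discrete \<Gamma>"
    using assms by (auto simp: lattice_in_G_def)
  \<comment> \<open>Inverts s = sqrt 6 log x_1: the scaling factor of the volumes is exp (s / sqrt
    6), which fixes \<kappa>.\<close>
  have x1: "exp (1 / sqrt 6 * arc_param x) = x $ 1" if "x \<in> \<H>" for x
    using \<H>_pos[OF that] by (simp add: arc_param_def)
  have region: "region_volume \<Gamma> R x = region_volume \<Gamma> R base_point * ennreal (exp (1 / sqrt 6 * arc_param x))"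
    if "R \<subseteq> fiber_dom" "x \<in> \<H>" for R x
    using region_volume_eq[OF \<Gamma>(2) that(2,1)] x1[OF that(2)] by simp
  have dom: "open fiber_dom" "fiber_dom \<noteq> {}"
  proof -
    show "open fiber_dom"
      unfolding fiber_dom_def by (intro open_Collect_conj open_Collect_less continuous_intros)
    have "(\<chi> i. 1) \<in> fiber_dom" by (simp add: fiber_dom_def)
    then show "fiber_dom \<noteq> {}" by blast
  qed
  show ?thesis
  proof (intro exI[of _ "1 / sqrt 6"] conjI ballI impI)
    show "\<exists>C>0. \<forall>x\<in>\<H>. fiber_volume \<Gamma> x = C * ennreal (exp (1 / sqrt 6 * arc_param x))"
      \<comment> \<open>The whole fibre is the case of the region \<open>fiber_dom\<close>. Its
        closure meets r = 0 and \<rho> = 0, so here the constant is only shown to be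
        positive.\<close>
      using region_volume_pos[OF \<Gamma> dom] region
      by (intro exI[of _ "region_volume \<Gamma> fiber_dom base_point"]) (simp add: fiber_volume_eq_region)
    show "\<exists>C. (\<forall>x\<in>\<H>. region_volume \<Gamma> R x = C * ennreal (exp (1 / sqrt 6 * arc_param x)))
             \<and> (open R \<and> R \<noteq> {} \<longrightarrow> C > 0)
             \<and> (compact (closure R) \<and> closure R \<subseteq> fiber_dom \<longrightarrow> C < \<infinity>)"
      if "R \<subseteq> fiber_dom" for R
      using region_volume_pos[OF \<Gamma> _ _ that] region_volume_finite[of R] region[OF that]
      by (intro exI[of _ "region_volume \<Gamma> R base_point"]) simp
    show "total_volume \<Gamma> = \<infinity>" by (rule total_volume_infinite[OF \<Gamma>])
  qed simp
qed

end
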